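(* Let $n\in\mathbb{N}$, $n\ge3$. For $\sigma\in(0,1)$ let $\lambda_{1,L,(n)}(\sigma)$ be the first eigenvalue of the Laplace operator (with vanishing Dirichlet traces) on $\Omega^*_{(n),\sigma}$ and let $\lambda_{1,L,(n)}(o)$ be the first eigenvalue of the Laplace operator (with vanishing Dirichlet traces) on the open unit ball $\Omega^*_{(n)}$. Then $$\lim_{\sigma\to0}\lambda_{1,L,(n)}(\sigma)=\lambda_{1,L,(n)}(o).$$
   Context: $\|\cdot\|$ is the Euclidean norm on $\mathbb{R}^n$. $\Omega^*_{(n)}:=\{x\in\mathbb{R}^n:\|x\|<1\}$ and, for $\sigma\in(0,1)$, $\Omega^*_{(n),\sigma}:=\{x\in\mathbb{R}^n:\sigma<\|x\|<1\}$. The Laplace operator on $\Omega$ is the Friedrichs extension in $L_2(\Omega)$ of $-\Delta$ on $C_c^\infty(\Omega)$ (positive Dirichlet Laplacian). First eigenvalue means smallest eigenvalue. *)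

theory Defs
  imports "HOL-Analysis.Analysis"
begin

section \<open>Smooth functions, test functions, the Laplacian\<close>

fun k_times_differentiable ::
  "nat \<Rightarrow> ('a::real_normed_vector \<Rightarrow> 'b::real_normed_vector) \<Rightarrow> bool" where
  "k_times_differentiable 0 f \<longleftrightarrow> continuous_on UNIV f"
| "k_times_differentiable (Suc k) f \<longleftrightarrow>
     (\<forall>x. f differentiable (at x)) \<and>
     (\<forall>v. k_times_differentiable k (\<lambda>x. frechet_derivative f (at x) v))"

definition smooth :: "('a::real_normed_vector \<Rightarrow> 'b::real_normed_vector) \<Rightarrow> bool" where
  "smooth f \<longleftrightarrow> (\<forall>k. k_times_differentiable k f)"

text \<open>An element of \<open>C\<^sub>c\<^sup>\<infinity>(\<Omega>)\<close> is represented by its extension by zero to the whole space.\<close>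

definition test_functions :: "'a::euclidean_space set \<Rightarrow> ('a \<Rightarrow> complex) set" where
  "test_functions \<Omega> =
     {\<phi>. smooth \<phi> \<and> compact (closure {x. \<phi> x \<noteq> 0}) \<and> closure {x. \<phi> x \<noteq> 0} \<subseteq> \<Omega>}"

definition partial_derivative ::
  "'a::euclidean_space \<Rightarrow> ('a \<Rightarrow> complex) \<Rightarrow> 'a \<Rightarrow> complex" where
  "partial_derivative b f x = frechet_derivative f (at x) b"

definition laplacian :: "('a::euclidean_space \<Rightarrow> complex) \<Rightarrow> 'a \<Rightarrow> complex" where
  "laplacian f x = (\<Sum>b\<in>Basis. partial_derivative b (partial_derivative b f) x)"


section \<open>Operators in \<open>L\<^sub>2\<close> and the Friedrichs extension\<close>

text \<open>
  Elements of \<open>L\<^sub>2(M)\<close> are represented by square-integrable functions; no quotient by almost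
  everywhere equality is taken. An operator in \<open>L\<^sub>2(M)\<close> is given by its graph, a set of pairs of
  functions.
\<close>

definition L2 :: "'a measure \<Rightarrow> ('a \<Rightarrow> complex) set" where
  "L2 M = {u. u \<in> borel_measurable M \<and> integrable M (\<lambda>x. (norm (u x))\<^sup>2)}"

definition L2_inner :: "'a measure \<Rightarrow> ('a \<Rightarrow> complex) \<Rightarrow> ('a \<Rightarrow> complex) \<Rightarrow> complex" where
  "L2_inner M u v = (\<integral>x. u x * cnj (v x) \<partial>M)"

definition L2_dist :: "'a measure \<Rightarrow> ('a \<Rightarrow> complex) \<Rightarrow> ('a \<Rightarrow> complex) \<Rightarrow> real" where
  "L2_dist M u v = sqrt (\<integral>x. (norm (u x - v x))\<^sup>2 \<partial>M)"

definition adjoint_graph :: "'a measure \<Rightarrow> ('a \<Rightarrow> complex) rel \<Rightarrow> ('a \<Rightarrow> complex) rel" where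
  "adjoint_graph M A = {(u, f). u \<in> L2 M \<and> f \<in> L2 M \<and>
     (\<forall>(\<phi>, g)\<in>A. L2_inner M g u = L2_inner M \<phi> f)}"

text \<open>
  For a positive symmetric operator \<open>A\<close>, the energy space is the completion of its domain with
  respect to the norm whose square is \<open>\<langle>A\<phi>, \<phi>\<rangle> + \<parallel>\<phi>\<parallel>\<^sup>2\<close>, realised inside \<open>L\<^sub>2(M)\<close> as the \<open>L\<^sub>2\<close>-limits
  of sequences that are Cauchy in this norm. The Friedrichs extension is the restriction of the
  adjoint to the energy space.
\<close>

definition energy_space :: "'a measure \<Rightarrow> ('a \<Rightarrow> complex) rel \<Rightarrow> ('a \<Rightarrow> complex) set" where
  "energy_space M A = {u \<in> L2 M. \<exists>\<phi> g. (\<forall>k::nat. (\<phi> k, g k) \<in> A) \<and>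
     (\<lambda>k. L2_dist M (\<phi> k) u) \<longlonglongrightarrow> 0 \<and>
     (\<forall>e>0. \<exists>N. \<forall>j\<ge>N. \<forall>k\<ge>N.
        Re (L2_inner M (\<lambda>x. g j x - g k x) (\<lambda>x. \<phi> j x - \<phi> k x)) < e)}"

definition friedrichs_extension ::
  "'a measure \<Rightarrow> ('a \<Rightarrow> complex) rel \<Rightarrow> ('a \<Rightarrow> complex) rel" where
  "friedrichs_extension M A = {(u, f) \<in> adjoint_graph M A. u \<in> energy_space M A}"

definition is_eigenvalue :: "'a measure \<Rightarrow> ('a \<Rightarrow> complex) rel \<Rightarrow> complex \<Rightarrow> bool" where
  "is_eigenvalue M A \<mu> \<longleftrightarrow>
     (\<exists>(u, f)\<in>A. \<not> (AE x in M. u x = 0) \<and> (AE x in M. f x = \<mu> * u x))"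

text \<open>Intended for self-adjoint \<open>A\<close>, all of whose eigenvalues are real.\<close>

definition first_eigenvalue :: "'a measure \<Rightarrow> ('a \<Rightarrow> complex) rel \<Rightarrow> real" where
  "first_eigenvalue M A = (LEAST \<mu>. is_eigenvalue M A (complex_of_real \<mu>))"


section \<open>The Dirichlet Laplacian\<close>

definition minus_laplacian_test ::
  "'a::euclidean_space set \<Rightarrow> ('a \<Rightarrow> complex) rel" where
  "minus_laplacian_test \<Omega> = {(\<phi>, \<lambda>x. - laplacian \<phi> x) | \<phi>. \<phi> \<in> test_functions \<Omega>}"

definition dirichlet_laplacian ::
  "'a::euclidean_space set \<Rightarrow> ('a \<Rightarrow> complex) rel" where
  "dirichlet_laplacian \<Omega> =
     friedrichs_extension (lebesgue_on \<Omega>) (minus_laplacian_test \<Omega>)"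

definition dirichlet_first_eigenvalue :: "'a::euclidean_space set \<Rightarrow> real" where
  "dirichlet_first_eigenvalue \<Omega> = first_eigenvalue (lebesgue_on \<Omega>) (dirichlet_laplacian \<Omega>)"

definition unit_annulus :: "real \<Rightarrow> 'a::euclidean_space set" where
  "unit_annulus \<sigma> = {x. \<sigma> < norm x \<and> norm x < 1}"

end

theory Submission
  imports Defs "HOL-Complex_Analysis.Great_Picard"
begin

text \<open>
  On a nonempty bounded open set the first Dirichlet eigenvalue is the infimum of the Rayleigh quotients
  of test functions. A minimising sequence has an \<open>L\<^sub>2\<close>-Cauchy subsequence by Rellich's theorem,
  which follows by comparing a function with its averages over the cells of a fine grid; by the
  parallelogram identity the subsequence is then Cauchy in the energy norm, and its limit is an
  eigenfunction. Extending test functions by zero makes the eigenvalue of the annulus at least that of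
  the ball. Conversely, multiplying a test function on the ball by a cutoff that vanishes for
  \<open>\<bar>x\<bar> \<le> \<sigma>\<close> and equals \<open>1\<close> for \<open>\<bar>x\<bar> \<ge> 2\<sigma>\<close> changes its energy by \<open>O(\<sigma>\<^sup>-\<^sup>2 \<sigma>\<^sup>n)\<close>, which
  tends to \<open>0\<close> because \<open>n \<ge> 3\<close>.
\<close>

section \<open>Smooth functions\<close>

text \<open>\<open>first_eigenvalue\<close> is a \<open>LEAST\<close> over the reals, so the infimum
  of the Rayleigh quotients says nothing about it until that infimum is attained by an element of
  the Friedrichs domain. This is why compactness is needed, on the annuli as well as on the ball,
  for what is otherwise a statement about limits of infima. No Sobolev space is built: energies are
  computed for test functions only, and an eigenfunction is handled through its approximating
  sequence and the defining relation of the adjoint. The remaining analysis rests on translations: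
  invariance of Lebesgue measure yields integration by parts, and the bound of f(x + h) - f(x) by
  the gradient yields the comparison with cell averages. Averages are constant on cells, so a single
  diagonal subsequence over countably many cells makes all of them converge. In the last step the
  exponent n - 2 must be positive; in the plane the same estimate for a cutoff living on a single
  scale would leave an error that does not shrink.\<close>

lemma k_times_differentiable_continuous:
  "k_times_differentiable k f \<Longrightarrow> continuous_on UNIV f"
  by (cases k) (auto intro!: differentiable_imp_continuous_on simp: differentiable_on_def)

lemma k_times_differentiable_SucD:
  "k_times_differentiable (Suc k) f \<Longrightarrow> k_times_differentiable k f"
proof (induction k arbitrary: f)
  case 0
  then show ?case by (simp add: differentiable_imp_continuous_on differentiable_on_def)
next
  case (Suc k)
  then show ?case by simp
qed

text \<open>Derivatives are unique, so any formula for the derivative may stand in for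
  \<open>frechet_derivative\<close>. The closure properties below are inductions through this
  rule.\<close>

lemma k_times_differentiable_SucI:
  assumes "\<And>x. (f has_derivative f' x) (at x)" "\<And>v. k_times_differentiable k (\<lambda>x. f' x v)"
  shows "k_times_differentiable (Suc k) f"
proof -
  have "frechet_derivative f (at x) = f' x" for x
    using frechet_derivative_at[OF assms(1)[of x]] by simp
  then show ?thesis using assms by (auto simp: differentiable_def)
qed

lemma k_times_differentiable_SucE:
  assumes "k_times_differentiable (Suc k) f"
  shows "(f has_derivative frechet_derivative f (at x)) (at x)"
    "k_times_differentiable k (\<lambda>x. frechet_derivative f (at x) v)"
  using assms by (simp_all flip: frechet_derivative_works)

lemma k_times_differentiable_const: "k_times_differentiable k (\<lambda>x. c)"
proof (induction k arbitrary: c)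
  case (Suc k)
  show ?case
    by (rule k_times_differentiable_SucI[OF has_derivative_const Suc])
qed simp

lemma k_times_differentiable_bounded_linear:
  assumes "bounded_linear f"
  shows "k_times_differentiable k f"
proof (cases k)
  case 0
  then show ?thesis using linear_continuous_on[OF assms] by simp
next
  case (Suc j)
  show ?thesis unfolding Suc
    by (rule k_times_differentiable_SucI[OF bounded_linear_imp_has_derivative[OF assms]
        k_times_differentiable_const])
qed

lemma k_times_differentiable_compose_bounded_linear:
  assumes "bounded_linear h" "k_times_differentiable k f"
  shows "k_times_differentiable k (\<lambda>x. h (f x))"
  using assms(2)
proof (induction k arbitrary: f)
  case 0
  then show ?case using bounded_linear.continuous_on[OF assms(1)] by auto
next
  case (Suc k)
  note f = k_times_differentiable_SucE[OF Suc.prems]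
  show ?case
    by (rule k_times_differentiable_SucI[OF bounded_linear.has_derivative[OF assms(1) f(1)]])
      (rule Suc.IH[OF f(2)])
qed

lemma k_times_differentiable_add:
  assumes "k_times_differentiable k f" "k_times_differentiable k g"
  shows "k_times_differentiable k (\<lambda>x. f x + g x)"
  using assms
proof (induction k arbitrary: f g)
  case 0
  then show ?case by (auto intro: continuous_intros)
next
  case (Suc k)
  note f = k_times_differentiable_SucE[OF Suc.prems(1)]
  note g = k_times_differentiable_SucE[OF Suc.prems(2)]
  show ?case
    by (rule k_times_differentiable_SucI[OF has_derivative_add[OF f(1) g(1)]])
      (rule Suc.IH[OF f(2) g(2)])
qed

lemma k_times_differentiable_sum:
  assumes "\<And>i. i \<in> I \<Longrightarrow> k_times_differentiable k (f i)"
  shows "k_times_differentiable k (\<lambda>x. \<Sum>i\<in>I. f i x)"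
  using assms
  by (induction I rule: infinite_finite_induct)
    (auto intro: k_times_differentiable_add k_times_differentiable_const)

lemma k_times_differentiable_mult:
  fixes f g :: "'a::real_normed_vector \<Rightarrow> 'b::real_normed_algebra"
  assumes "k_times_differentiable k f" "k_times_differentiable k g"
  shows "k_times_differentiable k (\<lambda>x. f x * g x)"
  using assms
proof (induction k arbitrary: f g)
  case 0
  then show ?case by (auto intro: continuous_intros)
next
  case (Suc k)
  note f = k_times_differentiable_SucE[OF Suc.prems(1)]
  note g = k_times_differentiable_SucE[OF Suc.prems(2)]
  show ?case
    by (rule k_times_differentiable_SucI[OF has_derivative_mult[OF f(1) g(1)]])
      (intro k_times_differentiable_add Suc.IH f(2) g(2)
        k_times_differentiable_SucD[OF Suc.prems(1)] k_times_differentiable_SucD[OF Suc.prems(2)])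
qed

lemma k_times_differentiable_compose_real:
  fixes g :: "real \<Rightarrow> real" and r :: "'a::real_normed_vector \<Rightarrow> real"
  assumes "k_times_differentiable k g" "k_times_differentiable k r"
  shows "k_times_differentiable k (\<lambda>x. g (r x))"
  using assms
proof (induction k arbitrary: g r)
  case 0
  then show ?case by (auto intro: continuous_on_compose2)
next
  case (Suc k)
  note g = k_times_differentiable_SucE[OF Suc.prems(1)]
  note r = k_times_differentiable_SucE[OF Suc.prems(2)]
  \<comment> \<open>A linear map on the reals is multiplication by its value at 1. This turns the
    chain rule into a product of functions to which the induction hypothesis applies.\<close>
  have eq: "frechet_derivative g (at (r x)) (frechet_derivative r (at x) v) =
      frechet_derivative r (at x) v * frechet_derivative g (at (r x)) 1" for x v
    using linear_cmul[OF has_derivative_linear[OF g(1)[of "r x"]],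
        of "frechet_derivative r (at x) v" 1] by simp
  show ?case
    by (rule k_times_differentiable_SucI[OF has_derivative_compose[OF r(1) g(1)]], subst eq)
      (intro k_times_differentiable_mult r(2)
        Suc.IH[OF g(2) k_times_differentiable_SucD[OF Suc.prems(2)]])
qed

lemma smooth_compose_bounded_linear:
  "bounded_linear h \<Longrightarrow> smooth f \<Longrightarrow> smooth (\<lambda>x. h (f x))"
  by (simp add: smooth_def k_times_differentiable_compose_bounded_linear)

lemma smooth_const: "smooth (\<lambda>x. c)"
  by (simp add: smooth_def k_times_differentiable_const)

lemma smooth_add: "smooth f \<Longrightarrow> smooth g \<Longrightarrow> smooth (\<lambda>x. f x + g x)"
  by (simp add: smooth_def k_times_differentiable_add)

lemma smooth_sum: "(\<And>i. i \<in> I \<Longrightarrow> smooth (f i)) \<Longrightarrow> smooth (\<lambda>x. \<Sum>i\<in>I. f i x)"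
  by (simp add: smooth_def k_times_differentiable_sum)

lemma smooth_mult:
  fixes f g :: "'a::real_normed_vector \<Rightarrow> 'b::real_normed_algebra"
  shows "smooth f \<Longrightarrow> smooth g \<Longrightarrow> smooth (\<lambda>x. f x * g x)"
  by (simp add: smooth_def k_times_differentiable_mult)

lemma smooth_cmult:
  fixes f :: "'a::real_normed_vector \<Rightarrow> 'b::real_normed_algebra"
  shows "smooth f \<Longrightarrow> smooth (\<lambda>x. c * f x)"
  by (intro smooth_mult smooth_const)

lemma smooth_compose_real:
  fixes g :: "real \<Rightarrow> real"
  shows "smooth g \<Longrightarrow> smooth r \<Longrightarrow> smooth (\<lambda>x. g (r x))"
  by (simp add: smooth_def k_times_differentiable_compose_real)

text \<open>The norm is not differentiable at 0, but its square is a polynomial in the coordinates.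
  Radial bumps and cutoffs are therefore functions of the squared norm.\<close>

lemma smooth_norm_power2:
  fixes c :: "'a::euclidean_space"
  shows "smooth (\<lambda>x. (norm (x - c))\<^sup>2)"
proof -
  have 1: "smooth (\<lambda>x::'a. x \<bullet> b)" for b
    unfolding smooth_def
    by (simp add: k_times_differentiable_bounded_linear bounded_linear_inner_left)
  have "smooth (\<lambda>x. \<Sum>b\<in>Basis. (x \<bullet> b + - (c \<bullet> b)) * (x \<bullet> b + - (c \<bullet> b)))"
    by (intro smooth_sum smooth_mult smooth_add smooth_const 1)
  moreover have "(\<Sum>b\<in>Basis. (x \<bullet> b + - (c \<bullet> b)) * (x \<bullet> b + - (c \<bullet> b))) = (norm (x - c))\<^sup>2" for x
    unfolding power2_norm_eq_inner euclidean_inner[of "x - c" "x - c"]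
    by (simp add: inner_diff_left)
  ultimately show ?thesis by simp
qed

lemma smooth_has_derivative: "smooth f \<Longrightarrow> (f has_derivative frechet_derivative f (at x)) (at x)"
  unfolding smooth_def by (rule k_times_differentiable_SucE(1)) (rule spec)

lemma smooth_frechet_derivative: "smooth f \<Longrightarrow> smooth (\<lambda>x. frechet_derivative f (at x) v)"
  unfolding smooth_def by (intro allI k_times_differentiable_SucE(2)) (rule spec)

lemma smooth_continuous_on: "smooth f \<Longrightarrow> continuous_on A f"
  using continuous_on_subset[OF k_times_differentiable_continuous[of 0 f]] by (simp add: smooth_def)

subsection \<open>A smooth step\<close>

text \<open>The index \<open>j\<close> makes the family closed under differentiation: the derivative
  of member \<open>j\<close> combines members \<open>j + 1\<close> and \<open>j + 2\<close>.
  Smoothness is then one induction for all \<open>j\<close> at once.\<close>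

definition flat_exp :: "nat \<Rightarrow> real \<Rightarrow> real" where
  "flat_exp j t = (if t > 0 then (1 / t) ^ j * exp (- 1 / t) else 0)"

lemma power_le_fact_exp:
  fixes s :: real
  assumes "0 \<le> s"
  shows "s ^ n \<le> fact n * exp s"
proof -
  have "s ^ n /\<^sub>R fact n \<le> (\<Sum>k<Suc n. s ^ k /\<^sub>R fact k)"
    by (rule member_le_sum) (use assms in auto)
  also have "\<dots> \<le> exp s"
    unfolding exp_def by (rule sum_le_suminf[OF summable_exp_generic]) (use assms in auto)
  finally show ?thesis by (simp add: field_simps)
qed

text \<open>Taking \<open>s = 1 / t\<close> and exponent \<open>j + 2\<close> in
  \<open>power_le_fact_exp\<close>, the exponential absorbs the pole and two further powers. The
  resulting quadratic decay makes the difference quotient at 0 tend to 0.\<close>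

lemma flat_exp_bound: "\<bar>flat_exp j t\<bar> \<le> fact (j + 2) * t\<^sup>2"
proof (cases "t > 0")
  case True
  have "(1 / t) ^ (j + 2) * exp (- 1 / t) \<le> fact (j + 2) * exp (1/t) * exp (- 1 / t)"
    using power_le_fact_exp[of "1/t" "j+2"] True by (intro mult_right_mono) auto
  then have "(1 / t) ^ j * exp (- 1 / t) / t\<^sup>2 \<le> fact (j + 2)"
    by (simp add: power_add power2_eq_square exp_minus mult.assoc flip: exp_add)
  then show ?thesis using True by (simp add: flat_exp_def field_simps)
qed (simp add: flat_exp_def)

lemma flat_exp_has_derivative:
  "(flat_exp j has_real_derivative (flat_exp (j + 2) t - real j * flat_exp (j + 1) t)) (at t)"
proof -
  consider "t > 0" | "t < 0" | "t = 0" by linarith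
  then show ?thesis
  proof cases
    case 1
    have "((\<lambda>t. (1 / t) ^ j * exp (- 1 / t)) has_real_derivative
       (flat_exp (j + 2) t - real j * flat_exp (j + 1) t)) (at t)"
    proof (cases j)
      case 0
      then show ?thesis using 1
        by (auto intro!: derivative_eq_intros simp: flat_exp_def field_simps power2_eq_square)
    next
      case (Suc i)
      have "((\<lambda>t. (1 / t) ^ j * exp (- 1 / t)) has_real_derivative
         real j * (1 / t) ^ i * (- (1 / t ^ 2)) * exp (- 1 / t) + (1 / t) ^ j * (exp (- 1 / t) * (1 / t ^ 2))) (at t)"
      proof -
        have "((\<lambda>t. 1 / t) has_real_derivative - (1 / t ^ 2)) (at t)"
          "((\<lambda>t. exp (- 1 / t)) has_real_derivative exp (- 1 / t) * (1 / t ^ 2)) (at t)"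
          using 1 by (auto intro!: derivative_eq_intros simp: power2_eq_square)
        from DERIV_mult[OF DERIV_power[OF this(1), of j] this(2)] show ?thesis
          by (rule DERIV_cong) (simp add: Suc algebra_simps add_divide_distrib)
      qed
      then show ?thesis using 1 Suc
        by (simp add: flat_exp_def power2_eq_square field_simps)
    qed
    then show ?thesis
      by (rule has_field_derivative_transform_within_open[of _ _ _ "{0<..}"])
        (use 1 in \<open>auto simp: flat_exp_def\<close>)
  next
    case 2
    have "((\<lambda>t. 0) has_real_derivative (flat_exp (j + 2) t - real j * flat_exp (j + 1) t)) (at t)"
      using 2 by (simp add: flat_exp_def)
    then show ?thesis
      by (rule has_field_derivative_transform_within_open[of _ _ _ "{..<0}"])
        (use 2 in \<open>auto simp: flat_exp_def\<close>)
  next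
    case 3
    \<comment> \<open>The claimed derivative at 0 is 0, since every member of the family vanishes
      there.\<close>
    have "(\<lambda>h. flat_exp j h / h) \<midarrow>0\<rightarrow> 0"
    proof (rule Lim_null_comparison)
      show "\<forall>\<^sub>F h in at 0. norm (flat_exp j h / h) \<le> fact (j + 2) * \<bar>h\<bar>"
        unfolding eventually_at_filter
      proof (rule always_eventually, intro allI impI)
        fix h :: real
        assume "h \<noteq> 0"
        have "\<bar>flat_exp j h\<bar> / \<bar>h\<bar> \<le> fact (j + 2) * h\<^sup>2 / \<bar>h\<bar>"
          by (intro divide_right_mono flat_exp_bound) simp
        also have "\<dots> = fact (j + 2) * \<bar>h\<bar>"
          using \<open>h \<noteq> 0\<close> by (simp add: power2_eq_square abs_if del: fact_Suc)
        finally show "norm (flat_exp j h / h) \<le> fact (j + 2) * \<bar>h\<bar>"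
          by (simp add: abs_divide del: fact_Suc)
      qed
      show "((\<lambda>h::real. fact (j + 2) * \<bar>h\<bar>) \<longlongrightarrow> 0) (at 0)"
        by (auto intro!: tendsto_eq_intros)
    qed
    then show ?thesis using 3 by (simp add: DERIV_def flat_exp_def)
  qed
qed

lemma smooth_flat_exp: "smooth (flat_exp j)"
proof -
  have "k_times_differentiable k (flat_exp j)" for k
  proof (induction k arbitrary: j)
    case 0
    show ?case using flat_exp_has_derivative
      by (auto intro!: continuous_at_imp_continuous_on DERIV_isCont)
  next
    case (Suc k)
    show ?case
    proof (rule k_times_differentiable_SucI)
      show "(flat_exp j has_derivative (\<lambda>v. (flat_exp (j + 2) t + (- real j) * flat_exp (j + 1) t) * v)) (at t)" for t
        using flat_exp_has_derivative[of j t] by (simp add: has_field_derivative_def)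
      show "k_times_differentiable k (\<lambda>t. (flat_exp (j + 2) t + (- real j) * flat_exp (j + 1) t) * v)" for v
        by (intro k_times_differentiable_mult k_times_differentiable_add
            k_times_differentiable_const Suc)
    qed
  qed
  then show ?thesis by (simp add: smooth_def)
qed

text \<open>This is h composed with itself for \<open>h t = 1 - exp 1 * flat_exp 0 t\<close>. The
  factor \<open>exp 1\<close> gives h(1) = 0, so h is 1 on t \<le> 0 and nonpositive on t \<ge> 1;
  the second application turns these values into 0 and 1. Differences are written as sums with a
  negative factor to fit \<open>smooth_add\<close> and \<open>smooth_cmult\<close>.\<close>

definition smooth_step :: "real \<Rightarrow> real" where
  "smooth_step t = 1 + (- exp 1) * flat_exp 0 (1 + (- exp 1) * flat_exp 0 t)"

lemma smooth_smooth_step: "smooth smooth_step"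
  unfolding smooth_step_def[abs_def]
  by (rule smooth_add[OF smooth_const smooth_cmult],
      rule smooth_compose_real[OF smooth_flat_exp],
      rule smooth_add[OF smooth_const smooth_cmult[OF smooth_flat_exp]])

lemma smooth_step_eq_0: "t \<le> 0 \<Longrightarrow> smooth_step t = 0"
  by (simp add: smooth_step_def flat_exp_def exp_minus)

lemma smooth_step_eq_1: "t \<ge> 1 \<Longrightarrow> smooth_step t = 1"
proof -
  assume "t \<ge> 1"
  \<comment> \<open>This makes the inner argument nonpositive, where the outer
    \<open>flat_exp 0\<close> vanishes.\<close>
  then have "exp 1 * exp (- 1 / t) \<ge> 1" by (simp flip: exp_add)
  then show ?thesis using \<open>t \<ge> 1\<close> by (simp add: smooth_step_def flat_exp_def)
qed

lemma smooth_step_bounds: "0 \<le> smooth_step t" "smooth_step t \<le> 1"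
proof -
  have *: "0 \<le> flat_exp 0 s" "s \<le> 1 \<Longrightarrow> exp 1 * flat_exp 0 s \<le> 1" for s
    by (auto simp: flat_exp_def field_simps simp flip: exp_add)
  show "0 \<le> smooth_step t" "smooth_step t \<le> 1"
    unfolding smooth_step_def using *(1)[of t] *(2)[of "1 + (- exp 1) * flat_exp 0 t"]
      *(1)[of "1 + (- exp 1) * flat_exp 0 t"] by auto
qed

text \<open>The step is locally constant off [0, 1], and its derivative is continuous on this
  compact interval.\<close>

lemma smooth_step_derivative_bounded:
  obtains B where "\<And>t v. \<bar>frechet_derivative smooth_step (at t) v\<bar> \<le> B * \<bar>v\<bar>"
    "\<And>t v. t < 0 \<or> t > 1 \<Longrightarrow> frechet_derivative smooth_step (at t) v = 0" "B \<ge> 0"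
proof -
  let ?D = "\<lambda>t. frechet_derivative smooth_step (at t)"
  note D = smooth_has_derivative[OF smooth_smooth_step]
  have zero: "?D t v = 0" if "t < 0 \<or> t > 1" for t v
  proof -
    have "(smooth_step has_derivative (\<lambda>_. 0)) (at t)"
      using that
    proof
      assume "t < 0"
      show ?thesis
        by (rule has_derivative_transform_within_open[OF has_derivative_const[of 0], where s = "{..<0}"])
          (use \<open>t < 0\<close> in \<open>auto simp: smooth_step_eq_0\<close>)
    next
      assume "t > 1"
      show ?thesis
        by (rule has_derivative_transform_within_open[OF has_derivative_const[of 1], where s = "{1<..}"])
          (use \<open>t > 1\<close> in \<open>auto simp: smooth_step_eq_1\<close>)
    qed
    then show ?thesis using has_derivative_unique[OF D[of t]] by metis
  qed
  have "compact ((\<lambda>t. ?D t 1) ` {0..1})"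
    by (intro compact_continuous_image smooth_continuous_on smooth_frechet_derivative
        smooth_smooth_step) auto
  then obtain B where B: "B > 0" "\<forall>t\<in>{0..1}. \<bar>?D t 1\<bar> \<le> B"
    using compact_imp_bounded bounded_pos by (metis (no_types, lifting) image_eqI real_norm_def)
  have "\<bar>?D t v\<bar> \<le> B * \<bar>v\<bar>" for t v
  proof -
    have "?D t v = v * ?D t 1"
      using linear_cmul[OF has_derivative_linear[OF D[of t]], of v 1] by simp
    moreover have "\<bar>?D t 1\<bar> \<le> B" using B zero[of t 1] by (cases "t < 0 \<or> t > 1") auto
    ultimately show ?thesis
      using mult_right_mono[of "\<bar>?D t 1\<bar>" B "\<bar>v\<bar>"] by (simp add: abs_mult mult.commute)
  qed
  then show ?thesis by (rule that[OF _ zero]) (use B(1) in auto)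
qed

section \<open>Test functions\<close>

text \<open>Any compact \<open>K\<close> off which the function vanishes can replace the closure of
  the support, so products, sums and derivatives can simply inherit their \<open>K\<close>.\<close>

lemma test_functionsI:
  assumes "smooth \<phi>" "compact K" "K \<subseteq> \<Omega>" "\<And>x. x \<notin> K \<Longrightarrow> \<phi> x = 0"
  shows "\<phi> \<in> test_functions \<Omega>"
proof -
  have "closure {x. \<phi> x \<noteq> 0} \<subseteq> K"
    using assms by (intro closure_minimal compact_imp_closed) auto
  moreover have "compact (closure {x. \<phi> x \<noteq> 0})"
    using compact_Int_closed[OF assms(2) closed_closure, of "{x. \<phi> x \<noteq> 0}"] calculation
    by (simp add: Int_absorb1)
  ultimately show ?thesis using assms by (auto simp: test_functions_def)
qed

lemma test_functionsE:
  assumes "\<phi> \<in> test_functions \<Omega>"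
  obtains K where "compact K" "K \<subseteq> \<Omega>" "\<And>x. x \<notin> K \<Longrightarrow> \<phi> x = 0"
  using assms closure_subset[of "{x. \<phi> x \<noteq> 0}"] that unfolding test_functions_def by blast

lemma test_functions_smooth: "\<phi> \<in> test_functions \<Omega> \<Longrightarrow> smooth \<phi>"
  by (simp add: test_functions_def)

lemma test_functions_mono: "\<Omega> \<subseteq> \<Omega>' \<Longrightarrow> test_functions \<Omega> \<subseteq> test_functions \<Omega>'"
  by (auto simp: test_functions_def)

lemma test_functions_UNIV: "\<phi> \<in> test_functions \<Omega> \<Longrightarrow> \<phi> \<in> test_functions UNIV"
  using test_functions_mono by blast

lemma test_functions_outside: "\<phi> \<in> test_functions \<Omega> \<Longrightarrow> x \<notin> \<Omega> \<Longrightarrow> \<phi> x = 0"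
  by (erule test_functionsE) auto

lemma test_functions_smooth_mult:
  assumes "\<phi> \<in> test_functions \<Omega>" "smooth f"
  shows "(\<lambda>x. f x * \<phi> x) \<in> test_functions \<Omega>"
  using assms(1) by (rule test_functionsE)
    (auto intro!: test_functionsI smooth_mult test_functions_smooth[OF assms(1)] assms(2))

lemma test_functions_cmult: "\<phi> \<in> test_functions \<Omega> \<Longrightarrow> (\<lambda>x. c * \<phi> x) \<in> test_functions \<Omega>"
  by (rule test_functions_smooth_mult[OF _ smooth_const])

lemma test_functions_zero: "(\<lambda>x. 0) \<in> test_functions \<Omega>"
  by (rule test_functionsI[OF smooth_const compact_empty]) auto

lemma test_functions_add:
  assumes "\<phi> \<in> test_functions \<Omega>" "\<psi> \<in> test_functions \<Omega>"
  shows "(\<lambda>x. \<phi> x + \<psi> x) \<in> test_functions \<Omega>"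
proof -
  from assms(1) obtain K where K: "compact K" "K \<subseteq> \<Omega>" "\<And>x. x \<notin> K \<Longrightarrow> \<phi> x = 0"
    by (rule test_functionsE) blast
  from assms(2) obtain L where L: "compact L" "L \<subseteq> \<Omega>" "\<And>x. x \<notin> L \<Longrightarrow> \<psi> x = 0"
    by (rule test_functionsE) blast
  show ?thesis
    by (rule test_functionsI[where K = "K \<union> L"])
      (use K L assms in \<open>auto intro: smooth_add test_functions_smooth\<close>)
qed

lemma test_functions_diff:
  assumes "\<phi> \<in> test_functions \<Omega>" "\<psi> \<in> test_functions \<Omega>"
  shows "(\<lambda>x. \<phi> x - \<psi> x) \<in> test_functions \<Omega>"
  using test_functions_add[OF assms(1) test_functions_cmult[OF assms(2), of "-1"]] by simp

lemma test_functions_cnj: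
  assumes "\<phi> \<in> test_functions \<Omega>"
  shows "(\<lambda>x. cnj (\<phi> x)) \<in> test_functions \<Omega>"
  using assms by (rule test_functionsE)
    (auto intro!: test_functionsI smooth_compose_bounded_linear[OF bounded_linear_cnj]
      test_functions_smooth[OF assms])

lemma test_functions_frechet_derivative:
  assumes "\<phi> \<in> test_functions \<Omega>"
  shows "(\<lambda>x. frechet_derivative \<phi> (at x) v) \<in> test_functions \<Omega>"
proof -
  from assms obtain K where K: "compact K" "K \<subseteq> \<Omega>" "\<And>x. x \<notin> K \<Longrightarrow> \<phi> x = 0"
    by (rule test_functionsE) blast
  show ?thesis
  proof (rule test_functionsI[OF smooth_frechet_derivative[OF test_functions_smooth[OF assms]] K(1,2)])
    fix x assume "x \<notin> K"
    \<comment> \<open>The complement of \<open>K\<close> is open, so the function vanishes near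
      \<open>x\<close> and the derivative is supported in the same \<open>K\<close>.\<close>
    have "(\<phi> has_derivative (\<lambda>_. 0)) (at x)"
      by (rule has_derivative_transform_within_open[OF has_derivative_const[of 0], where s = "- K"])
        (use K \<open>x \<notin> K\<close> in \<open>auto intro: open_Compl compact_imp_closed\<close>)
    then show "frechet_derivative \<phi> (at x) v = 0"
      using has_derivative_unique[OF smooth_has_derivative[OF test_functions_smooth[OF assms]]] by metis
  qed
qed

lemma test_functions_partial_derivative:
  "\<phi> \<in> test_functions \<Omega> \<Longrightarrow> partial_derivative b \<phi> \<in> test_functions \<Omega>"
  using test_functions_frechet_derivative[of \<phi> \<Omega> b] unfolding partial_derivative_def[abs_def] .

lemma test_functions_sum:
  "(\<And>i. i \<in> I \<Longrightarrow> f i \<in> test_functions \<Omega>) \<Longrightarrow> (\<lambda>x. \<Sum>i\<in>I. f i x) \<in> test_functions \<Omega>"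
  by (induction I rule: infinite_finite_induct) (auto intro: test_functions_zero test_functions_add)

lemma test_functions_minus_laplacian:
  assumes "\<phi> \<in> test_functions \<Omega>"
  shows "(\<lambda>x. - laplacian \<phi> x) \<in> test_functions \<Omega>"
proof -
  have "(\<lambda>x. - 1 * laplacian \<phi> x) \<in> test_functions \<Omega>"
    unfolding laplacian_def[abs_def]
    by (intro test_functions_cmult test_functions_sum test_functions_partial_derivative assms)
  then show ?thesis by simp
qed

lemma test_functions_continuous_on: "\<phi> \<in> test_functions \<Omega> \<Longrightarrow> continuous_on A \<phi>"
  by (intro smooth_continuous_on test_functions_smooth)

lemma test_functions_borel_measurable [measurable_dest]:
  "\<phi> \<in> test_functions \<Omega> \<Longrightarrow> \<phi> \<in> borel_measurable borel"
  by (intro borel_measurable_continuous_onI test_functions_continuous_on)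

lemma integrable_continuous_compact_support:
  fixes f :: "'a::euclidean_space \<Rightarrow> 'b::{banach, second_countable_topology}"
  assumes "continuous_on UNIV f" "compact K" "\<And>x. x \<notin> K \<Longrightarrow> f x = 0"
  shows "integrable lborel f"
proof -
  have "integrable lborel (\<lambda>x. indicator K x *\<^sub>R f x)"
    by (intro borel_integrable_compact assms(2) continuous_on_subset[OF assms(1)]) simp
  also have "(\<lambda>x. indicator K x *\<^sub>R f x) = f"
    using assms(3) by (auto simp: indicator_def)
  finally show ?thesis .
qed

lemma test_functions_integrable:
  assumes "\<phi> \<in> test_functions \<Omega>"
  shows "integrable lborel \<phi>"
  using assms by (rule test_functionsE)
    (rule integrable_continuous_compact_support[OF test_functions_continuous_on[OF assms]])

lemma test_functions_integrable_norm_power2: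
  assumes "\<phi> \<in> test_functions \<Omega>"
  shows "integrable lborel (\<lambda>x. (norm (\<phi> x))\<^sup>2)"
  using assms
  by (rule test_functionsE)
    (rule integrable_continuous_compact_support, auto intro!: continuous_intros test_functions_continuous_on[OF assms])

lemma test_functions_integrable_mult:
  assumes "\<phi> \<in> test_functions \<Omega>" "\<psi> \<in> test_functions \<Omega>'"
  shows "integrable lborel (\<lambda>x. \<phi> x * \<psi> x)"
  using assms
  by (intro test_functions_integrable[of _ \<Omega>'] test_functions_smooth_mult test_functions_smooth)

lemma test_functions_bounded:
  assumes "\<phi> \<in> test_functions \<Omega>"
  obtains B where "B > 0" "\<And>x. norm (\<phi> x) \<le> B"
proof -
  from assms obtain K where K: "compact K" "\<And>x. x \<notin> K \<Longrightarrow> \<phi> x = 0"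
    by (rule test_functionsE) blast
  have "bounded (\<phi> ` K)"
    using K test_functions_continuous_on[OF assms]
    by (intro compact_imp_bounded compact_continuous_image)
  then obtain B where B: "B > 0" "\<forall>y\<in>\<phi> ` K. norm y \<le> B" using bounded_pos by blast
  have "norm (\<phi> x) \<le> B" for x
    using B K(2)[of x] by (cases "x \<in> K") auto
  with B(1) show ?thesis by (rule that)
qed

lemma frechet_derivative_add_smooth:
  assumes "smooth f" "smooth g"
  shows "frechet_derivative (\<lambda>x. f x + g x) (at x) v = frechet_derivative f (at x) v + frechet_derivative g (at x) v"
  using frechet_derivative_at[OF has_derivative_add[OF smooth_has_derivative[OF assms(1)] smooth_has_derivative[OF assms(2)]]]
  by metis

lemma frechet_derivative_mult_smooth:
  fixes f g :: "'a::real_normed_vector \<Rightarrow> 'b::real_normed_algebra"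
  assumes "smooth f" "smooth g"
  shows "frechet_derivative (\<lambda>x. f x * g x) (at x) v
    = f x * frechet_derivative g (at x) v + frechet_derivative f (at x) v * g x"
  using frechet_derivative_at[OF has_derivative_mult[OF smooth_has_derivative[OF assms(1)] smooth_has_derivative[OF assms(2)]]]
  by metis

lemma frechet_derivative_compose_bounded_linear:
  assumes "bounded_linear h" "smooth f"
  shows "frechet_derivative (\<lambda>x. h (f x)) (at x) v = h (frechet_derivative f (at x) v)"
  using frechet_derivative_at[OF bounded_linear.has_derivative[OF assms(1) smooth_has_derivative[OF assms(2)]]]
  by metis

lemma partial_derivative_add:
  "\<phi> \<in> test_functions \<Omega> \<Longrightarrow> \<psi> \<in> test_functions \<Omega>' \<Longrightarrow>
    partial_derivative b (\<lambda>x. \<phi> x + \<psi> x) = (\<lambda>x. partial_derivative b \<phi> x + partial_derivative b \<psi> x)"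
  by (auto simp: partial_derivative_def fun_eq_iff frechet_derivative_add_smooth test_functions_smooth)

lemma partial_derivative_cmult:
  "\<phi> \<in> test_functions \<Omega> \<Longrightarrow> partial_derivative b (\<lambda>x. c * \<phi> x) = (\<lambda>x. c * partial_derivative b \<phi> x)"
  by (auto simp: partial_derivative_def fun_eq_iff
      frechet_derivative_compose_bounded_linear[OF bounded_linear_mult_right] test_functions_smooth)

lemma laplacian_add:
  "\<phi> \<in> test_functions \<Omega> \<Longrightarrow> \<psi> \<in> test_functions \<Omega>' \<Longrightarrow>
    laplacian (\<lambda>x. \<phi> x + \<psi> x) = (\<lambda>x. laplacian \<phi> x + laplacian \<psi> x)"
  unfolding laplacian_def
  by (auto simp: fun_eq_iff partial_derivative_add[of _ \<Omega> _ \<Omega>'] test_functions_partial_derivative sum.distrib)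

lemma laplacian_cmult:
  "\<phi> \<in> test_functions \<Omega> \<Longrightarrow> laplacian (\<lambda>x. c * \<phi> x) = (\<lambda>x. c * laplacian \<phi> x)"
  unfolding laplacian_def
  by (auto simp: fun_eq_iff partial_derivative_cmult[of _ \<Omega>] test_functions_partial_derivative sum_distrib_left)

section \<open>Translations and integration by parts\<close>

lemma integral_lborel_translate:
  fixes f :: "'a::euclidean_space \<Rightarrow> 'b::{banach, second_countable_topology}"
  assumes "f \<in> borel_measurable borel"
  shows "(\<integral>x. f (c + x) \<partial>lborel) = (\<integral>x. f x \<partial>lborel)"
proof -
  have "(\<integral>x. f x \<partial>distr lborel borel ((+) c)) = (\<integral>x. f (c + x) \<partial>lborel)"
    by (rule integral_distr) (use assms in auto)
  then show ?thesis by (simp add: lborel_distr_plus)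
qed

lemma nn_integral_lborel_translate:
  fixes c :: "'a::euclidean_space"
  assumes "f \<in> borel_measurable borel"
  shows "(\<integral>\<^sup>+x. f (c + x) \<partial>lborel) = (\<integral>\<^sup>+x. f x \<partial>lborel)"
proof -
  have "(\<integral>\<^sup>+x. f x \<partial>distr lborel borel ((+) c)) = (\<integral>\<^sup>+x. f (c + x) \<partial>lborel)"
    by (rule nn_integral_distr) (use assms in auto)
  then show ?thesis by (simp add: lborel_distr_plus)
qed

text \<open>The fundamental theorem of calculus along the segment from \<open>x\<close> to
  \<open>x + v\<close>. It links derivatives to translations, both for integration by parts and for
  \<open>translation_estimate\<close>.\<close>

lemma smooth_difference_eq_integral:
  fixes f :: "'a::real_normed_vector \<Rightarrow> 'b::euclidean_space"
  assumes "smooth f"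
  shows "(\<integral>s. indicator {0..1} s *\<^sub>R frechet_derivative f (at (x + s *\<^sub>R v)) v \<partial>lborel) = f (x + v) - f x"
proof -
  have "(\<integral>s. indicator {0..1} s *\<^sub>R frechet_derivative f (at (x + s *\<^sub>R v)) v \<partial>lborel)
      = f (x + 1 *\<^sub>R v) - f (x + 0 *\<^sub>R v)"
  proof (rule integral_FTC_atLeastAtMost)
    show "((\<lambda>s. f (x + s *\<^sub>R v)) has_vector_derivative frechet_derivative f (at (x + s *\<^sub>R v)) v) (at s within {0..1})" for s
    proof -
      have "((\<lambda>s. f (x + s *\<^sub>R v)) has_derivative (\<lambda>t. frechet_derivative f (at (x + s *\<^sub>R v)) (t *\<^sub>R v))) (at s within {0..1})"
        by (rule has_derivative_compose[OF _ smooth_has_derivative[OF assms]])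
          (auto intro!: derivative_eq_intros)
      then show ?thesis
        unfolding has_vector_derivative_def
        by (simp add: linear_cmul[OF has_derivative_linear[OF smooth_has_derivative[OF assms]]])
    qed
    show "continuous_on {0..1} (\<lambda>s. frechet_derivative f (at (x + s *\<^sub>R v)) v)"
      by (rule continuous_on_compose2[OF smooth_continuous_on[OF smooth_frechet_derivative[OF assms], of UNIV]])
        (auto intro!: continuous_intros)
  qed simp
  then show ?thesis by simp
qed

text \<open>By translation invariance F(x + v) - F(x) has integral 0. Writing this difference as an
  integral over the segment and exchanging the integrals, each inner integral equals that of
  \<open>G\<close>, again by translation invariance. No coordinatewise iterated integration is
  involved.\<close>

lemma integral_frechet_derivative_test_function:
  assumes F: "F \<in> test_functions (UNIV :: 'a::euclidean_space set)"
  shows "(\<integral>x. frechet_derivative F (at x) v \<partial>lborel) = 0"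
proof -
  define G where "G = (\<lambda>x. frechet_derivative F (at x) v)"
  have G: "G \<in> test_functions UNIV"
    unfolding G_def by (rule test_functions_frechet_derivative[OF F])
  then obtain K where K: "compact K" "\<And>x. x \<notin> K \<Longrightarrow> G x = 0"
    by (rule test_functionsE) blast
  \<comment> \<open>\<open>L\<close> collects all \<open>x\<close> whose segment to
    \<open>x + v\<close> meets \<open>K\<close>. It is compact, so on the product with [0, 1] the
    integrand is continuous on a compact set and hence integrable, as Fubini requires.\<close>
  define L where "L = (\<lambda>(x, s). x - s *\<^sub>R v) ` (K \<times> {0..1::real})"
  have cont: "continuous_on A (\<lambda>p. G (fst p + snd p *\<^sub>R v))" for A
    by (rule continuous_on_compose2[OF test_functions_continuous_on[OF G, of UNIV]])
      (auto intro!: continuous_intros)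
  have "compact L"
    unfolding L_def using K(1)
    by (intro compact_continuous_image compact_Times) (auto intro!: continuous_intros simp: case_prod_unfold)
  then have "compact (L \<times> {0..1::real})" by (intro compact_Times) auto
  from borel_integrable_compact[OF this cont]
  have int: "integrable (lborel \<Otimes>\<^sub>M lborel)
      (\<lambda>(x, s). indicator (L \<times> {0..1}) (x, s) *\<^sub>R G (x + s *\<^sub>R v))"
    by (simp add: lborel_prod case_prod_unfold)
  have eq: "indicator (L \<times> {0..1}) (x, s) *\<^sub>R G (x + s *\<^sub>R v) = indicator {0..1} s *\<^sub>R G (x + s *\<^sub>R v)" for x s
  proof (cases "x + s *\<^sub>R v \<in> K")
    case True
    then have "x \<in> L" if "s \<in> {0..1}"
      unfolding L_def using that by (intro image_eqI[of _ _ "(x + s *\<^sub>R v, s)"]) auto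
    then show ?thesis by (auto simp: indicator_def)
  qed (simp add: K)
  have "0 = (\<integral>x. F (v + x) \<partial>lborel) - (\<integral>x. F x \<partial>lborel)"
    using integral_lborel_translate[OF test_functions_borel_measurable[OF F], of v] by simp
  also have "\<dots> = (\<integral>x. F (x + v) - F x \<partial>lborel)"
  proof -
    have "integrable lborel (\<lambda>x. F (v + x))"
      using integrable_distr[of "(+) v" lborel borel F] test_functions_integrable[OF F] by (simp add: lborel_distr_plus)
    then show ?thesis using test_functions_integrable[OF F] by (simp add: add.commute)
  qed
  also have "\<dots> = (\<integral>x. (\<integral>s. indicator {0..1} s *\<^sub>R G (x + s *\<^sub>R v) \<partial>lborel) \<partial>lborel)"
    unfolding G_def by (simp add: smooth_difference_eq_integral test_functions_smooth[OF F])
  also have "\<dots> = (\<integral>s. (\<integral>x. indicator {0..1} s *\<^sub>R G (x + s *\<^sub>R v) \<partial>lborel) \<partial>lborel)"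
    using lborel_pair.Fubini_integral[OF int] by (simp add: eq)
  also have "\<dots> = (\<integral>s. indicator {0..1} s *\<^sub>R (\<integral>x. G x \<partial>lborel) \<partial>(lborel::real measure))"
  proof -
    have "(\<integral>x. G (x + s *\<^sub>R v) \<partial>lborel) = (\<integral>x. G x \<partial>lborel)" for s
      using integral_lborel_translate[OF test_functions_borel_measurable[OF G], of "s *\<^sub>R v"]
      by (simp add: add.commute)
    then show ?thesis by simp
  qed
  also have "\<dots> = (\<integral>x. G x \<partial>lborel)" by simp
  finally show ?thesis by (simp add: G_def)
qed

text \<open>The product of the two is a test function, so the integral of its derivative
  vanishes.\<close>

lemma integral_by_parts_partial_derivative:
  assumes "\<phi> \<in> test_functions (UNIV :: 'a::euclidean_space set)" "\<psi> \<in> test_functions UNIV"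
  shows "(\<integral>x. partial_derivative b \<phi> x * \<psi> x \<partial>lborel) = - (\<integral>x. \<phi> x * partial_derivative b \<psi> x \<partial>lborel)"
proof -
  have s: "smooth \<phi>" "smooth \<psi>" using assms test_functions_smooth by auto
  have "(\<lambda>x. \<phi> x * \<psi> x) \<in> test_functions UNIV"
    by (intro test_functions_smooth_mult assms s)
  from integral_frechet_derivative_test_function[OF this, of b]
  have "(\<integral>x. \<phi> x * partial_derivative b \<psi> x + partial_derivative b \<phi> x * \<psi> x \<partial>lborel) = 0"
    by (simp add: frechet_derivative_mult_smooth s partial_derivative_def)
  then show ?thesis
    using assms by (simp add: test_functions_integrable_mult[of _ UNIV _ UNIV] test_functions_partial_derivative
        add_eq_0_iff)
qed

section \<open>The Dirichlet energy and Green's identity\<close>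

definition dirichlet_energy :: "('a::euclidean_space \<Rightarrow> complex) \<Rightarrow> real" where
  "dirichlet_energy \<phi> = (\<integral>x. (\<Sum>b\<in>Basis. (norm (partial_derivative b \<phi> x))\<^sup>2) \<partial>lborel)"

lemma dirichlet_energy_nonneg: "dirichlet_energy \<phi> \<ge> 0"
  unfolding dirichlet_energy_def by (intro integral_nonneg_AE AE_I2 sum_nonneg) auto

lemma partial_derivative_cnj:
  "\<phi> \<in> test_functions \<Omega> \<Longrightarrow> partial_derivative b (\<lambda>x. cnj (\<phi> x)) = (\<lambda>x. cnj (partial_derivative b \<phi> x))"
  by (auto simp: partial_derivative_def fun_eq_iff
      frechet_derivative_compose_bounded_linear[OF bounded_linear_cnj] test_functions_smooth)

text \<open>One integration by parts per coordinate. The right-hand side is Hermitian in the two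
  functions, which gives the symmetry of the operator and, on the diagonal, its positivity.\<close>

lemma integral_minus_laplacian_mult_cnj:
  assumes "\<phi> \<in> test_functions (UNIV :: 'a::euclidean_space set)" "\<psi> \<in> test_functions UNIV"
  shows "(\<integral>x. (- laplacian \<phi> x) * cnj (\<psi> x) \<partial>lborel)
    = (\<Sum>b\<in>Basis. (\<integral>x. partial_derivative b \<phi> x * cnj (partial_derivative b \<psi> x) \<partial>lborel))"
proof -
  note t = test_functions_partial_derivative test_functions_cnj assms
  have "(\<integral>x. (- laplacian \<phi> x) * cnj (\<psi> x) \<partial>lborel)
      = (\<integral>x. - (\<Sum>b\<in>Basis. partial_derivative b (partial_derivative b \<phi>) x * cnj (\<psi> x)) \<partial>lborel)"
    by (simp add: laplacian_def sum_distrib_right)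
  also have "\<dots> = (\<Sum>b\<in>Basis. - (\<integral>x. partial_derivative b (partial_derivative b \<phi>) x * cnj (\<psi> x) \<partial>lborel))"
    by (simp add: Bochner_Integration.integral_sum test_functions_integrable_mult[of _ UNIV _ UNIV] t sum_negf)
  also have "\<dots> = (\<Sum>b\<in>Basis. (\<integral>x. partial_derivative b \<phi> x * cnj (partial_derivative b \<psi> x) \<partial>lborel))"
    using integral_by_parts_partial_derivative[of "partial_derivative _ \<phi>" "\<lambda>x. cnj (\<psi> x)"]
    by (simp add: t partial_derivative_cnj[OF assms(2)])
  finally show ?thesis .
qed

lemma integral_minus_laplacian_mult_cnj_self:
  assumes "\<phi> \<in> test_functions (UNIV :: 'a::euclidean_space set)"
  shows "(\<integral>x. (- laplacian \<phi> x) * cnj (\<phi> x) \<partial>lborel) = of_real (dirichlet_energy \<phi>)"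
proof -
  have "dirichlet_energy \<phi> = (\<Sum>b\<in>Basis. (\<integral>x. (norm (partial_derivative b \<phi> x))\<^sup>2 \<partial>lborel))"
    unfolding dirichlet_energy_def
    by (intro Bochner_Integration.integral_sum test_functions_integrable_norm_power2[of _ UNIV]
        test_functions_partial_derivative assms)
  then show ?thesis
    unfolding integral_minus_laplacian_mult_cnj[OF assms assms]
    by (simp flip: complex_norm_square integral_complex_of_real of_real_power)
qed

section \<open>Compactness\<close>

text \<open>Cauchy-Schwarz for the norm of \<open>g\<close> against the indicator of
  \<open>S\<close>, in extended reals so that infinite values need no separate treatment
  later.\<close>

lemma norm_power2_integral_le:
  fixes g :: "'a \<Rightarrow> 'b::{banach, second_countable_topology}"
  assumes [measurable]: "g \<in> borel_measurable M" "S \<in> sets M"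
  shows "ennreal ((norm (\<integral>x. indicator S x *\<^sub>R g x \<partial>M))\<^sup>2)
    \<le> emeasure M S * (\<integral>\<^sup>+x. indicator S x * ennreal ((norm (g x))\<^sup>2) \<partial>M)"
proof (cases "integrable M (\<lambda>x. indicator S x *\<^sub>R g x)")
  case True
  have ind: "ennreal (norm (indicator S x *\<^sub>R g x)) = indicator S x * (indicator S x * ennreal (norm (g x)))" for x
    by (auto simp: indicator_def)
  have "ennreal ((norm (\<integral>x. indicator S x *\<^sub>R g x \<partial>M))\<^sup>2) = (ennreal (norm (\<integral>x. indicator S x *\<^sub>R g x \<partial>M)))\<^sup>2"
    by (simp add: ennreal_power)
  also have "\<dots> \<le> (\<integral>\<^sup>+x. indicator S x * (indicator S x * ennreal (norm (g x))) \<partial>M)\<^sup>2"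
    using integral_norm_bound_ennreal[OF True] unfolding ind by (intro power_mono) auto
  also have "\<dots> \<le> (\<integral>\<^sup>+x. (indicator S x)\<^sup>2 \<partial>M) * (\<integral>\<^sup>+x. (indicator S x * ennreal (norm (g x)))\<^sup>2 \<partial>M)"
    by (rule Cauchy_Schwarz_nn_integral) auto
  also have "(\<integral>\<^sup>+x. (indicator S x)\<^sup>2 \<partial>M) = emeasure M S"
  proof -
    have "(indicator S x)\<^sup>2 = (indicator S x :: ennreal)" for x
      by (simp add: indicator_def)
    then show ?thesis by simp
  qed
  also have "(\<integral>\<^sup>+x. (indicator S x * ennreal (norm (g x)))\<^sup>2 \<partial>M) = (\<integral>\<^sup>+x. indicator S x * ennreal ((norm (g x))\<^sup>2) \<partial>M)"
    by (auto intro!: nn_integral_cong simp: indicator_def ennreal_power)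
  finally show ?thesis .
\<comment> \<open>The Bochner integral of a non-integrable function is 0 by convention.\<close>
qed (simp add: not_integrable_integral_eq)

text \<open>Expand \<open>h\<close> in the orthonormal basis and apply Cauchy-Schwarz to the
  coordinates.\<close>

lemma norm_frechet_derivative_power2_le:
  fixes f :: "'a::euclidean_space \<Rightarrow> complex"
  assumes "smooth f"
  shows "(norm (frechet_derivative f (at x) h))\<^sup>2 \<le> (norm h)\<^sup>2 * (\<Sum>b\<in>Basis. (norm (partial_derivative b f x))\<^sup>2)"
proof -
  note lin = has_derivative_linear[OF smooth_has_derivative[OF assms, of x]]
  have "frechet_derivative f (at x) h = frechet_derivative f (at x) (\<Sum>b\<in>Basis. (h \<bullet> b) *\<^sub>R b)"
    by (simp add: euclidean_representation)
  also have "\<dots> = (\<Sum>b\<in>Basis. (h \<bullet> b) *\<^sub>R partial_derivative b f x)"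
    by (simp add: linear_sum[OF lin] linear_cmul[OF lin] partial_derivative_def)
  finally have "norm (frechet_derivative f (at x) h) \<le> (\<Sum>b\<in>Basis. \<bar>h \<bullet> b\<bar> * norm (partial_derivative b f x))"
    by (auto intro!: order_trans[OF norm_sum])
  then have "(norm (frechet_derivative f (at x) h))\<^sup>2 \<le> (\<Sum>b\<in>Basis. \<bar>h \<bullet> b\<bar> * norm (partial_derivative b f x))\<^sup>2"
    by (intro power_mono) auto
  also have "\<dots> \<le> (\<Sum>b\<in>Basis. \<bar>h \<bullet> b\<bar>\<^sup>2) * (\<Sum>b\<in>Basis. (norm (partial_derivative b f x))\<^sup>2)"
    by (rule Cauchy_Schwarz_ineq_sum)
  also have "(\<Sum>b\<in>Basis. \<bar>h \<bullet> b\<bar>\<^sup>2) = (norm h)\<^sup>2"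
    unfolding power2_norm_eq_inner euclidean_inner[of h h] by (simp add: power2_eq_square)
  finally show ?thesis .
qed

lemma test_functions_integrable_energy:
  assumes "\<phi> \<in> test_functions (\<Omega> :: 'a::euclidean_space set)"
  shows "integrable lborel (\<lambda>x. \<Sum>b\<in>Basis. (norm (partial_derivative b \<phi> x))\<^sup>2)"
  by (intro Bochner_Integration.integrable_sum test_functions_integrable_norm_power2[of _ \<Omega>]
      test_functions_partial_derivative assms)

lemma nn_integral_energy:
  assumes "\<phi> \<in> test_functions (\<Omega> :: 'a::euclidean_space set)"
  shows "(\<integral>\<^sup>+x. ennreal (\<Sum>b\<in>Basis. (norm (partial_derivative b \<phi> x))\<^sup>2) \<partial>lborel) = ennreal (dirichlet_energy \<phi>)"
  unfolding dirichlet_energy_def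
  by (intro nn_integral_eq_integral test_functions_integrable_energy[OF assms] AE_I2 sum_nonneg) simp

text \<open>The increment is the integral of the derivative over the segment parameter s in [0, 1].
  Cauchy-Schwarz in s costs nothing, as the interval has length 1; after Tonelli, translation
  invariance removes the shift by s h.\<close>

lemma translation_estimate:
  fixes f :: "'a::euclidean_space \<Rightarrow> complex"
  assumes f: "f \<in> test_functions UNIV"
  shows "(\<integral>\<^sup>+x. ennreal ((norm (f (x + h) - f x))\<^sup>2) \<partial>lborel) \<le> ennreal ((norm h)\<^sup>2 * dirichlet_energy f)"
proof -
  define G where "G = (\<lambda>x. frechet_derivative f (at x) h)"
  have G: "G \<in> test_functions UNIV"
    unfolding G_def by (rule test_functions_frechet_derivative[OF f])
  note [measurable] = test_functions_borel_measurable[OF G]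
  have "ennreal ((norm (f (x + h) - f x))\<^sup>2) \<le> (\<integral>\<^sup>+s. indicator {0..1} s * ennreal ((norm (G (x + s *\<^sub>R h)))\<^sup>2) \<partial>lborel)" for x
  proof -
    have "(\<integral>s. indicator {0..1} s *\<^sub>R G (x + s *\<^sub>R h) \<partial>lborel) = f (x + h) - f x"
      unfolding G_def by (rule smooth_difference_eq_integral[OF test_functions_smooth[OF f]])
    then show ?thesis
      using norm_power2_integral_le[of "\<lambda>s. G (x + s *\<^sub>R h)" lborel "{0..1}"] by simp
  qed
  then have "(\<integral>\<^sup>+x. ennreal ((norm (f (x + h) - f x))\<^sup>2) \<partial>lborel)
      \<le> (\<integral>\<^sup>+x. (\<integral>\<^sup>+s. indicator {0..1} s * ennreal ((norm (G (x + s *\<^sub>R h)))\<^sup>2) \<partial>lborel) \<partial>lborel)"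
    by (intro nn_integral_mono)
  also have "\<dots> = (\<integral>\<^sup>+s. (\<integral>\<^sup>+x. indicator {0..1} s * ennreal ((norm (G (x + s *\<^sub>R h)))\<^sup>2) \<partial>lborel) \<partial>(lborel :: real measure))"
    by (rule lborel_pair.Fubini') measurable
  also have "\<dots> = (\<integral>\<^sup>+s. indicator {0..1} s * (\<integral>\<^sup>+x. ennreal ((norm (G x))\<^sup>2) \<partial>lborel) \<partial>(lborel :: real measure))"
  proof (rule nn_integral_cong)
    fix s :: real
    show "(\<integral>\<^sup>+x. indicator {0..1} s * ennreal ((norm (G (x + s *\<^sub>R h)))\<^sup>2) \<partial>lborel)
        = indicator {0..1} s * (\<integral>\<^sup>+x. ennreal ((norm (G x))\<^sup>2) \<partial>lborel)"
      using nn_integral_lborel_translate[of "\<lambda>x. ennreal ((norm (G x))\<^sup>2)" "s *\<^sub>R h"]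
      by (simp add: nn_integral_cmult add.commute)
  qed
  also have "\<dots> = (\<integral>\<^sup>+x. ennreal ((norm (G x))\<^sup>2) \<partial>lborel)"
    by (simp add: nn_integral_multc)
  also have "\<dots> \<le> (\<integral>\<^sup>+x. ennreal ((norm h)\<^sup>2) * ennreal (\<Sum>b\<in>Basis. (norm (partial_derivative b f x))\<^sup>2) \<partial>lborel)"
    unfolding G_def
    by (intro nn_integral_mono)
      (simp add: norm_frechet_derivative_power2_le[OF test_functions_smooth[OF f]] sum_nonneg flip: ennreal_mult)
  also have "\<dots> = ennreal ((norm h)\<^sup>2) * ennreal (dirichlet_energy f)"
    using test_functions_integrable_energy[OF f] by (simp add: nn_integral_cmult nn_integral_energy[OF f])
  finally show ?thesis by (simp add: ennreal_mult dirichlet_energy_nonneg)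
qed

subsection \<open>Averaging over the cells of a grid\<close>

text \<open>Half-open cubes of side 1 / (N + 1), encoded by floors of scaled coordinates: lying in
  the same cell is then visibly an equivalence relation and jointly measurable. \<open>Suc N\<close>
  avoids a division by 0.\<close>

definition grid_cell :: "nat \<Rightarrow> 'a::euclidean_space \<Rightarrow> 'a set" where
  "grid_cell N x = {y. \<forall>b\<in>Basis. \<lfloor>real (Suc N) * (y \<bullet> b)\<rfloor> = \<lfloor>real (Suc N) * (x \<bullet> b)\<rfloor>}"

lemma grid_cell_eq: "y \<in> grid_cell N x \<Longrightarrow> grid_cell N y = grid_cell N x"
  by (auto simp: grid_cell_def)

lemma measurable_grid_cell_pair [measurable]:
  "Measurable.pred (borel \<Otimes>\<^sub>M borel) (\<lambda>(x, y::'a::euclidean_space). y \<in> grid_cell N x)"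
proof -
  have "{p \<in> space (borel \<Otimes>\<^sub>M borel). snd p \<in> grid_cell N (fst p :: 'a)} =
    (\<Inter>b\<in>Basis. {p \<in> space (borel \<Otimes>\<^sub>M borel). real_of_int \<lfloor>real (Suc N) * (snd p \<bullet> b)\<rfloor> = real_of_int \<lfloor>real (Suc N) * (fst p \<bullet> b)\<rfloor>})"
    by (auto simp: grid_cell_def space_pair_measure)
  also have "\<dots> \<in> sets (borel \<Otimes>\<^sub>M borel)"
    by (intro sets.finite_INT) measurable
  finally show ?thesis by (simp add: pred_def case_prod_unfold)
qed

lemma grid_cell_borel [measurable]: "grid_cell N x \<in> sets borel"
  using measurable_compose[OF measurable_Pair1'[of x borel borel] measurable_grid_cell_pair[of N]]
  by (simp add: pred_def)

text \<open>A half-open cube lies between the open and the closed box of equal volume. Volume,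
  interior points and diameter of a cell are all read off from this sandwich.\<close>

lemma grid_cell_box:
  fixes x :: "'a::euclidean_space"
  obtains l where "box l (l + (1 / Suc N) *\<^sub>R One) \<subseteq> grid_cell N x" "grid_cell N x \<subseteq> cbox l (l + (1 / Suc N) *\<^sub>R One)"
proof
  let ?k = "\<lambda>b. real_of_int \<lfloor>real (Suc N) * (x \<bullet> b)\<rfloor>"
  let ?l = "(\<Sum>b\<in>Basis. (?k b / Suc N) *\<^sub>R b) :: 'a"
  have l: "?l \<bullet> b = ?k b / Suc N" if "b \<in> Basis" for b
    using that by simp
  have *: "b \<in> Basis \<Longrightarrow> \<lfloor>real (Suc N) * (y \<bullet> b)\<rfloor> = \<lfloor>real (Suc N) * (x \<bullet> b)\<rfloor> \<longleftrightarrow>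
      ?l \<bullet> b \<le> y \<bullet> b \<and> y \<bullet> b < ?l \<bullet> b + 1 / Suc N" for y b
    unfolding l floor_eq_iff by (simp add: field_simps del: of_nat_Suc)
  show "box ?l (?l + (1 / Suc N) *\<^sub>R One) \<subseteq> grid_cell N x"
    unfolding grid_cell_def box_def using * by (auto simp: inner_add_left simp del: of_nat_Suc intro: less_imp_le)
  show "grid_cell N x \<subseteq> cbox ?l (?l + (1 / Suc N) *\<^sub>R One)"
    unfolding grid_cell_def cbox_def using * by (auto simp: inner_add_left simp del: of_nat_Suc intro: less_imp_le)
qed

lemma emeasure_grid_cell:
  fixes x :: "'a::euclidean_space"
  shows "emeasure lborel (grid_cell N x) = ennreal ((1 / Suc N) ^ DIM('a))"
proof -
  obtain l where l: "box l (l + (1 / Suc N) *\<^sub>R One) \<subseteq> grid_cell N x" "grid_cell N x \<subseteq> cbox l (l + (1 / Suc N) *\<^sub>R One)"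
    by (rule grid_cell_box)
  have "emeasure lborel (grid_cell N x) \<le> emeasure lborel (cbox l (l + (1 / Suc N) *\<^sub>R One))"
    by (rule emeasure_mono[OF l(2)]) simp
  moreover have "emeasure lborel (box l (l + (1 / Suc N) *\<^sub>R One)) \<le> emeasure lborel (grid_cell N x)"
    by (rule emeasure_mono[OF l(1)]) simp
  ultimately show ?thesis
    by (subst (asm) emeasure_lborel_cbox, simp add: inner_add_left)
      (subst (asm) emeasure_lborel_box, auto simp: inner_add_left prod_constant)
qed

text \<open>A cell contains a nonempty open box. Hence countably many representatives reach every
  cell of every grid.\<close>

lemma grid_cell_contains_dense:
  assumes "closure D = UNIV"
  obtains z where "z \<in> D" "z \<in> grid_cell N (x::'a::euclidean_space)"
proof -
  obtain l where l: "box l (l + (1 / Suc N) *\<^sub>R One) \<subseteq> grid_cell N x"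
    by (rule grid_cell_box)
  have "box l (l + (1 / Suc N) *\<^sub>R One) \<noteq> {}"
    by (simp add: box_ne_empty inner_add_left)
  then have "box l (l + (1 / Suc N) *\<^sub>R One) \<inter> D \<noteq> {}"
    using assms open_Int_closure_eq_empty[of "box l (l + (1 / Suc N) *\<^sub>R One)" D] by auto
  with l show ?thesis using that by auto
qed

text \<open>The displacement within a cell lies in a cube that does not depend on the cell, which
  lets the order of integration be exchanged in \<open>grid_poincare\<close>.\<close>

lemma grid_cell_diff:
  fixes x :: "'a::euclidean_space"
  assumes "y \<in> grid_cell N x"
  shows "y - x \<in> cbox (- (1 / Suc N) *\<^sub>R One) ((1 / Suc N) *\<^sub>R One)"
proof -
  have "x \<in> grid_cell N x" by (simp add: grid_cell_def)
  obtain l where l: "grid_cell N x \<subseteq> cbox l (l + (1 / Suc N) *\<^sub>R One)"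
    by (rule grid_cell_box)
  then have "x \<in> cbox l (l + (1 / Suc N) *\<^sub>R One)" "y \<in> cbox l (l + (1 / Suc N) *\<^sub>R One)"
    using \<open>x \<in> grid_cell N x\<close> assms by auto
  then show ?thesis
    unfolding mem_box by (fastforce simp: inner_add_left inner_diff_left algebra_simps simp del: of_nat_Suc)
qed

lemma norm_le_of_mem_cube:
  fixes h :: "'a::euclidean_space" and a :: real
  assumes "h \<in> cbox (- a *\<^sub>R One) (a *\<^sub>R One)"
  shows "norm h \<le> DIM('a) * a"
proof -
  have "norm h \<le> (\<Sum>b\<in>Basis. \<bar>h \<bullet> b\<bar>)" by (rule norm_le_l1)
  also have "\<dots> \<le> (\<Sum>b\<in>(Basis::'a set). a)"
    using assms by (intro sum_mono) (force simp: mem_box abs_le_iff)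
  finally show ?thesis by simp
qed

text \<open>The factor is the reciprocal of the cell volume, so this is the conditional expectation
  onto functions that are constant on cells.\<close>

definition grid_average :: "nat \<Rightarrow> ('a::euclidean_space \<Rightarrow> complex) \<Rightarrow> 'a \<Rightarrow> complex" where
  "grid_average N f x = of_real (real (Suc N) ^ DIM('a)) * (\<integral>y. indicator (grid_cell N x) y *\<^sub>R f y \<partial>lborel)"

lemma borel_measurable_grid_average [measurable]:
  assumes [measurable]: "f \<in> borel_measurable borel"
  shows "grid_average N f \<in> borel_measurable borel"
proof -
  have [measurable]: "(\<lambda>(x, y::'a). indicat_real (grid_cell N x) y) \<in> borel_measurable (borel \<Otimes>\<^sub>M borel)"
    unfolding indicator_def of_bool_def
    using measurable_grid_cell_pair[of N, where 'a = 'a] by (simp add: case_prod_unfold)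
  show ?thesis
    unfolding grid_average_def[abs_def] by measurable
qed

text \<open>The difference is the average of f(x) - f(y) over the cell. Cauchy-Schwarz on a cell of
  volume 1/n turns the prefactor n squared into n.\<close>

lemma grid_average_diff_le:
  fixes f :: "'a::euclidean_space \<Rightarrow> complex"
  assumes f: "f \<in> test_functions UNIV"
  shows "ennreal ((norm (f x - grid_average N f x))\<^sup>2)
    \<le> ennreal (real (Suc N) ^ DIM('a)) * (\<integral>\<^sup>+y. indicator (grid_cell N x) y * ennreal ((norm (f x - f y))\<^sup>2) \<partial>lborel)"
proof -
  define n where "n = real (Suc N) ^ DIM('a)"
  have n: "n > 0" by (simp add: n_def)
  have vol: "emeasure lborel (grid_cell N x) = ennreal (1 / n)"
    by (simp add: emeasure_grid_cell n_def power_one_over del: of_nat_Suc)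
  note [measurable] = test_functions_borel_measurable[OF f]
  have "integrable lborel (\<lambda>y. indicator (grid_cell N x) y *\<^sub>R f y)"
    by (rule integrable_mult_indicator[OF _ test_functions_integrable[OF f]]) simp
  moreover have "integrable lborel (\<lambda>y. indicator (grid_cell N x) y *\<^sub>R f x)"
    by (rule integrable_scaleR_left, rule integrable_real_indicator) (auto simp: vol)
  ultimately have "(\<integral>y. indicator (grid_cell N x) y *\<^sub>R (f x - f y) \<partial>lborel)
      = (1 / n) *\<^sub>R f x - (\<integral>y. indicator (grid_cell N x) y *\<^sub>R f y \<partial>lborel)"
    using n by (simp add: scaleR_diff_right measure_def vol)
  then have "f x - grid_average N f x = n *\<^sub>R (\<integral>y. indicator (grid_cell N x) y *\<^sub>R (f x - f y) \<partial>lborel)"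
  proof -
    assume "(\<integral>y. indicator (grid_cell N x) y *\<^sub>R (f x - f y) \<partial>lborel)
      = (1 / n) *\<^sub>R f x - (\<integral>y. indicator (grid_cell N x) y *\<^sub>R f y \<partial>lborel)"
    moreover have "grid_average N f x = n *\<^sub>R (\<integral>y. indicator (grid_cell N x) y *\<^sub>R f y \<partial>lborel)"
      unfolding grid_average_def n_def scaleR_conv_of_real ..
    ultimately show ?thesis
      using n by (simp only: scaleR_diff_right scaleR_scaleR) simp
  qed
  then have "ennreal ((norm (f x - grid_average N f x))\<^sup>2)
      = ennreal (n\<^sup>2) * ennreal ((norm (\<integral>y. indicator (grid_cell N x) y *\<^sub>R (f x - f y) \<partial>lborel))\<^sup>2)"
    by (simp add: power_mult_distrib flip: ennreal_mult)
  also have "\<dots> \<le> ennreal (n\<^sup>2) * (ennreal (1 / n) * (\<integral>\<^sup>+y. indicator (grid_cell N x) y * ennreal ((norm (f x - f y))\<^sup>2) \<partial>lborel))"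
    using norm_power2_integral_le[of "\<lambda>y. f x - f y" lborel "grid_cell N x"]
    by (intro mult_left_mono) (simp_all add: vol)
  also have "\<dots> = ennreal n * (\<integral>\<^sup>+y. indicator (grid_cell N x) y * ennreal ((norm (f x - f y))\<^sup>2) \<partial>lborel)"
    using n by (simp add: power2_eq_square flip: mult.assoc ennreal_mult)
  finally show ?thesis by (simp add: n_def)
qed

text \<open>Substitute y = x + h, enlarge the range of h to the fixed cube \<open>C\<close>,
  exchange the integrals and apply \<open>translation_estimate\<close> for each h. In
  \<open>C\<close> the norm of h is at most DIM / (N + 1), and the volume of \<open>C\<close> is 2 ^
  DIM times that of a cell; the cell volume cancels the factor n.\<close>

lemma grid_poincare:
  fixes f :: "'a::euclidean_space \<Rightarrow> complex"
  assumes f: "f \<in> test_functions UNIV"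
  shows "(\<integral>\<^sup>+x. ennreal ((norm (f x - grid_average N f x))\<^sup>2) \<partial>lborel)
    \<le> ennreal (2 ^ DIM('a) * (DIM('a) / Suc N)\<^sup>2 * dirichlet_energy f)"
proof -
  define n where "n = real (Suc N) ^ DIM('a)"
  have n: "n > 0" by (simp add: n_def)
  define C where "C = cbox (- (1 / Suc N) *\<^sub>R One) ((1 / Suc N) *\<^sub>R (One::'a))"
  have [measurable]: "C \<in> sets borel" by (simp add: C_def)
  have vol: "emeasure lborel C = ennreal (2 ^ DIM('a) / n)"
  proof -
    have "emeasure lborel C = ennreal (\<Prod>b\<in>(Basis::'a set). 2 / Suc N)"
      unfolding C_def by (subst emeasure_lborel_cbox) (auto simp: inner_diff_left algebra_simps intro!: arg_cong[of _ _ ennreal] prod.cong)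
    then show ?thesis by (simp add: n_def power_divide)
  qed
  note [measurable] = test_functions_borel_measurable[OF f]
  have "(\<integral>\<^sup>+y. indicator (grid_cell N x) y * ennreal ((norm (f x - f y))\<^sup>2) \<partial>lborel)
      \<le> (\<integral>\<^sup>+h. indicator C h * ennreal ((norm (f (x + h) - f x))\<^sup>2) \<partial>lborel)" for x
  proof -
    have "(\<integral>\<^sup>+y. indicator (grid_cell N x) y * ennreal ((norm (f x - f y))\<^sup>2) \<partial>lborel)
        = (\<integral>\<^sup>+h. indicator (grid_cell N x) (x + h) * ennreal ((norm (f x - f (x + h)))\<^sup>2) \<partial>lborel)"
      by (rule nn_integral_lborel_translate[symmetric]) measurable
    also have "\<dots> \<le> (\<integral>\<^sup>+h. indicator C h * ennreal ((norm (f (x + h) - f x))\<^sup>2) \<partial>lborel)"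
      using grid_cell_diff[of "x + _" N x]
      by (intro nn_integral_mono mult_mono) (auto simp: C_def norm_minus_commute split: split_indicator)
    finally show ?thesis .
  qed
  then have "ennreal ((norm (f x - grid_average N f x))\<^sup>2)
      \<le> ennreal n * (\<integral>\<^sup>+h. indicator C h * ennreal ((norm (f (x + h) - f x))\<^sup>2) \<partial>lborel)" for x
    using grid_average_diff_le[OF f, of x N] unfolding n_def by (meson mult_left_mono order_trans zero_le)
  then have "(\<integral>\<^sup>+x. ennreal ((norm (f x - grid_average N f x))\<^sup>2) \<partial>lborel)
      \<le> (\<integral>\<^sup>+x. ennreal n * (\<integral>\<^sup>+h. indicator C h * ennreal ((norm (f (x + h) - f x))\<^sup>2) \<partial>lborel) \<partial>lborel)"
    by (intro nn_integral_mono)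
  also have "\<dots> = ennreal n * (\<integral>\<^sup>+x. (\<integral>\<^sup>+h. indicator C h * ennreal ((norm (f (x + h) - f x))\<^sup>2) \<partial>lborel) \<partial>lborel)"
    by (rule nn_integral_cmult) measurable
  also have "(\<integral>\<^sup>+x. (\<integral>\<^sup>+h. indicator C h * ennreal ((norm (f (x + h) - f x))\<^sup>2) \<partial>lborel) \<partial>lborel)
      = (\<integral>\<^sup>+h. (\<integral>\<^sup>+x. indicator C h * ennreal ((norm (f (x + h) - f x))\<^sup>2) \<partial>lborel) \<partial>lborel)"
    by (rule lborel_pair.Fubini') measurable
  also have "\<dots> = (\<integral>\<^sup>+h. indicator C h * (\<integral>\<^sup>+x. ennreal ((norm (f (x + h) - f x))\<^sup>2) \<partial>lborel) \<partial>lborel)"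
    by (intro nn_integral_cong nn_integral_cmult) measurable
  also have "\<dots> \<le> (\<integral>\<^sup>+h. ennreal ((DIM('a) / Suc N)\<^sup>2 * dirichlet_energy f) * indicator C h \<partial>lborel)"
  proof (intro nn_integral_mono)
    fix h :: 'a
    show "indicator C h * (\<integral>\<^sup>+x. ennreal ((norm (f (x + h) - f x))\<^sup>2) \<partial>lborel)
        \<le> ennreal ((DIM('a) / Suc N)\<^sup>2 * dirichlet_energy f) * indicator C h"
    proof (cases "h \<in> C")
      case True
      then have "norm h \<le> DIM('a) * (1 / Suc N)"
        unfolding C_def by (intro norm_le_of_mem_cube) simp
      then have "(norm h)\<^sup>2 * dirichlet_energy f \<le> (DIM('a) / Suc N)\<^sup>2 * dirichlet_energy f"
        by (intro mult_right_mono power_mono dirichlet_energy_nonneg) auto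
      then have "(\<integral>\<^sup>+x. ennreal ((norm (f (x + h) - f x))\<^sup>2) \<partial>lborel) \<le> ennreal ((DIM('a) / Suc N)\<^sup>2 * dirichlet_energy f)"
        using translation_estimate[OF f, of h] by (meson ennreal_leI order_trans)
      then show ?thesis using True by simp
    qed simp
  qed
  also have "\<dots> = ennreal ((DIM('a) / Suc N)\<^sup>2 * dirichlet_energy f) * ennreal (2 ^ DIM('a) / n)"
    by (simp add: nn_integral_cmult_indicator vol)
  also have "ennreal n * (ennreal ((DIM('a) / Suc N)\<^sup>2 * dirichlet_energy f) * ennreal (2 ^ DIM('a) / n))
      = ennreal (2 ^ DIM('a) * (DIM('a) / Suc N)\<^sup>2 * dirichlet_energy f)"
    using n dirichlet_energy_nonneg[of f] by (simp flip: ennreal_mult del: of_nat_Suc)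
  finally show ?thesis
    by (simp add: mult_left_mono)
qed

section \<open>Rellich's theorem for test functions\<close>

lemma dirichlet_energy_diff_le:
  assumes "\<phi> \<in> test_functions (UNIV :: 'a::euclidean_space set)" "\<psi> \<in> test_functions UNIV"
  shows "dirichlet_energy (\<lambda>x. \<phi> x - \<psi> x) \<le> 2 * dirichlet_energy \<phi> + 2 * dirichlet_energy \<psi>"
proof -
  have eq: "partial_derivative b (\<lambda>x. \<phi> x - \<psi> x) = (\<lambda>x. partial_derivative b \<phi> x - partial_derivative b \<psi> x)" for b
    using partial_derivative_add[OF assms(1) test_functions_cmult[OF assms(2), of "-1"]]
      partial_derivative_cmult[OF assms(2), of _ "-1"] by simp
  have "dirichlet_energy (\<lambda>x. \<phi> x - \<psi> x) \<le> (\<integral>x. 2 * (\<Sum>b\<in>Basis. (norm (partial_derivative b \<phi> x))\<^sup>2)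
      + 2 * (\<Sum>b\<in>Basis. (norm (partial_derivative b \<psi> x))\<^sup>2) \<partial>lborel)"
    unfolding dirichlet_energy_def
  proof (rule integral_mono)
    show "integrable lborel (\<lambda>x. \<Sum>b\<in>Basis. (norm (partial_derivative b (\<lambda>x. \<phi> x - \<psi> x) x))\<^sup>2)"
      by (intro test_functions_integrable_energy[of _ UNIV] test_functions_diff assms)
    show "integrable lborel (\<lambda>x. 2 * (\<Sum>b\<in>Basis. (norm (partial_derivative b \<phi> x))\<^sup>2)
      + 2 * (\<Sum>b\<in>Basis. (norm (partial_derivative b \<psi> x))\<^sup>2))"
      by (intro Bochner_Integration.integrable_add integrable_mult_right test_functions_integrable_energy[of _ UNIV] assms)
    have "(norm (a - b))\<^sup>2 \<le> 2 * (norm a)\<^sup>2 + 2 * (norm b)\<^sup>2" for a b :: complex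
      using norm_triangle_ineq4[of a b] power_mono[of "norm (a - b)" "norm a + norm b" 2]
        sum_squares_bound[of "norm a" "norm b"] by (simp add: power2_sum)
    then show "(\<Sum>b\<in>Basis. (norm (partial_derivative b (\<lambda>x. \<phi> x - \<psi> x) x))\<^sup>2)
      \<le> 2 * (\<Sum>b\<in>Basis. (norm (partial_derivative b \<phi> x))\<^sup>2) + 2 * (\<Sum>b\<in>Basis. (norm (partial_derivative b \<psi> x))\<^sup>2)" for x
      unfolding eq sum_distrib_left sum.distrib[symmetric] by (intro sum_mono) auto
  qed
  also have "\<dots> = 2 * dirichlet_energy \<phi> + 2 * dirichlet_energy \<psi>"
    unfolding dirichlet_energy_def by (simp add: test_functions_integrable_energy[OF assms(1)] test_functions_integrable_energy[OF assms(2)])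
  finally show ?thesis .
qed

text \<open>Cauchy-Schwarz on a cell, whose volume is at most 1. The bound is uniform over functions
  and cells, as the diagonal argument requires.\<close>

lemma norm_grid_integral_le:
  fixes \<phi> :: "'a::euclidean_space \<Rightarrow> complex"
  assumes "\<phi> \<in> test_functions \<Omega>" "(\<integral>x. (norm (\<phi> x))\<^sup>2 \<partial>lborel) \<le> 1"
  shows "norm (\<integral>y. indicator (grid_cell N x) y *\<^sub>R \<phi> y \<partial>lborel) \<le> 1"
proof -
  note [measurable] = test_functions_borel_measurable[OF assms(1)]
  have "ennreal ((norm (\<integral>y. indicator (grid_cell N x) y *\<^sub>R \<phi> y \<partial>lborel))\<^sup>2)
      \<le> emeasure lborel (grid_cell N x) * (\<integral>\<^sup>+y. indicator (grid_cell N x) y * ennreal ((norm (\<phi> y))\<^sup>2) \<partial>lborel)"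
    by (rule norm_power2_integral_le) auto
  also have "\<dots> \<le> 1 * (\<integral>\<^sup>+y. ennreal ((norm (\<phi> y))\<^sup>2) \<partial>lborel)"
    by (intro mult_mono nn_integral_mono)
      (auto simp: emeasure_grid_cell power_le_one simp del: of_nat_Suc split: split_indicator)
  also have "\<dots> \<le> 1"
    using assms by (simp add: nn_integral_eq_integral test_functions_integrable_norm_power2)
  finally show ?thesis
    by (simp add: ennreal_le_iff2 power_le_one_iff abs_square_le_1)
qed

text \<open>Points of one cell are at most \<open>DIM('a)\<close> apart, so averaging enlarges the
  support by no more than that. This supplies a common dominating function for all averages at a
  fixed level.\<close>

lemma grid_average_eq_0:
  fixes \<phi> :: "'a::euclidean_space \<Rightarrow> complex"
  assumes "\<And>y. norm y > R \<Longrightarrow> \<phi> y = 0" "norm x > R + DIM('a)"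
  shows "grid_average N \<phi> x = 0"
proof -
  have "indicator (grid_cell N x) y *\<^sub>R \<phi> y = 0" for y
  proof (cases "y \<in> grid_cell N x")
    case True
    have "norm (y - x) \<le> DIM('a) * (1 / Suc N)"
      using grid_cell_diff[OF True] by (intro norm_le_of_mem_cube) simp
    also have "\<dots> \<le> DIM('a)" by (simp add: field_simps)
    finally have "norm y > R" using assms(2) norm_triangle_ineq2[of x y] by (simp add: norm_minus_commute)
    then show ?thesis using assms(1) by simp
  qed simp
  then have "(\<lambda>y. indicator (grid_cell N x) y *\<^sub>R \<phi> y) = (\<lambda>_. 0)" by (rule ext)
  then show ?thesis unfolding grid_average_def by (simp only: integral_zero mult_zero_right)
qed

lemma nn_integral_norm_power2_diff_le:
  fixes f g h :: "'a \<Rightarrow> complex"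
  assumes [measurable]: "f \<in> borel_measurable M" "g \<in> borel_measurable M" "h \<in> borel_measurable M"
  shows "(\<integral>\<^sup>+x. ennreal ((norm (f x - g x))\<^sup>2) \<partial>M)
    \<le> 2 * (\<integral>\<^sup>+x. ennreal ((norm (f x - h x))\<^sup>2) \<partial>M) + 2 * (\<integral>\<^sup>+x. ennreal ((norm (g x - h x))\<^sup>2) \<partial>M)"
proof -
  have "(norm (a - b))\<^sup>2 \<le> 2 * (norm (a - c))\<^sup>2 + 2 * (norm (b - c))\<^sup>2" for a b c :: complex
    using norm_triangle_ineq4[of "a - c" "b - c"] power_mono[of "norm (a - b)" "norm (a - c) + norm (b - c)" 2]
      sum_squares_bound[of "norm (a - c)" "norm (b - c)"] by (simp add: power2_sum)
  then have "ennreal ((norm (f x - g x))\<^sup>2) \<le> 2 * ennreal ((norm (f x - h x))\<^sup>2) + 2 * ennreal ((norm (g x - h x))\<^sup>2)" for x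
    by (simp add: ennreal_leI flip: ennreal_plus ennreal_numeral ennreal_mult)
  then have "(\<integral>\<^sup>+x. ennreal ((norm (f x - g x))\<^sup>2) \<partial>M)
      \<le> (\<integral>\<^sup>+x. 2 * ennreal ((norm (f x - h x))\<^sup>2) + 2 * ennreal ((norm (g x - h x))\<^sup>2) \<partial>M)"
    by (intro nn_integral_mono)
  also have "\<dots> = 2 * (\<integral>\<^sup>+x. ennreal ((norm (f x - h x))\<^sup>2) \<partial>M) + 2 * (\<integral>\<^sup>+x. ennreal ((norm (g x - h x))\<^sup>2) \<partial>M)"
    by (simp add: nn_integral_add nn_integral_cmult)
  finally show ?thesis .
qed

text \<open>One subsequence is chosen for which the averages converge at every level. Given a
  tolerance, first the level \<open>N\<close> is fixed so that the averaging error is small for all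
  differences at once, and only then are the indices taken large.\<close>

lemma rellich:
  fixes \<phi> :: "nat \<Rightarrow> 'a::euclidean_space \<Rightarrow> complex"
  assumes "bounded \<Omega>" and test: "\<And>k. \<phi> k \<in> test_functions \<Omega>"
    and norm_le: "\<And>k. (\<integral>x. (norm (\<phi> k x))\<^sup>2 \<partial>lborel) \<le> 1"
    and energy_le: "\<And>k. dirichlet_energy (\<phi> k) \<le> K"
  obtains r :: "nat \<Rightarrow> nat" where "strict_mono r"
    "\<And>e. e > 0 \<Longrightarrow> \<exists>M. \<forall>j\<ge>M. \<forall>k\<ge>M. (\<integral>x. (norm (\<phi> (r j) x - \<phi> (r k) x))\<^sup>2 \<partial>lborel) < e"
proof -
  obtain R where R: "\<And>x. x \<in> \<Omega> \<Longrightarrow> norm x \<le> R" "R > 0"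
    using \<open>bounded \<Omega>\<close> bounded_pos by metis
  have outside: "\<phi> k x = 0" if "norm x > R" for k x
    using R(1)[of x] that test_functions_outside[OF test] by force
  note test' = test_functions_UNIV[OF test]
  note [measurable] = test_functions_borel_measurable[OF test]
  have "K \<ge> 0" using energy_le[of 0] dirichlet_energy_nonneg[of "\<phi> 0"] by linarith
  \<comment> \<open>The integral over a cell does not depend on the point naming the cell, so points
    of a countable dense set suffice.\<close>
  obtain D :: "'a set" where D: "countable D" "\<And>X. open X \<Longrightarrow> X \<noteq> {} \<Longrightarrow> \<exists>d\<in>D. d \<in> X"
    by (rule countable_dense_setE) blast
  have dense: "closure D = UNIV"
    unfolding closure_iff_nhds_not_empty[abs_def] set_eq_iff
    by simp (metis D(2) IntI empty_iff subsetD)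
  define F where "F = (\<lambda>k (N, z). \<integral>y. indicator (grid_cell N z) y *\<^sub>R \<phi> k y \<partial>lborel)"
  have "countable (UNIV \<times> D :: (nat \<times> 'a) set)" using D(1) by simp
  moreover have "norm (F k p) \<le> 1" for k p
    unfolding F_def by (cases p) (simp add: norm_grid_integral_le[OF test norm_le, simplified])
  \<comment> \<open>The diagonal argument for values bounded by 1, indexed by the countably many
    pairs of a level and a representative.\<close>
  ultimately obtain r where r: "strict_mono r" "\<And>p. p \<in> UNIV \<times> D \<Longrightarrow> \<exists>l. (\<lambda>k. F (r k) p) \<longlonglongrightarrow> l"
    using function_convergent_subsequence[of "UNIV \<times> D" F 1] by blast
  define A where "A = (\<lambda>N k. grid_average N (\<phi> (r k)))"
  have [measurable]: "A N k \<in> borel_measurable borel" for N k by (simp add: A_def)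
  have conv: "convergent (\<lambda>k. A N k x)" for N x
  proof -
    obtain z where z: "z \<in> D" "z \<in> grid_cell N x" using grid_cell_contains_dense[OF dense] by blast
    obtain l where "(\<lambda>k. F (r k) (N, z)) \<longlonglongrightarrow> l" using r(2)[of "(N, z)"] z(1) by auto
    then have "(\<lambda>k. of_real (real (Suc N) ^ DIM('a)) * F (r k) (N, z)) \<longlonglongrightarrow> of_real (real (Suc N) ^ DIM('a)) * l"
      by (intro tendsto_intros)
    moreover have "of_real (real (Suc N) ^ DIM('a)) * F (r k) (N, z) = A N k x" for k
      unfolding A_def F_def grid_average_def by (simp only: grid_cell_eq[OF z(2)] prod.case)
    ultimately show ?thesis unfolding convergent_def by auto
  qed
  define a where "a = (\<lambda>N x. lim (\<lambda>k. A N k x))"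
  have a: "(\<lambda>k. A N k x) \<longlonglongrightarrow> a N x" for N x
    using conv by (simp add: a_def convergent_LIMSEQ_iff)
  have [measurable]: "a N \<in> borel_measurable borel" for N
    by (rule borel_measurable_LIMSEQ_metric[OF _ a]) measurable
  define \<alpha> where "\<alpha> = (\<lambda>N k. \<integral>\<^sup>+x. ennreal ((norm (A N k x - a N x))\<^sup>2) \<partial>lborel)"
  have \<alpha>: "(\<lambda>k. \<alpha> N k) \<longlonglongrightarrow> 0" for N
  proof -
    define B where "B = real (Suc N) ^ DIM('a)"
    have B: "norm (A N k x) \<le> B" for k x
      using norm_grid_integral_le[OF test norm_le, of N x "r k"]
      by (simp add: A_def grid_average_def norm_mult B_def norm_power mult_left_le del: of_nat_Suc)
    have zero: "A N k x = 0" if "norm x > R + DIM('a)" for k x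
      unfolding A_def by (rule grid_average_eq_0[OF outside that])
    have Ba: "norm (a N x) \<le> B" for x
      using LIMSEQ_le_const2[OF tendsto_norm[OF a]] B by blast
    have zero_a: "a N x = 0" if "norm x > R + DIM('a)" for x
      using LIMSEQ_unique[OF a[of N x]] zero[OF that] by simp
    define S where "S = cball (0::'a) (R + DIM('a))"
    have [measurable]: "S \<in> sets borel" by (simp add: S_def)
    \<comment> \<open>Dominated convergence: the averages are bounded by \<open>B\<close> and
      supported in the ball \<open>S\<close>, and both properties pass to the pointwise
      limit.\<close>
    have "(\<lambda>k. \<alpha> N k) \<longlonglongrightarrow> (\<integral>\<^sup>+x. 0 \<partial>(lborel::'a measure))"
      unfolding \<alpha>_def
    proof (rule nn_integral_dominated_convergence)
      let ?w = "\<lambda>x::'a. ennreal ((2 * B)\<^sup>2) * indicator S x"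
      show "AE x in lborel. ennreal ((norm (A N k x - a N x))\<^sup>2) \<le> ?w x" for k
      proof (rule AE_I2)
        fix x :: 'a
        have "norm (A N k x - a N x) \<le> 2 * B"
          using norm_triangle_ineq4[of "A N k x" "a N x"] B[of k x] Ba[of x] by simp
        then have "(norm (A N k x - a N x))\<^sup>2 \<le> (2 * B)\<^sup>2" by (intro power_mono) auto
        then show "ennreal ((norm (A N k x - a N x))\<^sup>2) \<le> ?w x"
          using zero[of x k] zero_a[of x] by (auto simp: indicator_def S_def intro: ennreal_leI)
      qed
      show "(\<integral>\<^sup>+x. ?w x \<partial>lborel) < \<infinity>"
        using emeasure_lborel_cball_finite[of "0::'a" "R + DIM('a)"]
        by (simp add: nn_integral_cmult_indicator ennreal_mult_less_top S_def)
      show "AE x in lborel. (\<lambda>k. ennreal ((norm (A N k x - a N x))\<^sup>2)) \<longlonglongrightarrow> 0"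
      proof (rule AE_I2)
        fix x
        have "(\<lambda>k. ennreal ((norm (A N k x - a N x))\<^sup>2)) \<longlonglongrightarrow> ennreal ((norm (a N x - a N x))\<^sup>2)"
          by (intro tendsto_intros a)
        then show "(\<lambda>k. ennreal ((norm (A N k x - a N x))\<^sup>2)) \<longlonglongrightarrow> 0" by simp
      qed
    qed measurable
    then show ?thesis by simp
  qed
  define c where "c = (\<lambda>N. 2 ^ DIM('a) * (DIM('a) / Suc N)\<^sup>2 * K)"
  \<comment> \<open>The 8 is 2 * 4: a difference has energy at most \<open>4 * K\<close>, and
    splitting off its average doubles squared norms. Comparing two averages through their limit
    doubles again, whence the 4.\<close>
  have bound: "ennreal (\<integral>x. (norm (\<phi> (r j) x - \<phi> (r k) x))\<^sup>2 \<partial>lborel)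
      \<le> ennreal (8 * c N) + (4 * \<alpha> N j + 4 * \<alpha> N k)" for N j k
  proof -
    define f where "f = (\<lambda>x. \<phi> (r j) x - \<phi> (r k) x)"
    have f: "f \<in> test_functions UNIV" unfolding f_def by (intro test_functions_diff test')
    note [measurable] = test_functions_borel_measurable[OF f]
    have int: "integrable lborel (\<lambda>y. indicator (grid_cell N x) y *\<^sub>R \<phi> k y)" for k x
      by (rule integrable_mult_indicator[OF _ test_functions_integrable[OF test]]) simp
    have avg: "grid_average N f x = A N j x - A N k x" for x
      unfolding grid_average_def A_def f_def using int by (simp add: scaleR_diff_right right_diff_distrib)
    have "dirichlet_energy f \<le> 4 * K"
      using dirichlet_energy_diff_le[OF test'[of "r j"] test'[of "r k"]] energy_le[of "r j"] energy_le[of "r k"]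
      by (simp add: f_def)
    then have "2 ^ DIM('a) * (DIM('a) / Suc N)\<^sup>2 * dirichlet_energy f \<le> 2 ^ DIM('a) * (DIM('a) / Suc N)\<^sup>2 * (4 * K)"
      by (intro mult_left_mono) auto
    also have "\<dots> = 4 * c N" by (simp add: c_def)
    finally have 1: "(\<integral>\<^sup>+x. ennreal ((norm (f x - grid_average N f x))\<^sup>2) \<partial>lborel) \<le> ennreal (4 * c N)"
      by (intro order_trans[OF grid_poincare[OF f, of N]] ennreal_leI)
    have 2: "(\<integral>\<^sup>+x. ennreal ((norm (A N j x - A N k x))\<^sup>2) \<partial>lborel) \<le> 2 * \<alpha> N j + 2 * \<alpha> N k"
      unfolding \<alpha>_def by (rule nn_integral_norm_power2_diff_le) measurable
    have "ennreal (\<integral>x. (norm (f x))\<^sup>2 \<partial>lborel) = (\<integral>\<^sup>+x. ennreal ((norm (f x - 0))\<^sup>2) \<partial>lborel)"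
      using test_functions_integrable_norm_power2[OF f] by (simp add: nn_integral_eq_integral)
    also have "\<dots> \<le> 2 * (\<integral>\<^sup>+x. ennreal ((norm (f x - grid_average N f x))\<^sup>2) \<partial>lborel)
        + 2 * (\<integral>\<^sup>+x. ennreal ((norm (0 - grid_average N f x))\<^sup>2) \<partial>lborel)"
      by (rule nn_integral_norm_power2_diff_le) measurable
    also have "\<dots> \<le> 2 * ennreal (4 * c N) + 2 * (2 * \<alpha> N j + 2 * \<alpha> N k)"
      using 1 2 by (intro add_mono mult_left_mono) (simp_all add: avg norm_minus_commute)
    also have "\<dots> = ennreal (8 * c N) + (4 * \<alpha> N j + 4 * \<alpha> N k)"
    proof -
      have "2 * ennreal (4 * c N) = ennreal (8 * c N)"
        using \<open>K \<ge> 0\<close> by (simp add: c_def flip: ennreal_mult ennreal_numeral)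
      moreover have "2 * (2 * x) = 4 * x" for x :: ennreal by (simp flip: mult.assoc)
      ultimately show ?thesis by (simp add: distrib_left)
    qed
    finally show ?thesis by (simp add: f_def)
  qed
  have "\<exists>M. \<forall>j\<ge>M. \<forall>k\<ge>M. (\<integral>x. (norm (\<phi> (r j) x - \<phi> (r k) x))\<^sup>2 \<partial>lborel) < e" if "e > 0" for e
  proof -
    \<comment> \<open>The level takes one half of \<open>e\<close>; the indices then take 4 * e/16
      for each of the two averages, which is the other half.\<close>
    have "(\<lambda>N. 8 * (2 ^ DIM('a) * (DIM('a) * inverse (real (Suc N)))\<^sup>2 * K)) \<longlonglongrightarrow> 8 * (2 ^ DIM('a) * (real DIM('a) * 0)\<^sup>2 * K)"
      by (intro tendsto_intros LIMSEQ_inverse_real_of_nat)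
    then have "(\<lambda>N. 8 * c N) \<longlonglongrightarrow> 0" by (simp add: c_def field_simps del: of_nat_Suc)
    then have "\<forall>\<^sub>F N in sequentially. 8 * c N < e / 2" by (rule order_tendstoD(2)) (use \<open>e > 0\<close> in simp)
    then obtain N where N: "8 * c N < e / 2" by (metis eventually_sequentially order_refl)
    have "\<forall>\<^sub>F k in sequentially. \<alpha> N k < ennreal (e / 16)"
      using \<alpha>[of N] \<open>e > 0\<close> by (intro order_tendstoD(2)) auto
    then obtain M where M: "\<And>k. k \<ge> M \<Longrightarrow> \<alpha> N k < ennreal (e / 16)"
      by (metis eventually_sequentially)
    have "(\<integral>x. (norm (\<phi> (r j) x - \<phi> (r k) x))\<^sup>2 \<partial>lborel) < e" if "j \<ge> M" "k \<ge> M" for j k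
    proof -
      have "ennreal (\<integral>x. (norm (\<phi> (r j) x - \<phi> (r k) x))\<^sup>2 \<partial>lborel)
          \<le> ennreal (8 * c N) + (4 * ennreal (e / 16) + 4 * ennreal (e / 16))"
        using bound[of j k N] M[OF that(1)] M[OF that(2)]
        by (elim order_trans, intro add_mono mult_left_mono) auto
      also have "\<dots> = ennreal (8 * c N + e / 2)"
        using \<open>e > 0\<close> \<open>K \<ge> 0\<close> by (simp add: c_def flip: ennreal_plus ennreal_mult ennreal_numeral)
      finally show ?thesis
        using N \<open>e > 0\<close> \<open>K \<ge> 0\<close> by (subst (asm) ennreal_le_iff) (auto simp: c_def)
    qed
    then show ?thesis by blast
  qed
  with r(1) show ?thesis by (rule that)
qed

section \<open>Completeness of the space of square-integrable functions\<close>

text \<open>The Riesz-Fischer argument: a fast subsequence converges almost everywhere, and Fatou's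
  lemma turns its pointwise limit into the limit of the full sequence.\<close>

lemma nn_integral_power2_Cauchy_limit:
  fixes u :: "nat \<Rightarrow> 'a \<Rightarrow> complex"
  assumes [measurable]: "\<And>k. u k \<in> borel_measurable M"
    and Cauchy: "\<And>e. e > 0 \<Longrightarrow> \<exists>N. \<forall>j\<ge>N. \<forall>k\<ge>N. (\<integral>\<^sup>+x. ennreal ((norm (u j x - u k x))\<^sup>2) \<partial>M) < ennreal e"
  obtains v where "v \<in> borel_measurable M" "(\<lambda>k. \<integral>\<^sup>+x. ennreal ((norm (u k x - v x))\<^sup>2) \<partial>M) \<longlonglongrightarrow> 0"
proof -
  obtain N where N: "\<And>i j k. j \<ge> N i \<Longrightarrow> k \<ge> N i \<Longrightarrow> (\<integral>\<^sup>+x. ennreal ((norm (u j x - u k x))\<^sup>2) \<partial>M) < ennreal ((1/4) ^ i)"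
    using Cauchy[of "(1/4) ^ _"] by (simp add: all_conj_distrib) metis
  \<comment> \<open>The sum makes \<open>s i\<close> exceed every \<open>N l\<close> with
    \<open>l \<le> i\<close>; the summand \<open>i\<close> makes the indices grow even if all
    \<open>N l\<close> are 0.\<close>
  define s where "s = (\<lambda>i. i + (\<Sum>l\<le>i. N l))"
  have sN: "s i \<ge> N l" if "l \<le> i" for i l
    unfolding s_def using that by (intro trans_le_add2 member_le_sum) auto
  define d where "d = (\<lambda>i x. u (s (Suc i)) x - u (s i) x)"
  have [measurable]: "d i \<in> borel_measurable M" for i unfolding d_def by measurable
  have d: "(\<integral>\<^sup>+x. ennreal ((norm (d i x))\<^sup>2) \<partial>M) \<le> ennreal ((1/4) ^ i)" for i
    unfolding d_def using N[OF sN[of i "Suc i"] sN[of i i]] by simp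
  \<comment> \<open>The weights 2 ^ i are small enough against the decay 4 ^ -i for the total to be
    finite, and large enough for pointwise finiteness to make the jumps themselves summable.\<close>
  have "(\<integral>\<^sup>+x. (\<Sum>i. ennreal (2 ^ i * (norm (d i x))\<^sup>2)) \<partial>M) = (\<Sum>i. \<integral>\<^sup>+x. ennreal (2 ^ i) * ennreal ((norm (d i x))\<^sup>2) \<partial>M)"
    by (subst nn_integral_suminf) (auto simp: ennreal_mult)
  also have "\<dots> \<le> (\<Sum>i. ennreal ((1/2) ^ i))"
  proof (rule suminf_le)
    fix i
    have "(\<integral>\<^sup>+x. ennreal (2 ^ i) * ennreal ((norm (d i x))\<^sup>2) \<partial>M) \<le> ennreal (2 ^ i) * ennreal ((1/4) ^ i)"
      using d by (subst nn_integral_cmult) (auto intro: mult_left_mono)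
    also have "\<dots> = ennreal ((1/2) ^ i)"
      by (simp add: power_divide power_mult_distrib[symmetric] flip: ennreal_mult)
        (simp add: field_simps flip: power_mult_distrib)
    finally show "(\<integral>\<^sup>+x. ennreal (2 ^ i) * ennreal ((norm (d i x))\<^sup>2) \<partial>M) \<le> ennreal ((1/2) ^ i)" .
  qed auto
  also have "\<dots> < \<infinity>"
    by (simp add: suminf_ennreal2 summable_geometric)
  finally have "AE x in M. (\<Sum>i. ennreal (2 ^ i * (norm (d i x))\<^sup>2)) \<noteq> \<infinity>"
    by (intro nn_integral_noteq_infinite) auto
  then have AE: "AE x in M. convergent (\<lambda>i. u (s i) x)"
  proof eventually_elim
    case (elim x)
    then have "summable (\<lambda>i. 2 ^ i * (norm (d i x))\<^sup>2)"
      by (intro summable_suminf_not_top) auto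
    then have "summable (\<lambda>i. 2 ^ i * (norm (d i x))\<^sup>2 + (1/2) ^ i)"
      by (intro summable_add summable_geometric) auto
    then have "summable (\<lambda>i. d i x)"
    proof (rule summable_comparison_test')
      fix i :: nat
      \<comment> \<open>AM-GM for \<open>2\<^sup>i |d|\<^sup>2\<close> and \<open>2\<^sup>-\<^sup>i\<close>\<close>
      have "0 \<le> (2 ^ i * norm (d i x) - 1)\<^sup>2" by simp
      then have "2 * (2 ^ i * norm (d i x)) \<le> 2 ^ i * (2 ^ i * (norm (d i x))\<^sup>2) + 1"
        by (simp add: power2_eq_square algebra_simps)
      then have "2 * norm (d i x) \<le> 2 ^ i * (norm (d i x))\<^sup>2 + (1/2) ^ i"
        by (simp add: power_one_over field_simps)
      then show "norm (d i x) \<le> 2 ^ i * (norm (d i x))\<^sup>2 + (1/2) ^ i"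
        using norm_ge_zero[of "d i x"] by linarith
    qed
    then have "convergent (\<lambda>n. \<Sum>i<n. d i x)" by (simp add: summable_iff_convergent)
    moreover have "(\<Sum>i<n. d i x) = u (s n) x - u (s 0) x" for n
      unfolding d_def by (rule sum_lessThan_telescope)
    ultimately have "convergent (\<lambda>n. u (s n) x - u (s 0) x + u (s 0) x)"
      by (intro convergent_add convergent_const) simp
    then show ?case by simp
  qed
  define v where "v = (\<lambda>x. lim (\<lambda>i. u (s i) x))"
  have [measurable]: "v \<in> borel_measurable M"
    unfolding v_def by (rule borel_measurable_lim_metric) measurable
  have "(\<integral>\<^sup>+x. ennreal ((norm (u k x - v x))\<^sup>2) \<partial>M) \<le> ennreal e"
    if N': "\<And>j. j \<ge> N' \<Longrightarrow> (\<integral>\<^sup>+x. ennreal ((norm (u k x - u j x))\<^sup>2) \<partial>M) < ennreal e" for k e N'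
  proof -
    \<comment> \<open>The shift by \<open>N'\<close> guarantees \<open>s (i + N') \<ge> N'\<close>,
      so every integral under the liminf is below \<open>e\<close>.\<close>
    have "AE x in M. ennreal ((norm (u k x - v x))\<^sup>2) = liminf (\<lambda>i. ennreal ((norm (u k x - u (s (i + N')) x))\<^sup>2))"
      using AE
    proof eventually_elim
      case (elim x)
      then have "(\<lambda>i. u (s i) x) \<longlonglongrightarrow> v x" by (simp add: v_def convergent_LIMSEQ_iff)
      then have "(\<lambda>i. ennreal ((norm (u k x - u (s (i + N')) x))\<^sup>2)) \<longlonglongrightarrow> ennreal ((norm (u k x - v x))\<^sup>2)"
        by (intro tendsto_intros LIMSEQ_ignore_initial_segment)
      then show ?case by (rule lim_imp_Liminf[OF trivial_limit_sequentially, symmetric])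
    qed
    then have "(\<integral>\<^sup>+x. ennreal ((norm (u k x - v x))\<^sup>2) \<partial>M)
        = (\<integral>\<^sup>+x. liminf (\<lambda>i. ennreal ((norm (u k x - u (s (i + N')) x))\<^sup>2)) \<partial>M)"
      by (rule nn_integral_cong_AE)
    also have "\<dots> \<le> liminf (\<lambda>i. \<integral>\<^sup>+x. ennreal ((norm (u k x - u (s (i + N')) x))\<^sup>2) \<partial>M)"
      by (rule nn_integral_liminf) measurable
    also have "\<dots> \<le> liminf (\<lambda>i. ennreal e)"
      by (rule Liminf_mono, intro always_eventually allI, rule less_imp_le, rule N') (simp add: s_def)
    finally show ?thesis by (simp add: Liminf_const)
  qed
  note limit = this
  have "(\<lambda>k. \<integral>\<^sup>+x. ennreal ((norm (u k x - v x))\<^sup>2) \<partial>M) \<longlonglongrightarrow> 0"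
  proof (rule order_tendstoI)
    fix e :: ennreal
    assume "0 < e"
    then obtain e' where e': "0 < ennreal e'" "ennreal e' < e"
      by (metis dense ennreal_cases top.not_eq_extremum order_less_trans less_irrefl)
    then obtain N' where "\<And>j k. j \<ge> N' \<Longrightarrow> k \<ge> N' \<Longrightarrow> (\<integral>\<^sup>+x. ennreal ((norm (u j x - u k x))\<^sup>2) \<partial>M) < ennreal e'"
      using Cauchy[of e'] by (auto simp: ennreal_less_zero_iff)
    then have "(\<integral>\<^sup>+x. ennreal ((norm (u k x - v x))\<^sup>2) \<partial>M) < e" if "k \<ge> N'" for k
      using limit[of N' k e'] that e'(2) by (meson order_le_less_trans)
    then show "\<forall>\<^sub>F k in sequentially. (\<integral>\<^sup>+x. ennreal ((norm (u k x - v x))\<^sup>2) \<partial>M) < e"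
      by (auto simp: eventually_sequentially)
  qed simp
  then show ?thesis by (rule that[rotated]) measurable
qed

section \<open>The inner product of square-integrable functions\<close>

lemma borel_measurable_cnj [measurable]: "cnj \<in> borel_measurable borel"
  by (intro borel_measurable_continuous_onI continuous_intros)

lemma L2_cmult:
  assumes "u \<in> L2 M"
  shows "(\<lambda>x. c * u x) \<in> L2 M"
  using assms by (auto simp: L2_def norm_mult power_mult_distrib)

lemma norm_mult_le_power2_add: "norm (a * b) \<le> (norm a)\<^sup>2 + (norm b)\<^sup>2" for a b :: complex
proof -
  have "0 \<le> norm a * norm b" by simp
  then show ?thesis
    using sum_squares_bound[of "norm a" "norm b"] unfolding norm_mult by linarith
qed

lemma norm_add_power2_le: "(norm (a + b))\<^sup>2 \<le> 2 * (norm a)\<^sup>2 + 2 * (norm b)\<^sup>2" for a b :: complex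
  using norm_triangle_ineq[of a b] power_mono[of "norm (a + b)" "norm a + norm b" 2]
    sum_squares_bound[of "norm a" "norm b"] by (simp add: power2_sum)

lemma L2_add:
  assumes "u \<in> L2 M" "v \<in> L2 M"
  shows "(\<lambda>x. u x + v x) \<in> L2 M"
proof -
  have [measurable]: "u \<in> borel_measurable M" "v \<in> borel_measurable M"
    and int: "integrable M (\<lambda>x. (norm (u x))\<^sup>2)" "integrable M (\<lambda>x. (norm (v x))\<^sup>2)"
    using assms by (auto simp: L2_def)
  have "integrable M (\<lambda>x. 2 * (norm (u x))\<^sup>2 + 2 * (norm (v x))\<^sup>2)" using int by simp
  then have "integrable M (\<lambda>x. (norm (u x + v x))\<^sup>2)"
  proof (rule Bochner_Integration.integrable_bound)
    show "AE x in M. norm ((norm (u x + v x))\<^sup>2) \<le> norm (2 * (norm (u x))\<^sup>2 + 2 * (norm (v x))\<^sup>2)"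
      using norm_add_power2_le by (intro AE_I2) simp
  qed measurable
  then show ?thesis by (simp add: L2_def)
qed

lemma L2_diff: "u \<in> L2 M \<Longrightarrow> v \<in> L2 M \<Longrightarrow> (\<lambda>x. u x - v x) \<in> L2 M"
  using L2_add[of u M "\<lambda>x. -1 * v x"] L2_cmult[of v M "-1"] by simp

lemma L2_integrable_mult_cnj:
  assumes "u \<in> L2 M" "v \<in> L2 M"
  shows "integrable M (\<lambda>x. u x * cnj (v x))"
proof -
  have [measurable]: "u \<in> borel_measurable M" "v \<in> borel_measurable M"
    and int: "integrable M (\<lambda>x. (norm (u x))\<^sup>2)" "integrable M (\<lambda>x. (norm (v x))\<^sup>2)"
    using assms by (auto simp: L2_def)
  have "integrable M (\<lambda>x. (norm (u x))\<^sup>2 + (norm (v x))\<^sup>2)" using int by simp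
  then show ?thesis
  proof (rule Bochner_Integration.integrable_bound)
    show "AE x in M. norm (u x * cnj (v x)) \<le> norm ((norm (u x))\<^sup>2 + (norm (v x))\<^sup>2)"
      using norm_mult_le_power2_add[of "u _" "cnj (v _)"] by (intro AE_I2) simp
  qed measurable
qed

lemma L2_inner_add_left:
  "u \<in> L2 M \<Longrightarrow> v \<in> L2 M \<Longrightarrow> w \<in> L2 M \<Longrightarrow>
    L2_inner M (\<lambda>x. u x + v x) w = L2_inner M u w + L2_inner M v w"
  by (simp add: L2_inner_def distrib_right L2_integrable_mult_cnj)

lemma L2_inner_cmult_left: "L2_inner M (\<lambda>x. c * u x) v = c * L2_inner M u v"
  by (simp add: L2_inner_def mult.assoc)

lemma L2_inner_commute: "L2_inner M u v = cnj (L2_inner M v u)"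
  unfolding L2_inner_def by (subst Bochner_Integration.integral_cnj[symmetric]) (simp add: mult.commute)

lemma L2_inner_cmult_right: "L2_inner M u (\<lambda>x. c * v x) = cnj c * L2_inner M u v"
  by (subst (1 2) L2_inner_commute) (simp add: L2_inner_cmult_left)

lemma L2_inner_add_right:
  "u \<in> L2 M \<Longrightarrow> v \<in> L2 M \<Longrightarrow> w \<in> L2 M \<Longrightarrow>
    L2_inner M w (\<lambda>x. u x + v x) = L2_inner M w u + L2_inner M w v"
  by (subst (1 2 3) L2_inner_commute) (simp add: L2_inner_add_left)

lemma L2_inner_self: "L2_inner M u u = of_real (\<integral>x. (norm (u x))\<^sup>2 \<partial>M)"
  unfolding L2_inner_def by (simp flip: complex_norm_square integral_complex_of_real of_real_power)

lemma L2_Cauchy_Schwarz: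
  assumes "u \<in> L2 M" "v \<in> L2 M"
  shows "(norm (L2_inner M u v))\<^sup>2 \<le> (\<integral>x. (norm (u x))\<^sup>2 \<partial>M) * (\<integral>x. (norm (v x))\<^sup>2 \<partial>M)"
proof -
  have [measurable]: "u \<in> borel_measurable M" "v \<in> borel_measurable M"
    and int: "integrable M (\<lambda>x. (norm (u x))\<^sup>2)" "integrable M (\<lambda>x. (norm (v x))\<^sup>2)"
    using assms by (auto simp: L2_def)
  have "ennreal ((norm (L2_inner M u v))\<^sup>2) = (ennreal (norm (L2_inner M u v)))\<^sup>2"
    by (simp add: ennreal_power)
  also have "\<dots> \<le> (\<integral>\<^sup>+x. ennreal (norm (u x)) * ennreal (norm (v x)) \<partial>M)\<^sup>2"
    using integral_norm_bound_ennreal[OF L2_integrable_mult_cnj[OF assms]]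
    by (intro power_mono) (auto simp: L2_inner_def norm_mult ennreal_mult)
  also have "\<dots> \<le> (\<integral>\<^sup>+x. (ennreal (norm (u x)))\<^sup>2 \<partial>M) * (\<integral>\<^sup>+x. (ennreal (norm (v x)))\<^sup>2 \<partial>M)"
    by (rule Cauchy_Schwarz_nn_integral) auto
  also have "\<dots> = ennreal ((\<integral>x. (norm (u x))\<^sup>2 \<partial>M) * (\<integral>x. (norm (v x))\<^sup>2 \<partial>M))"
    using int by (simp add: ennreal_power nn_integral_eq_integral ennreal_mult)
  finally show ?thesis by (subst (asm) ennreal_le_iff) auto
qed

text \<open>By Cauchy-Schwarz the difference is at most the norm of \<open>g\<close> times the
  distance. This is how relations between approximants reach their limit.\<close>

lemma L2_inner_tendsto_right:
  assumes "\<And>k. \<phi> k \<in> L2 M" "u \<in> L2 M" "g \<in> L2 M" "(\<lambda>k. L2_dist M (\<phi> k) u) \<longlonglongrightarrow> 0"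
  shows "(\<lambda>k. L2_inner M g (\<phi> k)) \<longlonglongrightarrow> L2_inner M g u"
proof -
  have "norm (L2_inner M g (\<phi> k) - L2_inner M g u) \<le> sqrt (\<integral>x. (norm (g x))\<^sup>2 \<partial>M) * L2_dist M (\<phi> k) u" for k
  proof -
    have "L2_inner M g (\<phi> k) - L2_inner M g u = L2_inner M g (\<lambda>x. \<phi> k x - u x)"
      using L2_inner_add_right[OF assms(1) L2_cmult[OF assms(2), of "-1"] assms(3), of k]
        L2_inner_cmult_right[of M g "-1" u] by simp
    then have "(norm (L2_inner M g (\<phi> k) - L2_inner M g u))\<^sup>2
        \<le> (\<integral>x. (norm (g x))\<^sup>2 \<partial>M) * (\<integral>x. (norm (\<phi> k x - u x))\<^sup>2 \<partial>M)"
      using L2_Cauchy_Schwarz[OF assms(3) L2_diff[OF assms(1) assms(2)]] by simp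
    from real_sqrt_le_mono[OF this] show ?thesis
      by (simp add: real_sqrt_mult L2_dist_def)
  qed
  moreover have "(\<lambda>k. sqrt (\<integral>x. (norm (g x))\<^sup>2 \<partial>M) * L2_dist M (\<phi> k) u) \<longlonglongrightarrow> 0"
    using tendsto_mult_right_zero[OF assms(4)] by blast
  ultimately have "(\<lambda>k. L2_inner M g (\<phi> k) - L2_inner M g u) \<longlonglongrightarrow> 0"
    by (rule Lim_null_comparison[OF always_eventually[OF allI]])
  then show ?thesis by (simp add: LIM_zero_iff)
qed

lemma L2_inner_tendsto_left:
  assumes "\<And>k. \<phi> k \<in> L2 M" "u \<in> L2 M" "g \<in> L2 M" "(\<lambda>k. L2_dist M (\<phi> k) u) \<longlonglongrightarrow> 0"
  shows "(\<lambda>k. L2_inner M (\<phi> k) g) \<longlonglongrightarrow> L2_inner M u g"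
  using tendsto_cnj[OF L2_inner_tendsto_right[OF assms]] by (simp flip: L2_inner_commute)

lemma L2_Cauchy_limit:
  assumes "\<And>k. u k \<in> L2 M"
    and Cauchy: "\<And>e. e > 0 \<Longrightarrow> \<exists>N. \<forall>j\<ge>N. \<forall>k\<ge>N. (\<integral>x. (norm (u j x - u k x))\<^sup>2 \<partial>M) < e"
  obtains v where "v \<in> L2 M" "(\<lambda>k. L2_dist M (u k) v) \<longlonglongrightarrow> 0"
proof -
  have [measurable]: "u k \<in> borel_measurable M" for k using assms(1)[of k] by (simp add: L2_def)
  have int: "integrable M (\<lambda>x. (norm (u k x))\<^sup>2)" for k using assms(1)[of k] by (simp add: L2_def)
  have eq: "(\<integral>\<^sup>+x. ennreal ((norm (u j x - u k x))\<^sup>2) \<partial>M) = ennreal (\<integral>x. (norm (u j x - u k x))\<^sup>2 \<partial>M)" for j k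
    using L2_diff[OF assms(1)[of j] assms(1)[of k]] by (simp add: nn_integral_eq_integral L2_def)
  have "\<exists>N. \<forall>j\<ge>N. \<forall>k\<ge>N. (\<integral>\<^sup>+x. ennreal ((norm (u j x - u k x))\<^sup>2) \<partial>M) < ennreal e" if "e > 0" for e
    using Cauchy[OF that] that unfolding eq by (simp add: ennreal_less_iff)
  with \<open>\<And>k. u k \<in> borel_measurable M\<close> obtain v
    where [measurable]: "v \<in> borel_measurable M"
      and lim: "(\<lambda>k. \<integral>\<^sup>+x. ennreal ((norm (u k x - v x))\<^sup>2) \<partial>M) \<longlonglongrightarrow> 0"
    by (rule nn_integral_power2_Cauchy_limit)
  have "\<forall>\<^sub>F k in sequentially. (\<integral>\<^sup>+x. ennreal ((norm (u k x - v x))\<^sup>2) \<partial>M) < 1"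
    using lim by (rule order_tendstoD(2)) simp
  then obtain k where k: "(\<integral>\<^sup>+x. ennreal ((norm (u k x - v x))\<^sup>2) \<partial>M) < 1"
    using eventually_happens'[OF sequentially_bot] by blast
  \<comment> \<open>A single \<open>k\<close> at finite distance from \<open>v\<close> suffices,
    since \<open>v\<close> is the difference of \<open>u k\<close> and
    \<open>u k - v\<close>.\<close>
  then have "integrable M (\<lambda>x. (norm (u k x - v x))\<^sup>2)"
    by (intro integrableI_bounded) (auto intro: order_less_trans)
  then have "(\<lambda>x. u k x - v x) \<in> L2 M" by (simp add: L2_def)
  from L2_diff[OF assms(1)[of k] this] have v: "v \<in> L2 M" by simp
  have "(\<integral>\<^sup>+x. ennreal ((norm (u k x - v x))\<^sup>2) \<partial>M) = ennreal (\<integral>x. (norm (u k x - v x))\<^sup>2 \<partial>M)" for k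
    using L2_diff[OF assms(1)[of k] v] by (simp add: nn_integral_eq_integral L2_def)
  then have "(\<lambda>k. \<integral>x. (norm (u k x - v x))\<^sup>2 \<partial>M) \<longlonglongrightarrow> 0"
    using lim by (simp add: tendsto_ennreal_iff[of _ _ 0, simplified])
  then have "(\<lambda>k. L2_dist M (u k) v) \<longlonglongrightarrow> sqrt 0"
    unfolding L2_dist_def by (rule tendsto_real_sqrt)
  with v show ?thesis using that by simp
qed

section \<open>The variational principle for the Friedrichs extension\<close>

text \<open>Separates the Hilbert space argument from the differential operator. The assumption
  \<open>compact\<close> is what Rellich's theorem delivers: normalised elements of the domain with
  bounded energy have an L2-Cauchy subsequence.\<close>

locale positive_operator_with_compact_embedding =
  fixes M :: "'a measure" and D :: "('a \<Rightarrow> complex) set" and T :: "('a \<Rightarrow> complex) \<Rightarrow> 'a \<Rightarrow> complex"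
  assumes D_L2: "\<phi> \<in> D \<Longrightarrow> \<phi> \<in> L2 M"
    and T_L2: "\<phi> \<in> D \<Longrightarrow> T \<phi> \<in> L2 M"
    and D_add: "\<phi> \<in> D \<Longrightarrow> \<psi> \<in> D \<Longrightarrow> (\<lambda>x. \<phi> x + \<psi> x) \<in> D"
    and D_cmult: "\<phi> \<in> D \<Longrightarrow> (\<lambda>x. c * \<phi> x) \<in> D"
    and T_add: "\<phi> \<in> D \<Longrightarrow> \<psi> \<in> D \<Longrightarrow> T (\<lambda>x. \<phi> x + \<psi> x) = (\<lambda>x. T \<phi> x + T \<psi> x)"
    and T_cmult: "\<phi> \<in> D \<Longrightarrow> T (\<lambda>x. c * \<phi> x) = (\<lambda>x. c * T \<phi> x)"
    and T_symmetric: "\<phi> \<in> D \<Longrightarrow> \<psi> \<in> D \<Longrightarrow> L2_inner M (T \<phi>) \<psi> = cnj (L2_inner M (T \<psi>) \<phi>)"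
    and T_nonneg: "\<phi> \<in> D \<Longrightarrow> 0 \<le> Re (L2_inner M (T \<phi>) \<phi>)"
    and compact: "(\<And>k. s k \<in> D) \<Longrightarrow> (\<And>k. (\<integral>x. (norm (s k x))\<^sup>2 \<partial>M) = 1) \<Longrightarrow>
      (\<And>k. Re (L2_inner M (T (s k)) (s k)) \<le> K) \<Longrightarrow>
      \<exists>r::nat \<Rightarrow> nat. strict_mono r \<and> (\<forall>e>0. \<exists>N. \<forall>j\<ge>N. \<forall>k\<ge>N. (\<integral>x. (norm (s (r j) x - s (r k) x))\<^sup>2 \<partial>M) < e)"
    and nontrivial: "\<exists>\<phi>\<in>D. 0 < (\<integral>x. (norm (\<phi> x))\<^sup>2 \<partial>M)"
begin

definition rayleigh_quotients :: "real set" where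
  "rayleigh_quotients = {Re (L2_inner M (T \<phi>) \<phi>) / (\<integral>x. (norm (\<phi> x))\<^sup>2 \<partial>M) | \<phi>. \<phi> \<in> D \<and> 0 < (\<integral>x. (norm (\<phi> x))\<^sup>2 \<partial>M)}"

abbreviation ground :: real where "ground \<equiv> Inf rayleigh_quotients"

lemma rayleigh_quotients_nonneg: "q \<in> rayleigh_quotients \<Longrightarrow> 0 \<le> q"
  unfolding rayleigh_quotients_def using T_nonneg by auto

lemma rayleigh_quotients_nonempty: "rayleigh_quotients \<noteq> {}"
  using nontrivial by (auto simp: rayleigh_quotients_def)

lemma bdd_below_rayleigh_quotients: "bdd_below rayleigh_quotients"
  using rayleigh_quotients_nonneg by (auto simp: bdd_below_def)

lemma ground_nonneg: "0 \<le> ground"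
  using rayleigh_quotients_nonempty rayleigh_quotients_nonneg by (rule cInf_greatest)

text \<open>The form of T - \<open>ground\<close>, positive semidefinite because
  \<open>ground\<close> is the infimum. Only the first argument is fed to \<open>T\<close>, so an
  L2-limit may be inserted in the second.\<close>

definition shifted_form :: "('a \<Rightarrow> complex) \<Rightarrow> ('a \<Rightarrow> complex) \<Rightarrow> complex" where
  "shifted_form \<phi> \<psi> = L2_inner M (T \<phi>) \<psi> - ground * L2_inner M \<phi> \<psi>"

lemma shifted_form_nonneg:
  assumes "\<phi> \<in> D"
  shows "0 \<le> Re (shifted_form \<phi> \<phi>)"
proof (cases "0 < (\<integral>x. (norm (\<phi> x))\<^sup>2 \<partial>M)")
  case True
  then have "Re (L2_inner M (T \<phi>) \<phi>) / (\<integral>x. (norm (\<phi> x))\<^sup>2 \<partial>M) \<in> rayleigh_quotients"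
    using assms by (auto simp: rayleigh_quotients_def)
  from cInf_lower[OF this bdd_below_rayleigh_quotients] show ?thesis
    using True by (simp add: shifted_form_def L2_inner_self pos_le_divide_eq)
next
  \<comment> \<open>Functions that vanish almost everywhere have no Rayleigh quotient. For them the
    term with \<open>ground\<close> is 0 and \<open>T_nonneg\<close> is enough.\<close>
  case False
  moreover have "0 \<le> (\<integral>x. (norm (\<phi> x))\<^sup>2 \<partial>M)" by simp
  ultimately have "(\<integral>x. (norm (\<phi> x))\<^sup>2 \<partial>M) = 0" by linarith
  then show ?thesis using T_nonneg[OF assms] by (simp add: shifted_form_def L2_inner_self)
qed

lemma shifted_form_add_left:
  "\<phi> \<in> D \<Longrightarrow> \<psi> \<in> D \<Longrightarrow> u \<in> L2 M \<Longrightarrow> shifted_form (\<lambda>x. \<phi> x + \<psi> x) u = shifted_form \<phi> u + shifted_form \<psi> u"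
  by (simp add: shifted_form_def T_add L2_inner_add_left D_L2 T_L2 algebra_simps)

lemma shifted_form_cmult_left:
  "\<phi> \<in> D \<Longrightarrow> shifted_form (\<lambda>x. c * \<phi> x) u = c * shifted_form \<phi> u"
  by (simp add: shifted_form_def T_cmult L2_inner_cmult_left algebra_simps)

lemma shifted_form_symmetric:
  "\<phi> \<in> D \<Longrightarrow> \<psi> \<in> D \<Longrightarrow> shifted_form \<phi> \<psi> = cnj (shifted_form \<psi> \<phi>)"
  by (simp add: shifted_form_def flip: T_symmetric[of \<phi> \<psi>] L2_inner_commute[of M \<phi> \<psi>])

lemma shifted_form_add_self:
  assumes "\<phi> \<in> D" "\<psi> \<in> D"
  shows "Re (shifted_form (\<lambda>x. \<phi> x + \<psi> x) (\<lambda>x. \<phi> x + \<psi> x))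
    = Re (shifted_form \<phi> \<phi>) + 2 * Re (shifted_form \<psi> \<phi>) + Re (shifted_form \<psi> \<psi>)"
proof -
  note s = D_add[OF assms]
  have right: "shifted_form u (\<lambda>x. \<phi> x + \<psi> x) = cnj (shifted_form \<phi> u) + cnj (shifted_form \<psi> u)" if "u \<in> D" for u
    using shifted_form_symmetric[OF that s] shifted_form_add_left[OF assms D_L2[OF that]] by simp
  show ?thesis
    using shifted_form_add_left[OF assms D_L2[OF s]] right[OF assms(1)] right[OF assms(2)]
      shifted_form_symmetric[OF assms] by simp
qed

lemma shifted_form_cmult_self:
  assumes "\<phi> \<in> D"
  shows "Re (shifted_form (\<lambda>x. of_real t * \<phi> x) (\<lambda>x. of_real t * \<phi> x)) = t\<^sup>2 * Re (shifted_form \<phi> \<phi>)"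
  using shifted_form_cmult_left[OF assms] shifted_form_symmetric[OF assms D_cmult[OF assms, of "of_real t"]]
  by (simp add: power2_eq_square)

lemma T_diff:
  assumes "\<phi> \<in> D" "\<psi> \<in> D"
  shows "T (\<lambda>x. \<phi> x - \<psi> x) = (\<lambda>x. T \<phi> x - T \<psi> x)"
  using T_add[OF assms(1) D_cmult[OF assms(2), of "-1"]] T_cmult[OF assms(2), of "-1"] by simp

lemma shifted_form_diff_self:
  assumes "\<phi> \<in> D" "\<psi> \<in> D"
  shows "Re (shifted_form (\<lambda>x. \<phi> x - \<psi> x) (\<lambda>x. \<phi> x - \<psi> x))
    = Re (shifted_form \<phi> \<phi>) - 2 * Re (shifted_form \<psi> \<phi>) + Re (shifted_form \<psi> \<psi>)"
  using shifted_form_add_self[OF assms(1) D_cmult[OF assms(2), of "of_real (-1)"]]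
    shifted_form_cmult_self[OF assms(2), of "-1"] shifted_form_cmult_left[OF assms(2), of "-1"] by simp

section \<open>The infimum of the Rayleigh quotients as the least eigenvalue\<close>

abbreviation friedrichs :: "('a \<Rightarrow> complex) rel" where
  "friedrichs \<equiv> friedrichs_extension M {(\<phi>, T \<phi>) | \<phi>. \<phi> \<in> D}"

text \<open>The eigenfunction \<open>u\<close> need not lie in \<open>D\<close>, so it has no
  Rayleigh quotient of its own. Instead, the form of a late difference is below \<open>e\<close>
  while the forms of both approximants are nonnegative, so twice the real mixed term is at least -e.
  Letting first one index and then the other tend to infinity leaves (\<mu> - ground) times the
  squared norm of \<open>u\<close>.\<close>

lemma ground_le_eigenvalue:
  assumes "is_eigenvalue M friedrichs (of_real \<mu>)"
  shows "ground \<le> \<mu>"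
proof -
  obtain u f where uf: "(u, f) \<in> friedrichs" and nz: "\<not> (AE x in M. u x = 0)"
    and f: "AE x in M. f x = of_real \<mu> * u x"
    using assms by (auto simp: is_eigenvalue_def)
  have L2: "u \<in> L2 M" "f \<in> L2 M" and adj: "\<And>\<phi>. \<phi> \<in> D \<Longrightarrow> L2_inner M (T \<phi>) u = L2_inner M \<phi> f"
    and "u \<in> energy_space M {(\<phi>, T \<phi>) | \<phi>. \<phi> \<in> D}"
    using uf by (auto simp: friedrichs_extension_def adjoint_graph_def)
  then obtain \<phi> g where "\<And>k::nat. (\<phi> k, g k) \<in> {(\<phi>, T \<phi>) | \<phi>. \<phi> \<in> D}"
    and lim: "(\<lambda>k. L2_dist M (\<phi> k) u) \<longlonglongrightarrow> 0"
    and Cauchy: "\<And>e. e > 0 \<Longrightarrow> \<exists>N. \<forall>j\<ge>N. \<forall>k\<ge>N. Re (L2_inner M (\<lambda>x. g j x - g k x) (\<lambda>x. \<phi> j x - \<phi> k x)) < e"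
    unfolding energy_space_def by blast
  then have D: "\<phi> k \<in> D" and g: "g k = T (\<phi> k)" for k by blast+
  have [measurable]: "u \<in> borel_measurable M" "f \<in> borel_measurable M" "\<phi> k \<in> borel_measurable M" for k
    using L2 D_L2[OF D] by (auto simp: L2_def)
  have inner_f: "L2_inner M (\<phi> k) f = \<mu> * L2_inner M (\<phi> k) u" for k
  proof -
    have "L2_inner M (\<phi> k) f = L2_inner M (\<phi> k) (\<lambda>x. of_real \<mu> * u x)"
      unfolding L2_inner_def
    proof (rule integral_cong_AE)
      show "AE x in M. \<phi> k x * cnj (f x) = \<phi> k x * cnj (of_real \<mu> * u x)"
        using f by eventually_elim simp
    qed measurable
    then show ?thesis by (simp add: L2_inner_cmult_right)
  qed
  have "0 - e \<le> 2 * ((\<mu> - ground) * (\<integral>x. (norm (u x))\<^sup>2 \<partial>M))" if e: "e > 0" for e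
  proof -
    obtain N where N: "\<And>j k. j \<ge> N \<Longrightarrow> k \<ge> N \<Longrightarrow> Re (L2_inner M (\<lambda>x. g j x - g k x) (\<lambda>x. \<phi> j x - \<phi> k x)) < e"
      using Cauchy[OF e] by blast
    have step: "- e \<le> 2 * Re (shifted_form (\<phi> k) (\<phi> j))" if "j \<ge> N" "k \<ge> N" for j k
    proof -
      let ?d = "\<lambda>x. \<phi> j x - \<phi> k x"
      \<comment> \<open>The dropped term is \<open>ground\<close> times a squared norm, and
        \<open>ground\<close> is nonnegative.\<close>
      have "Re (shifted_form ?d ?d) \<le> Re (L2_inner M (T ?d) ?d)"
        using ground_nonneg by (simp add: shifted_form_def L2_inner_self)
      also have "\<dots> < e" using N[OF that] by (simp add: g T_diff[OF D D])
      finally show ?thesis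
        using shifted_form_diff_self[OF D D, of j k] shifted_form_nonneg[OF D, of j] shifted_form_nonneg[OF D, of k]
        by simp
    qed
    have "- e \<le> 2 * Re (shifted_form (\<phi> k) u)" if "k \<ge> N" for k
    proof (rule LIMSEQ_le_const)
      show "(\<lambda>j. 2 * Re (shifted_form (\<phi> k) (\<phi> j))) \<longlonglongrightarrow> 2 * Re (shifted_form (\<phi> k) u)"
        unfolding shifted_form_def
        by (intro tendsto_intros L2_inner_tendsto_right lim L2 D_L2 T_L2 D)
      show "\<exists>N. \<forall>j\<ge>N. - e \<le> 2 * Re (shifted_form (\<phi> k) (\<phi> j))" using step that by blast
    qed
    \<comment> \<open>The adjoint relation moves \<open>T\<close> off the approximant, and the
      eigenvalue equation replaces \<open>f\<close> by \<mu> times \<open>u\<close>.\<close>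
    then have ineq: "\<exists>N. \<forall>k\<ge>N. - e \<le> 2 * ((\<mu> - ground) * Re (L2_inner M (\<phi> k) u))"
      by (auto simp: shifted_form_def adj[OF D] inner_f algebra_simps)
    have "(\<lambda>k. 2 * ((\<mu> - ground) * Re (L2_inner M (\<phi> k) u))) \<longlonglongrightarrow> 2 * ((\<mu> - ground) * Re (L2_inner M u u))"
      by (intro tendsto_intros L2_inner_tendsto_left lim L2 D_L2 D)
    from LIMSEQ_le_const[OF this ineq] show ?thesis by (simp add: L2_inner_self)
  qed
  note bound = this
  have "0 \<le> 2 * ((\<mu> - ground) * (\<integral>x. (norm (u x))\<^sup>2 \<partial>M))"
  proof (rule field_le_epsilon)
    fix e :: real
    assume "0 < e"
    from bound[OF this] show "0 \<le> 2 * ((\<mu> - ground) * (\<integral>x. (norm (u x))\<^sup>2 \<partial>M)) + e"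
      unfolding diff_le_eq .
  qed
  moreover have "0 < (\<integral>x. (norm (u x))\<^sup>2 \<partial>M)"
  proof -
    have "(\<integral>x. (norm (u x))\<^sup>2 \<partial>M) \<noteq> 0"
      using nz L2(1) by (subst integral_nonneg_eq_0_iff_AE) (auto simp: L2_def)
    moreover have "0 \<le> (\<integral>x. (norm (u x))\<^sup>2 \<partial>M)" by simp
    ultimately show ?thesis by linarith
  qed
  ultimately show ?thesis by (simp add: zero_le_mult_iff)
qed

text \<open>On unit vectors the shifted form is exactly the excess of the Rayleigh quotient over its
  infimum.\<close>

lemma minimizing_sequence:
  obtains \<phi> where "\<And>k. \<phi> k \<in> D" "\<And>k. (\<integral>x. (norm (\<phi> k x))\<^sup>2 \<partial>M) = 1"
    "\<And>k. Re (shifted_form (\<phi> k) (\<phi> k)) < 1 / Suc k"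
proof -
  have "\<exists>\<phi>. \<phi> \<in> D \<and> (\<integral>x. (norm (\<phi> x))\<^sup>2 \<partial>M) = 1 \<and> Re (shifted_form \<phi> \<phi>) < 1 / Suc k" for k
  proof -
    have "ground < ground + 1 / Suc k" by simp
    then obtain q where "q \<in> rayleigh_quotients" "q < ground + 1 / Suc k"
      using cInf_lessD[OF rayleigh_quotients_nonempty] by blast
    then obtain \<psi> where \<psi>: "\<psi> \<in> D" "0 < (\<integral>x. (norm (\<psi> x))\<^sup>2 \<partial>M)"
      "Re (L2_inner M (T \<psi>) \<psi>) / (\<integral>x. (norm (\<psi> x))\<^sup>2 \<partial>M) < ground + 1 / Suc k"
      by (auto simp: rayleigh_quotients_def)
    define n where "n = (\<integral>x. (norm (\<psi> x))\<^sup>2 \<partial>M)"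
    define t where "t = 1 / sqrt n"
    have n: "n > 0" and t: "t\<^sup>2 = 1 / n" using \<psi>(2) by (simp_all add: n_def t_def power_divide)
    let ?\<phi> = "\<lambda>x. of_real t * \<psi> x"
    have "Re (shifted_form \<psi> \<psi>) = Re (L2_inner M (T \<psi>) \<psi>) - ground * n"
      by (simp add: shifted_form_def L2_inner_self n_def)
    then have "Re (shifted_form ?\<phi> ?\<phi>) = Re (L2_inner M (T \<psi>) \<psi>) / n - ground"
      using n by (simp add: shifted_form_cmult_self[OF \<psi>(1)] t field_simps)
    moreover have "(\<integral>x. (norm (?\<phi> x))\<^sup>2 \<partial>M) = 1"
      using n t by (simp add: norm_mult power_mult_distrib n_def[symmetric])
    ultimately show ?thesis using \<psi>(3) D_cmult[OF \<psi>(1), of "of_real t"]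
      by (intro exI[of _ ?\<phi>]) (auto simp: n_def)
  qed
  then show ?thesis using that by metis
qed

text \<open>The limit \<open>u\<close> is shown to annihilate the shifted form against all of
  \<open>D\<close>, which is the adjoint relation with right-hand side \<open>ground\<close> times
  \<open>u\<close>. This comes from a first variation carried out on the approximants, since the
  form need not be defined on \<open>u\<close> itself.\<close>

lemma is_eigenvalue_ground: "is_eigenvalue M friedrichs (of_real ground)"
proof -
  obtain \<psi> where \<psi>: "\<And>k. \<psi> k \<in> D" "\<And>k. (\<integral>x. (norm (\<psi> k x))\<^sup>2 \<partial>M) = 1"
    "\<And>k. Re (shifted_form (\<psi> k) (\<psi> k)) < 1 / Suc k"
    using minimizing_sequence by blast
  have "Re (L2_inner M (T (\<psi> k)) (\<psi> k)) \<le> ground + 1" for k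
  proof -
    have "Re (shifted_form (\<psi> k) (\<psi> k)) < 1 / Suc k" by (rule \<psi>(3))
    also have "\<dots> \<le> 1" by simp
    finally show ?thesis by (simp add: shifted_form_def L2_inner_self \<psi>(2))
  qed
  from compact[of \<psi> "ground + 1", OF \<psi>(1,2) this] obtain r :: "nat \<Rightarrow> nat" where r: "strict_mono r"
    "\<forall>e>0. \<exists>N. \<forall>j\<ge>N. \<forall>k\<ge>N. (\<integral>x. (norm (\<psi> (r j) x - \<psi> (r k) x))\<^sup>2 \<partial>M) < e"
    by (elim exE conjE) (rule that)
  define \<phi> where "\<phi> = (\<lambda>k. \<psi> (r k))"
  have D: "\<phi> k \<in> D" for k by (simp add: \<phi>_def \<psi>(1))
  have small: "Re (shifted_form (\<phi> k) (\<phi> k)) \<le> 1 / Suc k" for k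
  proof -
    have "Re (shifted_form (\<phi> k) (\<phi> k)) \<le> 1 / Suc (r k)" using \<psi>(3)[of "r k"] by (simp add: \<phi>_def)
    also have "\<dots> \<le> 1 / Suc k" using seq_suble[OF r(1), of k] by (simp add: frac_le)
    finally show ?thesis .
  qed
  obtain u where u: "u \<in> L2 M" "(\<lambda>k. L2_dist M (\<phi> k) u) \<longlonglongrightarrow> 0"
    by (rule L2_Cauchy_limit[of \<phi> M, OF D_L2[OF D]]) (use r(2) in \<open>auto simp: \<phi>_def\<close>)
  have inverse: "(\<lambda>k. 1 / real (Suc k)) \<longlonglongrightarrow> 0"
    using LIMSEQ_inverse_real_of_nat by (simp add: inverse_eq_divide)
  have "\<exists>N. \<forall>j\<ge>N. \<forall>k\<ge>N. Re (L2_inner M (\<lambda>x. T (\<phi> j) x - T (\<phi> k) x) (\<lambda>x. \<phi> j x - \<phi> k x)) < e" if "e > 0" for e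
  proof -
    \<comment> \<open>The tolerance makes \<open>ground\<close> times the squared distance at most
      e/2; the summand 1 covers \<open>ground = 0\<close>. The bound e/8 for
      \<open>1 / Suc k\<close> gives 2 * e/8 + 2 * e/8 for the other half.\<close>
    obtain N1 where N1: "\<And>j k. j \<ge> N1 \<Longrightarrow> k \<ge> N1 \<Longrightarrow> (\<integral>x. (norm (\<phi> j x - \<phi> k x))\<^sup>2 \<partial>M) < e / (2 * (ground + 1))"
      using r(2)[rule_format, of "e / (2 * (ground + 1))"] \<open>e > 0\<close> ground_nonneg by (auto simp: \<phi>_def)
    have "\<forall>\<^sub>F k in sequentially. 1 / real (Suc k) < e / 8" using inverse \<open>e > 0\<close> by (intro order_tendstoD) auto
    then obtain N2 where N2: "\<And>k. k \<ge> N2 \<Longrightarrow> 1 / real (Suc k) < e / 8"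
      unfolding eventually_sequentially by blast
    have "Re (L2_inner M (\<lambda>x. T (\<phi> j) x - T (\<phi> k) x) (\<lambda>x. \<phi> j x - \<phi> k x)) < e"
      if "j \<ge> max N1 N2" "k \<ge> max N1 N2" for j k
    proof -
      let ?d = "\<lambda>x. \<phi> j x - \<phi> k x"
      \<comment> \<open>parallelogram identity for the shifted form\<close>
      have "Re (shifted_form ?d ?d) \<le> 2 * Re (shifted_form (\<phi> j) (\<phi> j)) + 2 * Re (shifted_form (\<phi> k) (\<phi> k))"
        using shifted_form_diff_self[OF D D, of j k] shifted_form_add_self[OF D D, of j k]
          shifted_form_nonneg[OF D_add[OF D D], of j k] by simp
      also have "\<dots> < e / 2"
        using small[of j] small[of k] N2[of j] N2[of k] that by simp
      finally have "Re (L2_inner M (T ?d) ?d) < e / 2 + ground * (\<integral>x. (norm (?d x))\<^sup>2 \<partial>M)"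
        by (simp add: shifted_form_def L2_inner_self)
      also have "\<dots> \<le> e / 2 + (ground + 1) * (e / (2 * (ground + 1)))"
        using N1[of j k] that ground_nonneg by (intro add_mono mult_mono) auto
      also have "\<dots> = e" using ground_nonneg by (simp add: field_simps)
      finally show ?thesis by (simp add: T_diff[OF D D])
    qed
    then show ?thesis by blast
  qed
  then have energy: "u \<in> energy_space M {(\<phi>, T \<phi>) | \<phi>. \<phi> \<in> D}"
    unfolding energy_space_def using u D
    by (intro CollectI conjI exI[of _ \<phi>] exI[of _ "\<lambda>k. T (\<phi> k)"]) auto
  have Re_0: "Re (shifted_form v u) = 0" if v: "v \<in> D" for v
  proof -
    \<comment> \<open>The form is nonnegative at the sum of \<open>\<phi> k\<close> and t times
      \<open>v\<close>; its own part at \<open>\<phi> k\<close> is at most \<open>1 / Suc k\<close>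
      and disappears in the limit.\<close>
    have ineq: "0 \<le> 2 * t * Re (shifted_form v u) + t\<^sup>2 * Re (shifted_form v v)" for t
    proof (rule LIMSEQ_le_const)
      have "(\<lambda>k. 1 / real (Suc k) + 2 * t * Re (shifted_form v (\<phi> k)) + t\<^sup>2 * Re (shifted_form v v))
          \<longlonglongrightarrow> 0 + 2 * t * Re (shifted_form v u) + t\<^sup>2 * Re (shifted_form v v)"
        unfolding shifted_form_def
        by (intro tendsto_intros inverse L2_inner_tendsto_right u D_L2 T_L2 D v)
      then show "(\<lambda>k. 1 / real (Suc k) + 2 * t * Re (shifted_form v (\<phi> k)) + t\<^sup>2 * Re (shifted_form v v))
          \<longlonglongrightarrow> 2 * t * Re (shifted_form v u) + t\<^sup>2 * Re (shifted_form v v)" by simp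
      have "0 \<le> 1 / real (Suc k) + 2 * t * Re (shifted_form v (\<phi> k)) + t\<^sup>2 * Re (shifted_form v v)" for k
        using shifted_form_nonneg[OF D_add[OF D D_cmult[OF v, of "of_real t"]], of k]
          shifted_form_add_self[OF D D_cmult[OF v, of "of_real t"], of k]
          shifted_form_cmult_self[OF v, of t] shifted_form_cmult_left[OF v, of "of_real t" "\<phi> k"] small[of k]
        by simp
      then show "\<exists>N. \<forall>k\<ge>N. 0 \<le> 1 / real (Suc k) + 2 * t * Re (shifted_form v (\<phi> k)) + t\<^sup>2 * Re (shifted_form v v)"
        by blast
    qed
    \<comment> \<open>The value t = -a/q nearly minimises the quadratic in t; adding 1 keeps
      \<open>q\<close> positive even if the form vanishes at \<open>v\<close>.\<close>
    define a q where "a = Re (shifted_form v u)" and "q = Re (shifted_form v v) + 1"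
    have q: "q > 0" using shifted_form_nonneg[OF v] by (simp add: q_def)
    have "0 \<le> 2 * (- a / q) * a + (- a / q)\<^sup>2 * (q - 1)" using ineq[of "- a / q"] by (simp add: a_def q_def)
    also have "\<dots> = - (a\<^sup>2 / q) - (a / q)\<^sup>2" using q by (simp add: power2_eq_square field_simps)
    finally have "(a / q)\<^sup>2 \<le> 0" using q zero_le_power2[of a] by (smt (verit) divide_nonneg_pos)
    then show ?thesis using q by (simp add: a_def)
  qed
  \<comment> \<open>Replacing \<open>v\<close> by \<i> times \<open>v\<close> turns the imaginary
    part into a real part.\<close>
  have "shifted_form v u = 0" if "v \<in> D" for v
    using Re_0[OF that] Re_0[OF D_cmult[OF that, of \<i>]] shifted_form_cmult_left[OF that, of \<i> u]
    by (simp add: complex_eq_iff)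
  then have "(u, \<lambda>x. of_real ground * u x) \<in> friedrichs"
    using energy u(1) L2_cmult[OF u(1)]
    by (auto simp: friedrichs_extension_def adjoint_graph_def shifted_form_def L2_inner_cmult_right)
  \<comment> \<open>Unit vectors cannot converge to a function that vanishes almost
    everywhere.\<close>
  moreover have "\<not> (AE x in M. u x = 0)"
  proof
    assume AE: "AE x in M. u x = 0"
    have [measurable]: "u \<in> borel_measurable M" "\<phi> k \<in> borel_measurable M" for k
      using u(1) D_L2[OF D] by (auto simp: L2_def)
    have "L2_dist M (\<phi> k) u = sqrt (\<integral>x. (norm (\<phi> k x))\<^sup>2 \<partial>M)" for k
      unfolding L2_dist_def
    proof (intro arg_cong[of _ _ sqrt] integral_cong_AE)
      show "AE x in M. (norm (\<phi> k x - u x))\<^sup>2 = (norm (\<phi> k x))\<^sup>2"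
        using AE by eventually_elim simp
    qed measurable
    then have "L2_dist M (\<phi> k) u = 1" for k by (simp add: \<phi>_def \<psi>(2))
    with u(2) show False by (simp add: LIMSEQ_const_iff)
  qed
  ultimately show ?thesis
    unfolding is_eigenvalue_def by (intro bexI[of _ "(u, \<lambda>x. of_real ground * u x)"]) simp_all
qed

lemma first_eigenvalue_friedrichs: "first_eigenvalue M friedrichs = ground"
  unfolding first_eigenvalue_def
  by (rule Least_equality, rule is_eigenvalue_ground, erule ground_le_eigenvalue)

end

section \<open>The Dirichlet Laplacian as a Friedrichs extension\<close>

text \<open>The operator lives on the completed measure restricted to \<Omega>, the computations on
  \<open>lborel\<close> over the whole space. For Borel functions vanishing off \<Omega> the two
  agree.\<close>

lemma lebesgue_on_zero_outside:
  fixes f :: "'a::euclidean_space \<Rightarrow> 'b::{banach, second_countable_topology}"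
  assumes "\<Omega> \<in> sets borel" "f \<in> borel_measurable borel" "\<And>x. x \<notin> \<Omega> \<Longrightarrow> f x = 0"
  shows "integral\<^sup>L (lebesgue_on \<Omega>) f = integral\<^sup>L lborel f"
    "integrable (lebesgue_on \<Omega>) f \<longleftrightarrow> integrable lborel f"
    "f \<in> borel_measurable (lebesgue_on \<Omega>)"
proof -
  have eq: "(\<lambda>x. indicator \<Omega> x *\<^sub>R f x) = f"
    using assms(3) by (auto simp: indicator_def)
  have \<Omega>: "\<Omega> \<inter> space lebesgue \<in> sets lebesgue" using assms(1) by auto
  have f: "f \<in> borel_measurable lborel" using assms(2) by simp
  show "integral\<^sup>L (lebesgue_on \<Omega>) f = integral\<^sup>L lborel f"
    using integral_restrict_space[OF \<Omega>, of f] integral_completion[OF f] by (simp add: eq)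
  show "integrable (lebesgue_on \<Omega>) f \<longleftrightarrow> integrable lborel f"
    using integrable_restrict_space[OF \<Omega>, of f] integrable_completion[OF f] by (simp add: eq)
  show "f \<in> borel_measurable (lebesgue_on \<Omega>)"
    by (intro measurable_restrict_space1 measurable_completion f)
qed

lemma L2_lebesgue_on_test_function:
  assumes "open (\<Omega> :: 'a::euclidean_space set)" "\<phi> \<in> test_functions \<Omega>"
  shows "\<phi> \<in> L2 (lebesgue_on \<Omega>)"
    "(\<integral>x. (norm (\<phi> x))\<^sup>2 \<partial>lebesgue_on \<Omega>) = (\<integral>x. (norm (\<phi> x))\<^sup>2 \<partial>lborel)"
proof -
  note [measurable] = test_functions_borel_measurable[OF assms(2)]
  note out = test_functions_outside[OF assms(2)]
  have \<Omega>: "\<Omega> \<in> sets borel" using assms(1) by simp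
  have n: "(\<lambda>x. (norm (\<phi> x))\<^sup>2) \<in> borel_measurable borel" by measurable
  show "\<phi> \<in> L2 (lebesgue_on \<Omega>)"
    unfolding L2_def using lebesgue_on_zero_outside(3)[OF \<Omega> test_functions_borel_measurable[OF assms(2)] out]
      lebesgue_on_zero_outside(2)[OF \<Omega> n] test_functions_integrable_norm_power2[OF assms(2)] out by simp
  show "(\<integral>x. (norm (\<phi> x))\<^sup>2 \<partial>lebesgue_on \<Omega>) = (\<integral>x. (norm (\<phi> x))\<^sup>2 \<partial>lborel)"
    using lebesgue_on_zero_outside(1)[OF \<Omega> n] out by simp
qed

lemma L2_inner_lebesgue_on_test_functions:
  assumes "open (\<Omega> :: 'a::euclidean_space set)" "\<phi> \<in> test_functions \<Omega>" "\<psi> \<in> test_functions \<Omega>"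
  shows "L2_inner (lebesgue_on \<Omega>) \<phi> \<psi> = (\<integral>x. \<phi> x * cnj (\<psi> x) \<partial>lborel)"
proof -
  note [measurable] = test_functions_borel_measurable[OF assms(2)] test_functions_borel_measurable[OF assms(3)]
  have "(\<lambda>x. \<phi> x * cnj (\<psi> x)) \<in> borel_measurable borel" by measurable
  from lebesgue_on_zero_outside(1)[OF _ this] show ?thesis
    unfolding L2_inner_def using assms(1) test_functions_outside[OF assms(2)] by simp
qed

lemma Re_L2_inner_minus_laplacian:
  assumes "open (\<Omega> :: 'a::euclidean_space set)" "\<phi> \<in> test_functions \<Omega>"
  shows "Re (L2_inner (lebesgue_on \<Omega>) (\<lambda>x. - laplacian \<phi> x) \<phi>) = dirichlet_energy \<phi>"
  unfolding L2_inner_lebesgue_on_test_functions[OF assms(1) test_functions_minus_laplacian[OF assms(2)] assms(2)]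
    integral_minus_laplacian_mult_cnj_self[OF test_functions_UNIV[OF assms(2)]] by simp

text \<open>A zero integral would make the set where \<open>f\<close> is nonzero negligible, but
  that set is open and contains \<open>c\<close>.\<close>

lemma integral_pos_of_continuous:
  fixes f :: "'a::euclidean_space \<Rightarrow> real"
  assumes "continuous_on UNIV f" "integrable lborel f" "\<And>x. 0 \<le> f x" "0 < f c"
  shows "0 < (\<integral>x. f x \<partial>lborel)"
proof -
  have "(\<integral>x. f x \<partial>lborel) \<noteq> 0"
  proof
    assume "(\<integral>x. f x \<partial>lborel) = 0"
    then have "AE x in lborel. f x = 0"
      using assms by (subst (asm) integral_nonneg_eq_0_iff_AE) auto
    then have "AE x in lebesgue. f x = 0" by (rule AE_completion)
    moreover have op: "open {x. f x \<noteq> 0}"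
      using open_Collect_neq[OF assms(1) continuous_on_const] by simp
    then have "{x. f x \<noteq> 0} \<in> sets lebesgue" by simp
    ultimately have "negligible {x. f x \<noteq> 0}"
      using AE_iff_null_sets[of "{x. f x \<noteq> 0}" lebesgue] by (simp add: negligible_iff_null_sets)
    moreover have "f c \<noteq> 0" using assms(4) by simp
    then have "{x. f x \<noteq> 0} \<noteq> {}" by blast
    ultimately show False using open_not_negligible[OF op] by blast
  qed
  moreover have "0 \<le> (\<integral>x. f x \<partial>lborel)" using assms(3) by simp
  ultimately show ?thesis by linarith
qed

lemma exists_nonzero_test_function:
  assumes "open (\<Omega> :: 'a::euclidean_space set)" "\<Omega> \<noteq> {}"
  obtains \<phi> where "\<phi> \<in> test_functions \<Omega>" "0 < (\<integral>x. (norm (\<phi> x))\<^sup>2 \<partial>lborel)"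
proof -
  obtain c where "c \<in> \<Omega>" using assms(2) by blast
  then obtain \<rho> where \<rho>: "\<rho> > 0" "cball c \<rho> \<subseteq> \<Omega>"
    using assms(1) open_contains_cball by blast
  \<comment> \<open>A radial bump: \<open>flat_exp 0\<close> is positive exactly on positive
    arguments, that is, inside the open ball of radius \<rho>.\<close>
  define \<phi> where "\<phi> = (\<lambda>x. complex_of_real (flat_exp 0 (\<rho>\<^sup>2 + (- 1) * (norm (x - c))\<^sup>2)))"
  have \<phi>: "\<phi> \<in> test_functions \<Omega>"
  proof (rule test_functionsI[OF _ compact_cball \<rho>(2)])
    show "smooth \<phi>"
      unfolding \<phi>_def
      by (rule smooth_compose_bounded_linear[OF bounded_linear_of_real],
          rule smooth_compose_real[OF smooth_flat_exp],
          rule smooth_add[OF smooth_const smooth_cmult[OF smooth_norm_power2]])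
    fix x
    assume "x \<notin> cball c \<rho>"
    then have "\<rho>\<^sup>2 \<le> (norm (x - c))\<^sup>2"
      using \<rho>(1) by (intro power_mono) (auto simp: dist_norm norm_minus_commute)
    then show "\<phi> x = 0" by (simp add: \<phi>_def flat_exp_def)
  qed
  have "0 < (norm (\<phi> c))\<^sup>2" using \<rho>(1) by (simp add: \<phi>_def flat_exp_def)
  then have "0 < (\<integral>x. (norm (\<phi> x))\<^sup>2 \<partial>lborel)"
    by (intro integral_pos_of_continuous test_functions_integrable_norm_power2[OF \<phi>])
      (auto intro!: continuous_intros test_functions_continuous_on[OF \<phi>])
  with \<phi> show ?thesis by (rule that)
qed

text \<open>Green's identity gives symmetry and positivity. Boundedness of \<Omega> enters through
  \<open>rellich\<close>, nonemptiness through the bump function.\<close>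

lemma positive_operator_minus_laplacian:
  assumes \<Omega>: "open (\<Omega> :: 'a::euclidean_space set)" "bounded \<Omega>" "\<Omega> \<noteq> {}"
  shows "positive_operator_with_compact_embedding (lebesgue_on \<Omega>) (test_functions \<Omega>) (\<lambda>\<phi> x. - laplacian \<phi> x)"
proof
  note inner = L2_inner_lebesgue_on_test_functions[OF \<Omega>(1)]
  note UNIV = test_functions_UNIV
  note lap = test_functions_minus_laplacian
  fix \<phi> \<psi> :: "'a \<Rightarrow> complex" and c :: complex
  assume \<phi>: "\<phi> \<in> test_functions \<Omega>"
  show "\<phi> \<in> L2 (lebesgue_on \<Omega>)" "(\<lambda>x. - laplacian \<phi> x) \<in> L2 (lebesgue_on \<Omega>)"
    by (intro L2_lebesgue_on_test_function \<Omega> \<phi> lap)+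
  show "(\<lambda>x. c * \<phi> x) \<in> test_functions \<Omega>" by (rule test_functions_cmult[OF \<phi>])
  show "(\<lambda>x. - laplacian (\<lambda>x. c * \<phi> x) x) = (\<lambda>x. c * - laplacian \<phi> x)"
    by (simp add: laplacian_cmult[OF \<phi>])
  show "0 \<le> Re (L2_inner (lebesgue_on \<Omega>) (\<lambda>x. - laplacian \<phi> x) \<phi>)"
    using Re_L2_inner_minus_laplacian[OF \<Omega>(1) \<phi>] dirichlet_energy_nonneg by simp
  assume \<psi>: "\<psi> \<in> test_functions \<Omega>"
  show "(\<lambda>x. \<phi> x + \<psi> x) \<in> test_functions \<Omega>" by (rule test_functions_add[OF \<phi> \<psi>])
  show "(\<lambda>x. - laplacian (\<lambda>x. \<phi> x + \<psi> x) x) = (\<lambda>x. - laplacian \<phi> x + - laplacian \<psi> x)"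
    by (simp add: laplacian_add[OF \<phi> \<psi>])
  show "L2_inner (lebesgue_on \<Omega>) (\<lambda>x. - laplacian \<phi> x) \<psi> = cnj (L2_inner (lebesgue_on \<Omega>) (\<lambda>x. - laplacian \<psi> x) \<phi>)"
    unfolding inner[OF lap[OF \<phi>] \<psi>] inner[OF lap[OF \<psi>] \<phi>]
      integral_minus_laplacian_mult_cnj[OF UNIV[OF \<phi>] UNIV[OF \<psi>]]
      integral_minus_laplacian_mult_cnj[OF UNIV[OF \<psi>] UNIV[OF \<phi>]]
    by (simp add: mult.commute flip: Bochner_Integration.integral_cnj)
next
  fix s :: "nat \<Rightarrow> 'a \<Rightarrow> complex" and K :: real
  assume s: "\<And>k. s k \<in> test_functions \<Omega>" "\<And>k. (\<integral>x. (norm (s k x))\<^sup>2 \<partial>lebesgue_on \<Omega>) = 1"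
    "\<And>k. Re (L2_inner (lebesgue_on \<Omega>) (\<lambda>x. - laplacian (s k) x) (s k)) \<le> K"
  have n: "(\<integral>x. (norm (s k x))\<^sup>2 \<partial>lborel) \<le> 1" for k
    using s(2)[of k] L2_lebesgue_on_test_function(2)[OF \<Omega>(1) s(1)] by simp
  have E: "dirichlet_energy (s k) \<le> K" for k
    using s(3)[of k] Re_L2_inner_minus_laplacian[OF \<Omega>(1) s(1)] by simp
  obtain r :: "nat \<Rightarrow> nat" where r: "strict_mono r"
    "\<And>e. e > 0 \<Longrightarrow> \<exists>M. \<forall>j\<ge>M. \<forall>k\<ge>M. (\<integral>x. (norm (s (r j) x - s (r k) x))\<^sup>2 \<partial>lborel) < e"
    by (rule rellich[of \<Omega> s K, OF \<Omega>(2) s(1) n E]) blast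
  have "(\<integral>x. (norm (s j x - s k x))\<^sup>2 \<partial>lebesgue_on \<Omega>) = (\<integral>x. (norm (s j x - s k x))\<^sup>2 \<partial>lborel)" for j k
    by (rule L2_lebesgue_on_test_function(2)[OF \<Omega>(1) test_functions_diff[OF s(1) s(1)]])
  with r show "\<exists>r::nat \<Rightarrow> nat. strict_mono r \<and> (\<forall>e>0. \<exists>N. \<forall>j\<ge>N. \<forall>k\<ge>N. (\<integral>x. (norm (s (r j) x - s (r k) x))\<^sup>2 \<partial>lebesgue_on \<Omega>) < e)"
    by (intro exI[of _ r]) simp
next
  obtain \<phi> where "\<phi> \<in> test_functions \<Omega>" "0 < (\<integral>x. (norm (\<phi> x))\<^sup>2 \<partial>lborel)"
    using exists_nonzero_test_function[OF \<Omega>(1,3)] by blast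
  then show "\<exists>\<phi>\<in>test_functions \<Omega>. 0 < (\<integral>x. (norm (\<phi> x))\<^sup>2 \<partial>lebesgue_on \<Omega>)"
    using L2_lebesgue_on_test_function(2)[OF \<Omega>(1)] by (intro bexI[of _ \<phi>]) simp_all
qed

section \<open>The first Dirichlet eigenvalue as an infimum over test functions\<close>

definition dirichlet_quotients :: "'a::euclidean_space set \<Rightarrow> real set" where
  "dirichlet_quotients \<Omega> = {dirichlet_energy \<phi> / (\<integral>x. (norm (\<phi> x))\<^sup>2 \<partial>lborel) | \<phi>.
     \<phi> \<in> test_functions \<Omega> \<and> 0 < (\<integral>x. (norm (\<phi> x))\<^sup>2 \<partial>lborel)}"

lemma dirichlet_quotients_nonneg: "q \<in> dirichlet_quotients \<Omega> \<Longrightarrow> 0 \<le> q"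
  by (auto simp: dirichlet_quotients_def dirichlet_energy_nonneg)

lemma bdd_below_dirichlet_quotients: "bdd_below (dirichlet_quotients \<Omega>)"
  using dirichlet_quotients_nonneg by (auto simp: bdd_below_def)

lemma dirichlet_quotients_nonempty:
  "open (\<Omega> :: 'a::euclidean_space set) \<Longrightarrow> \<Omega> \<noteq> {} \<Longrightarrow> dirichlet_quotients \<Omega> \<noteq> {}"
  using exists_nonzero_test_function[of \<Omega>] unfolding dirichlet_quotients_def by blast

text \<open>Green's identity and extension by zero rewrite each quotient with integrals over the
  whole space, so that different \<Omega> become comparable.\<close>

lemma dirichlet_first_eigenvalue_eq_Inf:
  assumes \<Omega>: "open (\<Omega> :: 'a::euclidean_space set)" "bounded \<Omega>" "\<Omega> \<noteq> {}"
  shows "dirichlet_first_eigenvalue \<Omega> = Inf (dirichlet_quotients \<Omega>)"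
proof -
  interpret positive_operator_with_compact_embedding "lebesgue_on \<Omega>" "test_functions \<Omega>" "\<lambda>\<phi> x. - laplacian \<phi> x"
    by (rule positive_operator_minus_laplacian[OF \<Omega>])
  note energy = Re_L2_inner_minus_laplacian[OF \<Omega>(1)]
  have "rayleigh_quotients = dirichlet_quotients \<Omega>"
    unfolding rayleigh_quotients_def dirichlet_quotients_def
    using L2_lebesgue_on_test_function(2)[OF \<Omega>(1)] energy by (intro Collect_cong ex_cong1) auto
  then show ?thesis
    using first_eigenvalue_friedrichs
    by (simp add: dirichlet_first_eigenvalue_def dirichlet_laplacian_def minus_laplacian_test_def)
qed

lemma dirichlet_first_eigenvalue_antimono:
  assumes "open (\<Omega> :: 'a::euclidean_space set)" "\<Omega> \<noteq> {}" "open \<Omega>'" "bounded \<Omega>'" "\<Omega> \<subseteq> \<Omega>'"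
  shows "dirichlet_first_eigenvalue \<Omega>' \<le> dirichlet_first_eigenvalue \<Omega>"
proof -
  have "dirichlet_quotients \<Omega> \<subseteq> dirichlet_quotients \<Omega>'"
    using test_functions_mono[OF assms(5)] unfolding dirichlet_quotients_def by blast
  then have "Inf (dirichlet_quotients \<Omega>') \<le> Inf (dirichlet_quotients \<Omega>)"
    by (intro cInf_superset_mono dirichlet_quotients_nonempty bdd_below_dirichlet_quotients assms)
  then show ?thesis
    using dirichlet_first_eigenvalue_eq_Inf[OF assms(1) bounded_subset[OF assms(4,5)] assms(2)]
      dirichlet_first_eigenvalue_eq_Inf[OF assms(3,4)] assms(2,5) by (cases "\<Omega>' = {}") auto
qed

section \<open>Cutting out a small ball\<close>

text \<open>The step runs while the squared norm goes from 2 \<sigma>^2 to 3 \<sigma>^2. Starting at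
  2 rather than 1 keeps the support a positive distance from the inner sphere; ending at 3 < 4 makes
  the cutoff locally constant beyond radius 2 \<sigma>. The \<open>x - 0\<close> matches
  \<open>smooth_norm_power2\<close>.\<close>

definition radial_cutoff :: "real \<Rightarrow> 'a::euclidean_space \<Rightarrow> real" where
  "radial_cutoff \<sigma> x = smooth_step ((- 2) + 1 / \<sigma>\<^sup>2 * (norm (x - 0))\<^sup>2)"

lemma smooth_radial_cutoff: "smooth (radial_cutoff \<sigma> :: 'a::euclidean_space \<Rightarrow> real)"
  unfolding radial_cutoff_def[abs_def]
  by (rule smooth_compose_real[OF smooth_smooth_step],
      rule smooth_add[OF smooth_const smooth_cmult[OF smooth_norm_power2]])

lemma radial_cutoff_eq_0: "\<sigma> > 0 \<Longrightarrow> (norm x)\<^sup>2 \<le> 2 * \<sigma>\<^sup>2 \<Longrightarrow> radial_cutoff \<sigma> x = 0"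
  unfolding radial_cutoff_def by (rule smooth_step_eq_0) (simp add: field_simps)

lemma radial_cutoff_eq_1:
  assumes "\<sigma> > 0" "norm x > 2 * \<sigma>"
  shows "radial_cutoff \<sigma> x = 1"
proof -
  have "(2 * \<sigma>)\<^sup>2 \<le> (norm x)\<^sup>2" using assms by (intro power_mono) auto
  moreover have "3 * \<sigma>\<^sup>2 \<le> (2 * \<sigma>)\<^sup>2" by (simp add: power_mult_distrib)
  ultimately have "3 * \<sigma>\<^sup>2 \<le> (norm x)\<^sup>2" by linarith
  then show ?thesis
    unfolding radial_cutoff_def using assms(1) by (intro smooth_step_eq_1) (simp add: field_simps)
qed

lemma radial_cutoff_bounds: "0 \<le> radial_cutoff \<sigma> x" "radial_cutoff \<sigma> x \<le> 1"
  by (simp_all add: radial_cutoff_def smooth_step_bounds)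

text \<open>By the chain rule the partial derivative is that of the step applied to 2 (x, b) /
  \<sigma>^2. Where it does not vanish, the coordinate is at most 2 \<sigma>, which gives 4 B /
  \<sigma> with \<open>B\<close> bounding the derivative of the step, independently of
  \<sigma>.\<close>

lemma radial_cutoff_derivative:
  obtains B where "B \<ge> 0"
    "\<And>\<sigma> (x::'a::euclidean_space) b. \<sigma> > 0 \<Longrightarrow> b \<in> Basis \<Longrightarrow> norm (frechet_derivative (radial_cutoff \<sigma>) (at x) b) \<le> B / \<sigma>"
    "\<And>\<sigma> (x::'a) b. \<sigma> > 0 \<Longrightarrow> norm x > 2 * \<sigma> \<Longrightarrow> frechet_derivative (radial_cutoff \<sigma>) (at x) b = 0"
proof -
  obtain B where B: "\<And>t v. \<bar>frechet_derivative smooth_step (at t) v\<bar> \<le> B * \<bar>v\<bar>"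
    "\<And>t v. t < 0 \<or> t > 1 \<Longrightarrow> frechet_derivative smooth_step (at t) v = 0" "B \<ge> 0"
    by (rule smooth_step_derivative_bounded) blast
  have D: "frechet_derivative (radial_cutoff \<sigma>) (at x) v
      = frechet_derivative smooth_step (at (- 2 + 1 / \<sigma>\<^sup>2 * (norm (x - 0))\<^sup>2)) (2 * (x \<bullet> v) / \<sigma>\<^sup>2)" for \<sigma> and x v :: 'a
  proof -
    have "((\<lambda>x::'a. - 2 + 1 / \<sigma>\<^sup>2 * (norm (x - 0))\<^sup>2) has_derivative (\<lambda>v. 2 * (x \<bullet> v) / \<sigma>\<^sup>2)) (at x)"
    proof -
      have "((\<lambda>x::'a. (norm (x - 0))\<^sup>2) has_derivative (\<lambda>v. 2 * (x \<bullet> v))) (at x)"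
        unfolding power2_norm_eq_inner by (auto intro!: derivative_eq_intros simp: inner_commute)
      from has_derivative_add[OF has_derivative_const[of "- 2"] has_derivative_mult_right[OF this, of "1 / \<sigma>\<^sup>2"]]
      show ?thesis by simp
    qed
    from has_derivative_compose[OF this smooth_has_derivative[OF smooth_smooth_step]]
    show ?thesis
      unfolding radial_cutoff_def[abs_def] by (simp add: frechet_derivative_at[symmetric])
  qed
  have far: "frechet_derivative (radial_cutoff \<sigma>) (at x) b = 0" if "\<sigma> > 0" "norm x > 2 * \<sigma>" for \<sigma> and x b :: 'a
  proof -
    have "(2 * \<sigma>)\<^sup>2 \<le> (norm x)\<^sup>2" using that by (intro power_mono) auto
    moreover have "3 * \<sigma>\<^sup>2 < (2 * \<sigma>)\<^sup>2" using that(1) by (simp add: power_mult_distrib)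
    ultimately have "3 * \<sigma>\<^sup>2 < (norm x)\<^sup>2" by linarith
    then have "- 2 + 1 / \<sigma>\<^sup>2 * (norm (x - 0))\<^sup>2 > 1" using that(1) by (simp add: field_simps)
    then show ?thesis unfolding D using B(2) by blast
  qed
  have bound: "norm (frechet_derivative (radial_cutoff \<sigma>) (at x) b) \<le> 4 * B / \<sigma>" if "\<sigma> > 0" "b \<in> Basis" for \<sigma> and x b :: 'a
  proof (cases "norm x > 2 * \<sigma>")
    case True
    then show ?thesis using far that(1) B(3) by simp
  next
    case False
    have "\<bar>x \<bullet> b\<bar> \<le> 2 * \<sigma>" using Basis_le_norm[OF that(2), of x] False by linarith
    then have "\<bar>2 * (x \<bullet> b) / \<sigma>\<^sup>2\<bar> \<le> 4 / \<sigma>"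
      using that(1) by (simp add: abs_mult power2_eq_square field_simps)
    then have "B * \<bar>2 * (x \<bullet> b) / \<sigma>\<^sup>2\<bar> \<le> B * (4 / \<sigma>)" using B(3) by (rule mult_left_mono)
    then show ?thesis
      using order_trans[OF B(1)] unfolding D real_norm_def by (metis mult.commute times_divide_eq_right)
  qed
  show ?thesis using that[of "4 * B"] B(3) bound far by simp
qed

text \<open>The support stays away from the outer sphere because of \<open>K\<close> and from the
  inner one because the cutoff vanishes up to radius sqrt 2 times \<sigma>.\<close>

lemma test_functions_annulus_cutoff:
  assumes \<phi>: "\<phi> \<in> test_functions (ball 0 1 :: 'a::euclidean_space set)" and "\<sigma> > 0"
  shows "(\<lambda>x. of_real (radial_cutoff \<sigma> x) * \<phi> x) \<in> test_functions (unit_annulus \<sigma>)"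
proof -
  obtain K where K: "compact K" "K \<subseteq> ball 0 1" "\<And>x. x \<notin> K \<Longrightarrow> \<phi> x = 0"
    using test_functionsE[OF \<phi>] by metis
  define L where "L = K \<inter> {x. 2 * \<sigma>\<^sup>2 \<le> (norm x)\<^sup>2}"
  show ?thesis
  proof (rule test_functionsI)
    show "smooth (\<lambda>x. complex_of_real (radial_cutoff \<sigma> x) * \<phi> x)"
      by (rule smooth_mult[OF smooth_compose_bounded_linear[OF bounded_linear_of_real smooth_radial_cutoff]
            test_functions_smooth[OF \<phi>]])
    show "compact L"
      unfolding L_def using K(1) by (intro compact_Int_closed closed_Collect_le continuous_intros)
    show "L \<subseteq> unit_annulus \<sigma>"
    proof
      fix x
      assume x: "x \<in> L"
      have "\<sigma>\<^sup>2 < 2 * \<sigma>\<^sup>2" using \<open>\<sigma> > 0\<close> by simp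
      also have "\<dots> \<le> (norm x)\<^sup>2" using x by (simp add: L_def)
      finally have "\<sigma> < norm x" by (rule power_less_imp_less_base) simp
      moreover have "norm x < 1" using x K(2) by (auto simp: L_def)
      ultimately show "x \<in> unit_annulus \<sigma>" by (simp add: unit_annulus_def)
    qed
    show "complex_of_real (radial_cutoff \<sigma> x) * \<phi> x = 0" if "x \<notin> L" for x
      using that K(3)[of x] radial_cutoff_eq_0[OF \<open>\<sigma> > 0\<close>, of x] by (auto simp: L_def)
  qed
qed

text \<open>For \<sigma> at most 1 higher powers are smaller, so dimension at least 3 enters as a
  factor \<sigma>^3.\<close>

lemma measure_small_ball_le:
  assumes "3 \<le> DIM('a::euclidean_space)" "0 < \<sigma>" "\<sigma> \<le> 1"
  shows "measure lborel (cball (0::'a) (2 * \<sigma>)) \<le> unit_ball_vol DIM('a) * 2 ^ DIM('a) * \<sigma> ^ 3"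
proof -
  have "measure lborel (cball (0::'a) (2 * \<sigma>)) = unit_ball_vol DIM('a) * 2 ^ DIM('a) * \<sigma> ^ DIM('a)"
    using assms by (simp add: content_cball power_mult_distrib)
  also have "\<dots> \<le> unit_ball_vol DIM('a) * 2 ^ DIM('a) * \<sigma> ^ 3"
    using assms by (intro mult_left_mono power_decreasing) auto
  finally show ?thesis .
qed

text \<open>The functions differ only in the ball of radius 2 \<sigma>. There the gradient is
  O(1/\<sigma>) and the volume O(\<sigma>^3), so the energy error is O(\<sigma>). The constant
  depends on the given function but not on \<sigma>.\<close>

lemma annulus_approximation:
  assumes dim: "3 \<le> DIM('a::euclidean_space)" and \<phi>: "\<phi> \<in> test_functions (ball 0 1 :: 'a set)"
  obtains C where "\<And>\<sigma>. 0 < \<sigma> \<Longrightarrow> \<sigma> \<le> 1 \<Longrightarrow> \<exists>\<psi>\<in>test_functions (unit_annulus \<sigma> :: 'a set).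
      dirichlet_energy \<psi> \<le> dirichlet_energy \<phi> + C * \<sigma> \<and>
      (\<integral>x. (norm (\<phi> x))\<^sup>2 \<partial>lborel) - C * \<sigma> \<le> (\<integral>x. (norm (\<psi> x))\<^sup>2 \<partial>lborel)"
proof -
  obtain B where B: "B \<ge> 0"
    "\<And>\<sigma> (x::'a) b. \<sigma> > 0 \<Longrightarrow> b \<in> Basis \<Longrightarrow> norm (frechet_derivative (radial_cutoff \<sigma>) (at x) b) \<le> B / \<sigma>"
    "\<And>\<sigma> (x::'a) b. \<sigma> > 0 \<Longrightarrow> norm x > 2 * \<sigma> \<Longrightarrow> frechet_derivative (radial_cutoff \<sigma>) (at x) b = 0"
    by (rule radial_cutoff_derivative) blast
  obtain C0 where C0: "C0 > 0" "\<And>x. norm (\<phi> x) \<le> C0"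
    by (rule test_functions_bounded[OF \<phi>]) blast
  have "\<exists>c. c > 0 \<and> (\<forall>x. norm (partial_derivative b \<phi> x) \<le> c)" for b
    by (rule test_functions_bounded[OF test_functions_partial_derivative[OF \<phi>, of b]]) blast
  then obtain c where c: "\<And>b. c b > 0" "\<And>b x. norm (partial_derivative b \<phi> x) \<le> c b" by metis
  define C1 where "C1 = (\<Sum>b\<in>(Basis::'a set). c b)"
  have C1: "norm (partial_derivative b \<phi> x) \<le> C1" if "b \<in> Basis" for b x
    using c(2)[of b x] member_le_sum[OF that, of c] c(1) less_imp_le unfolding C1_def
    by (meson finite_Basis order_trans)
  have "C1 \<ge> 0" unfolding C1_def using c(1) by (intro sum_nonneg less_imp_le)
  define V where "V = unit_ball_vol DIM('a) * 2 ^ DIM('a)"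
  have "V \<ge> 0" by (simp add: V_def)
  \<comment> \<open>The product rule bounds a partial derivative by C1 + (B / \<sigma>) C0, which is
    at most A / \<sigma> because \<sigma> is at most 1.\<close>
  define A where "A = C1 + B * C0"
  \<comment> \<open>The first summand pays for the energy error, the second for the loss of L2
    norm.\<close>
  define C where "C = DIM('a) * A\<^sup>2 * V + C0\<^sup>2 * V"
  show ?thesis
  proof (rule that[of C])
    fix \<sigma> :: real
    assume \<sigma>: "0 < \<sigma>" "\<sigma> \<le> 1"
    define S where "S = cball (0::'a) (2 * \<sigma>)"
    have S: "S \<in> sets borel" "emeasure lborel S < \<infinity>" "measure lborel S \<le> V * \<sigma> ^ 3"
      using emeasure_lborel_cball_finite[of "0::'a" "2 * \<sigma>"] measure_small_ball_le[OF dim \<sigma>]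
      by (simp_all add: S_def V_def)
    have int_S: "integrable lborel (\<lambda>x. a * indicator S x)" for a :: real
      using S by (intro integrable_mult_right integrable_real_indicator) auto
    define \<psi> where "\<psi> = (\<lambda>x. of_real (radial_cutoff \<sigma> x) * \<phi> x)"
    have \<psi>: "\<psi> \<in> test_functions (unit_annulus \<sigma>)"
      unfolding \<psi>_def by (rule test_functions_annulus_cutoff[OF \<phi> \<sigma>(1)])
    have D\<psi>: "partial_derivative b \<psi> x = of_real (radial_cutoff \<sigma> x) * partial_derivative b \<phi> x
        + of_real (frechet_derivative (radial_cutoff \<sigma>) (at x) b) * \<phi> x" for b x
      unfolding \<psi>_def partial_derivative_def
        frechet_derivative_mult_smooth[OF smooth_compose_bounded_linear[OF bounded_linear_of_real smooth_radial_cutoff]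
          test_functions_smooth[OF \<phi>]]
        frechet_derivative_compose_bounded_linear[OF bounded_linear_of_real smooth_radial_cutoff] ..
    have pointwise: "(norm (partial_derivative b \<psi> x))\<^sup>2 \<le> (norm (partial_derivative b \<phi> x))\<^sup>2 + (A / \<sigma>)\<^sup>2 * indicator S x"
      if b: "b \<in> Basis" for b x
    proof (cases "x \<in> S")
      case True
      have "norm (partial_derivative b \<psi> x) \<le> \<bar>radial_cutoff \<sigma> x\<bar> * norm (partial_derivative b \<phi> x)
          + \<bar>frechet_derivative (radial_cutoff \<sigma>) (at x) b\<bar> * norm (\<phi> x)"
        unfolding D\<psi> by (rule order_trans[OF norm_triangle_ineq]) (simp add: norm_mult)
      also have "\<dots> \<le> 1 * C1 + (B / \<sigma>) * C0"
        using radial_cutoff_bounds[of \<sigma> x] B(2)[OF \<sigma>(1) b, of x] C0(2)[of x] C1[OF b, of x] B(1) \<sigma>(1)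
        by (intro add_mono mult_mono) auto
      also have "\<dots> \<le> A / \<sigma>"
      proof -
        have "C1 \<le> C1 / \<sigma>" using \<open>C1 \<ge> 0\<close> \<sigma> by (simp add: le_divide_eq mult_left_le)
        then show ?thesis by (simp add: A_def add_divide_distrib)
      qed
      finally have "(norm (partial_derivative b \<psi> x))\<^sup>2 \<le> (A / \<sigma>)\<^sup>2" by (intro power_mono) auto
      then show ?thesis using True by (simp add: add_increasing)
    next
      case False
      then have "norm x > 2 * \<sigma>" by (simp add: S_def)
      then show ?thesis using False by (simp add: D\<psi> radial_cutoff_eq_1[OF \<sigma>(1)] B(3)[OF \<sigma>(1)])
    qed
    have "dirichlet_energy \<psi> \<le> (\<integral>x. (\<Sum>b\<in>Basis. (norm (partial_derivative b \<phi> x))\<^sup>2) + DIM('a) * (A / \<sigma>)\<^sup>2 * indicator S x \<partial>lborel)"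
      unfolding dirichlet_energy_def
    proof (rule integral_mono)
      show "(\<Sum>b\<in>Basis. (norm (partial_derivative b \<psi> x))\<^sup>2)
          \<le> (\<Sum>b\<in>Basis. (norm (partial_derivative b \<phi> x))\<^sup>2) + DIM('a) * (A / \<sigma>)\<^sup>2 * indicator S x" for x
      proof -
        have "(\<Sum>b\<in>Basis. (norm (partial_derivative b \<psi> x))\<^sup>2)
            \<le> (\<Sum>b\<in>(Basis :: 'a set). (norm (partial_derivative b \<phi> x))\<^sup>2 + (A / \<sigma>)\<^sup>2 * indicator S x)"
          by (intro sum_mono pointwise)
        then show ?thesis by (simp add: sum.distrib)
      qed
    qed (intro Bochner_Integration.integrable_add test_functions_integrable_energy[OF \<phi>]
        test_functions_integrable_energy[OF \<psi>] int_S)+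
    also have "\<dots> = dirichlet_energy \<phi> + DIM('a) * (A / \<sigma>)\<^sup>2 * measure lborel S"
      unfolding dirichlet_energy_def using S
      by (subst Bochner_Integration.integral_add[OF test_functions_integrable_energy[OF \<phi>] int_S]) simp
    also have "DIM('a) * (A / \<sigma>)\<^sup>2 * measure lborel S \<le> DIM('a) * (A / \<sigma>)\<^sup>2 * (V * \<sigma> ^ 3)"
      using S(3) by (intro mult_left_mono) auto
    also have "\<dots> = DIM('a) * A\<^sup>2 * V * \<sigma>"
      using \<sigma>(1) by (simp add: power2_eq_square power3_eq_cube)
    also have "\<dots> \<le> C * \<sigma>"
      using \<sigma>(1) \<open>V \<ge> 0\<close> by (intro mult_right_mono) (simp_all add: C_def)
    finally have energy: "dirichlet_energy \<psi> \<le> dirichlet_energy \<phi> + C * \<sigma>" by simp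
    have pointwise': "(norm (\<phi> x))\<^sup>2 \<le> (norm (\<psi> x))\<^sup>2 + C0\<^sup>2 * indicator S x" for x
    proof (cases "x \<in> S")
      case True
      have "(norm (\<phi> x))\<^sup>2 \<le> C0\<^sup>2" using C0(2) by (intro power_mono) auto
      then show ?thesis using True by (simp add: add_increasing)
    next
      case False
      then show ?thesis by (simp add: \<psi>_def S_def radial_cutoff_eq_1[OF \<sigma>(1)])
    qed
    have "(\<integral>x. (norm (\<phi> x))\<^sup>2 \<partial>lborel) \<le> (\<integral>x. (norm (\<psi> x))\<^sup>2 + C0\<^sup>2 * indicator S x \<partial>lborel)"
      by (intro integral_mono Bochner_Integration.integrable_add test_functions_integrable_norm_power2[OF \<phi>]
          test_functions_integrable_norm_power2[OF \<psi>] int_S pointwise')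
    also have "\<dots> = (\<integral>x. (norm (\<psi> x))\<^sup>2 \<partial>lborel) + C0\<^sup>2 * measure lborel S"
      using S by (subst Bochner_Integration.integral_add[OF test_functions_integrable_norm_power2[OF \<psi>] int_S]) simp
    also have "C0\<^sup>2 * measure lborel S \<le> C0\<^sup>2 * (V * \<sigma> ^ 3)"
      using S(3) by (intro mult_left_mono) auto
    \<comment> \<open>The norm loss is even O(\<sigma>^3); it is weakened so that one constant
      serves both estimates.\<close>
    also have "\<dots> \<le> C0\<^sup>2 * (V * \<sigma> ^ 1)"
      using \<sigma> \<open>V \<ge> 0\<close> by (intro mult_left_mono power_decreasing) auto
    also have "\<dots> \<le> C * \<sigma>"
    proof -
      have "C0\<^sup>2 * V * \<sigma> \<le> C * \<sigma>"
        using \<sigma>(1) \<open>V \<ge> 0\<close> by (intro mult_right_mono) (simp_all add: C_def)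
      then show ?thesis by (simp add: mult.assoc)
    qed
    finally have "(\<integral>x. (norm (\<phi> x))\<^sup>2 \<partial>lborel) - C * \<sigma> \<le> (\<integral>x. (norm (\<psi> x))\<^sup>2 \<partial>lborel)" by simp
    with energy \<psi> show "\<exists>\<psi>\<in>test_functions (unit_annulus \<sigma> :: 'a set).
      dirichlet_energy \<psi> \<le> dirichlet_energy \<phi> + C * \<sigma> \<and>
      (\<integral>x. (norm (\<phi> x))\<^sup>2 \<partial>lborel) - C * \<sigma> \<le> (\<integral>x. (norm (\<psi> x))\<^sup>2 \<partial>lborel)"
      by blast
  qed
qed

section \<open>The limit of the eigenvalues of the annuli\<close>

lemma open_unit_annulus: "open (unit_annulus \<sigma> :: 'a::euclidean_space set)"
proof -
  have "unit_annulus \<sigma> = {x::'a. \<sigma> < norm x} \<inter> {x. norm x < 1}" by (auto simp: unit_annulus_def)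
  then show ?thesis by (simp only:) (intro open_Int open_Collect_less continuous_intros)
qed

lemma unit_annulus_subset_ball: "unit_annulus \<sigma> \<subseteq> ball 0 1"
  by (auto simp: unit_annulus_def)

lemma unit_annulus_nonempty:
  assumes "0 < \<sigma>" "\<sigma> < 1"
  shows "unit_annulus \<sigma> \<noteq> ({} :: 'a::euclidean_space set)"
proof -
  obtain b :: 'a where "b \<in> Basis" using nonempty_Basis by blast
  then have "((1 + \<sigma>) / 2) *\<^sub>R b \<in> unit_annulus \<sigma>" using assms by (simp add: unit_annulus_def)
  then show ?thesis by blast
qed

lemma dirichlet_first_eigenvalue_unit_annulus_tendsto:
  assumes dim: "3 \<le> DIM('a::euclidean_space)"
  shows "((\<lambda>\<sigma>. dirichlet_first_eigenvalue (unit_annulus \<sigma> :: 'a set))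
           \<longlongrightarrow> dirichlet_first_eigenvalue (ball 0 1 :: 'a set)) (at_right 0)"
proof (rule order_tendstoI)
  let ?m = "dirichlet_first_eigenvalue (ball 0 1 :: 'a set)"
  have small: "\<forall>\<^sub>F \<sigma>::real in at_right 0. 0 < \<sigma> \<and> \<sigma> < 1"
    by (rule eventually_at_rightI[of 0 1]) auto
  fix a
  assume "a < ?m"
  have "a < dirichlet_first_eigenvalue (unit_annulus \<sigma> :: 'a set)" if "0 < \<sigma> \<and> \<sigma> < 1" for \<sigma>
  proof (rule less_le_trans[OF \<open>a < ?m\<close>])
    show "?m \<le> dirichlet_first_eigenvalue (unit_annulus \<sigma> :: 'a set)"
      using that by (intro dirichlet_first_eigenvalue_antimono open_unit_annulus unit_annulus_nonempty
          unit_annulus_subset_ball) auto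
  qed
  with small show "\<forall>\<^sub>F \<sigma> in at_right 0. a < dirichlet_first_eigenvalue (unit_annulus \<sigma> :: 'a set)"
    by (rule eventually_mono)
next
  let ?m = "dirichlet_first_eigenvalue (ball 0 1 :: 'a set)"
  fix a
  assume "?m < a"
  moreover have "?m = Inf (dirichlet_quotients (ball 0 1 :: 'a set))"
    by (intro dirichlet_first_eigenvalue_eq_Inf) auto
  moreover have "dirichlet_quotients (ball 0 1 :: 'a set) \<noteq> {}"
    by (intro dirichlet_quotients_nonempty) auto
  \<comment> \<open>A test function with quotient strictly below \<open>a\<close> is fixed before
    \<sigma> shrinks, since the constant \<open>C\<close> depends on it.\<close>
  ultimately obtain q where "q \<in> dirichlet_quotients (ball 0 1 :: 'a set)" "q < a"
    using cInf_lessD by metis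
  then obtain \<phi> where \<phi>: "\<phi> \<in> test_functions (ball 0 1 :: 'a set)" "0 < (\<integral>x. (norm (\<phi> x))\<^sup>2 \<partial>lborel)"
    "dirichlet_energy \<phi> / (\<integral>x. (norm (\<phi> x))\<^sup>2 \<partial>lborel) < a"
    unfolding dirichlet_quotients_def by blast
  define n where "n = (\<integral>x. (norm (\<phi> x))\<^sup>2 \<partial>lborel)"
  obtain C where C: "\<And>\<sigma>. 0 < \<sigma> \<Longrightarrow> \<sigma> \<le> 1 \<Longrightarrow> \<exists>\<psi>\<in>test_functions (unit_annulus \<sigma> :: 'a set).
      dirichlet_energy \<psi> \<le> dirichlet_energy \<phi> + C * \<sigma> \<and> n - C * \<sigma> \<le> (\<integral>x. (norm (\<psi> x))\<^sup>2 \<partial>lborel)"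
    unfolding n_def by (rule annulus_approximation[OF dim \<phi>(1)]) blast
  have "n > 0" using \<phi>(2) by (simp add: n_def)
  \<comment> \<open>The upper bound for the modified quotient tends to the original quotient, the
    denominator having the positive limit \<open>n\<close>.\<close>
  have "((\<lambda>\<sigma>. (dirichlet_energy \<phi> + C * \<sigma>) / (n - C * \<sigma>)) \<longlongrightarrow> (dirichlet_energy \<phi> + C * 0) / (n - C * 0)) (at_right 0)"
    using \<open>n > 0\<close> by (intro tendsto_intros) auto
  then have lim1: "\<forall>\<^sub>F \<sigma> in at_right 0. (dirichlet_energy \<phi> + C * \<sigma>) / (n - C * \<sigma>) < a"
    by (rule order_tendstoD(2)) (use \<phi>(3) in \<open>simp add: n_def\<close>)
  have "((\<lambda>\<sigma>. n - C * \<sigma>) \<longlongrightarrow> n - C * 0) (at_right 0)" by (intro tendsto_intros)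
  then have lim2: "\<forall>\<^sub>F \<sigma> in at_right 0. 0 < n - C * \<sigma>"
    by (rule order_tendstoD(1)) (use \<open>n > 0\<close> in simp)
  have small: "\<forall>\<^sub>F \<sigma>::real in at_right 0. 0 < \<sigma> \<and> \<sigma> < 1"
    by (rule eventually_at_rightI[of 0 1]) auto
  show "\<forall>\<^sub>F \<sigma> in at_right 0. dirichlet_first_eigenvalue (unit_annulus \<sigma> :: 'a set) < a"
    using lim1 lim2 small
  proof eventually_elim
    case (elim \<sigma>)
    then obtain \<psi> where \<psi>: "\<psi> \<in> test_functions (unit_annulus \<sigma> :: 'a set)"
      "dirichlet_energy \<psi> \<le> dirichlet_energy \<phi> + C * \<sigma>" "n - C * \<sigma> \<le> (\<integral>x. (norm (\<psi> x))\<^sup>2 \<partial>lborel)"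
      using C[of \<sigma>] by auto
    have "dirichlet_first_eigenvalue (unit_annulus \<sigma> :: 'a set) = Inf (dirichlet_quotients (unit_annulus \<sigma> :: 'a set))"
      using elim bounded_subset[OF bounded_ball unit_annulus_subset_ball]
      by (intro dirichlet_first_eigenvalue_eq_Inf open_unit_annulus unit_annulus_nonempty) auto
    also have "\<dots> \<le> dirichlet_energy \<psi> / (\<integral>x. (norm (\<psi> x))\<^sup>2 \<partial>lborel)"
      using \<psi> elim by (intro cInf_lower bdd_below_dirichlet_quotients) (auto simp: dirichlet_quotients_def)
    also have "\<dots> \<le> (dirichlet_energy \<phi> + C * \<sigma>) / (n - C * \<sigma>)"
      using \<psi> elim dirichlet_energy_nonneg[of \<psi>] by (intro frac_le) auto
    also have "\<dots> < a" using elim by simp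
    finally show ?case .
  qed
qed

theorem mainTheorem5:
  assumes "3 \<le> CARD('n::finite)"
  shows "((\<lambda>\<sigma>. dirichlet_first_eigenvalue (unit_annulus \<sigma> :: (real ^ 'n) set))
           \<longlongrightarrow> dirichlet_first_eigenvalue (ball 0 1 :: (real ^ 'n) set)) (at_right 0)"
  by (rule dirichlet_first_eigenvalue_unit_annulus_tendsto) (use assms in simp)

end
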